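(* Let $G(x,L)\in A[L][[x]]$ be defined by $$G(x,L)=1-\sum_{k\ge1}\frac{(-L)^k}{k!}\sum_{\substack{C\in\mathcal R_{\rm dec}\\ b(C)\ge k}}\omega_C\,\hat a_C\,a_{d_{b(C)},\,b(C)-k}\,x^{\|C\|}.$$ Then $G$ is a (formal) solution of the analytic Dyson–Schwinger equation $$G(x,L)=1-\sum_{k\ge1}x^k\,G(x,\partial_{-\rho})^{1-sk}\,(e^{-L\rho}-1)F_k(\rho)\Big|_{\rho=0},\qquad F_k(\rho)=\sum_{l\ge0}a_{k,l}\rho^{l-1}.$$
   Context: Fix a commutative $\mathbb Q$-algebra $A$, an integer $s$, and elements $a_{k,i}\in A$ ($k\ge1$, $i\ge0$). For $y$ and $n\ge0$, $\binom{y}{n}=y(y-1)\cdots(y-n+1)/n!$. Meaning of the equation: for $H(x,L)=\sum_j c_j(x)L^j\in A[L][[x]]$ (each $x$-coefficient a polynomial in $L$) and $h(\rho)\in A[L][[\rho]]$, set $H(x,\partial_{-\rho})h(\rho)|_{\rho=0}:=\sum_j c_j(x)(-1)^j h^{(j)}(0)$ (derivatives in $\rho$). Since $G\equiv1 \pmod x$, $G^{1-sk}\in A[L][[x]]$ is defined by the binomial series, and $(e^{-L\rho}-1)F_k(\rho)\in A[L][[\rho]]$ because the simple pole cancels. Chord diagrams. A rooted chord diagram of size $n$ is a fixed-point-free involution $C$ of $\{1,\dots,2n\}$, viewed as $n$ chords (transpositions) $(x\,y)$ with $x<y$; the chord containing $1$ is the root chord; $|C|=n$. Chords $(x\,y),(x'\,y')$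 cross if $x<x'<y<y'$ or $x'<x<y'<y$. $C$ is connected if the graph whose vertices are the chords, with edges joining crossing chords, is connected. For a set of $m$ chords with $2m$ distinct positive integer endpoints, $\mathrm{norm}$ of it is the chord diagram on $\{1,\dots,2m\}$ obtained by replacing each endpoint by its rank among the $2m$ endpoints. Intersection order. The chords of a rooted connected chord diagram of size $n$ are labeled $1,\dots,n$ recursively: the root chord gets the first available label; the remaining chords split into connected components (w.r.t. crossing); the components are processed in increasing order of their smallest endpoint, each regarded as a rooted connected chord diagram rooted at its chord with smallest endpoint and labeled recursively with the next block of consecutive labels. "Chord $i$" means the chord with label $i$. Terminal and base chords. Chord $i$ is terminal if it crosses no chord $j$ with $j>i$. If $t_0<t_1<\dots<t_m$ are the terminal labels, the base chord is $b(C)=t_0$. Insertion of chord diagrams. For $C$ of size $n$ with chords $(x_1y_1),\dots,(x_ny_n)$, root $(x_1y_1)$ ($x_1=1$), $D$ of size $m$ with chords $(x'_iy'_i)$, and $1\le k\le 2m-1$, $C\circ_kD$ is the chord diagram of size $n+m$ with chords $(1,y_1+k)$, $(x_i+k,y_i+k)$ ($2\le i\le n$), $(H(x'_i),H(y'_i))$ ($1\le i\le m$), where $H(x)=x+1$ if $x\le k$ and $H(x)=x+2n$ otherwise. Root share decomposition. For rooted connected $C$ with $|C|\ge2$, let $C_1$ be the connected component (of the chords other than the root) having the smallest endpoint among such components. There is a unique $i$ with $C=C'\circ_iC''$, where $C'=\mathrm{norm}(C\setminus C_1)$, $C''=\mathrm{norm}(C_1)$. Trees. Trees are rooted plane binary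 trees (every non-leaf vertex has a left and a right child) with labeled leaves. For such $T,T'$ with $T'$ having $\ell$ leaves and $1\le k\le2\ell-1$: add a virtual edge above the root of $T'$, number it $1$, and number the other $2\ell-2$ edges $2,3,\dots$ in pre-order of their lower endpoints (left subtree before right). $T\circ_kT'$ is obtained by subdividing edge $k$ of $T'$ by a new vertex $v$, making the part of $T'$ below edge $k$ the right subtree of $v$ and $T$ the left subtree of $v$; leaf labels are kept. Insertion tree. If $|C|=1$, $T(C)$ is a single vertex labeled by the label of its chord; if $|C|\ge2$ with root share decomposition $C=C'\circ_iC''$, then $T(C)=T(C')\circ_iT(C'')$, where the leaves of $T(C'),T(C'')$ carry the intersection-order labels in $C$ of the corresponding chords. So the leaves of $T(C)$ are labeled bijectively by $1,\dots,|C|$. Branch-left vector. For a leaf $v$, $\nu_v$ is the number of edges in the path starting at $v$ and repeatedly moving to the parent as long as the current vertex is a right child. $\nu_i(C)$ is $\nu_v$ for the leaf $v$ of $T(C)$ labeled $i$. Decorations. A decorated chord diagram is a rooted connected chord diagram with a positive integer $d_i$ on each chord $i$; $\|C\|=\sum_id_i$; $\mathcal R_{\rm dec}$ is the set of all of them (labels, terminal chords, $T(C)$, $\nu$ ignore decorations). Weight and monomial. $\omega_C=\prod_{i=1}^{|C|}\binom{sd_i+\nu_i(C)-2}{\nu_i(C)}$. With terminal labels $t_0<\dots<t_m$, $\hat a_C=\prod_{c=1}^m a_{d_{t_c},t_c-t_{c-1}}\cdot\prod_{i\text{ non-terminal}}a_{d_i,0}$. (For each power of $x$ only finitely many $C$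 contribute, so $G\in A[L][[x]]$.) *)

theory Defs
  imports "HOL-Computational_Algebra.Formal_Power_Series"
          "HOL-Computational_Algebra.Formal_Laurent_Series"
          "HOL-Computational_Algebra.Polynomial"
begin

section \<open>Chord diagrams\<close>

text \<open>A chord is a pair (x,y) with x < y.  Chord diagrams of size n are given by
  fixed-point-free involutions of {1..2n} (extended by the identity outside {1..2n},
  so that the representation is canonical); internally we work with their sets of chords.\<close>

definition fpf_inv :: "nat \<Rightarrow> (nat \<Rightarrow> nat) \<Rightarrow> bool" where
  "fpf_inv n f \<longleftrightarrow>
     (\<forall>x\<in>{1..2*n}. f x \<in> {1..2*n} \<and> f x \<noteq> x \<and> f (f x) = x) \<and>
     (\<forall>x. x \<notin> {1..2*n} \<longrightarrow> f x = x)"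

definition chords :: "nat \<Rightarrow> (nat \<Rightarrow> nat) \<Rightarrow> (nat \<times> nat) set" where
  "chords n f = {(x, f x) | x. x \<in> {1..2*n} \<and> x < f x}"

definition crosses :: "nat \<times> nat \<Rightarrow> nat \<times> nat \<Rightarrow> bool" where
  "crosses c c' \<longleftrightarrow>
     (fst c < fst c' \<and> fst c' < snd c \<and> snd c < snd c') \<or>
     (fst c' < fst c \<and> fst c < snd c' \<and> snd c' < snd c)"

definition crel :: "(nat \<times> nat) set \<Rightarrow> ((nat \<times> nat) \<times> (nat \<times> nat)) set" where
  "crel R = {(c, c'). c \<in> R \<and> c' \<in> R \<and> crosses c c'}"

definition connected_cd :: "(nat \<times> nat) set \<Rightarrow> bool" where
  "connected_cd S \<longleftrightarrow> (\<forall>c\<in>S. \<forall>c'\<in>S. (c, c') \<in> (crel S)\<^sup>*)"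

text \<open>connected component of the chord c inside the chord set R\<close>
definition comp_of :: "(nat \<times> nat) set \<Rightarrow> nat \<times> nat \<Rightarrow> (nat \<times> nat) set" where
  "comp_of R c = {c' \<in> R. (c, c') \<in> (crel R)\<^sup>*}"

text \<open>the chord with the smallest endpoint\<close>
definition minch :: "(nat \<times> nat) set \<Rightarrow> nat \<times> nat" where
  "minch R = arg_min fst (\<lambda>c. c \<in> R)"

lemma comp_of_sub: "comp_of R c \<subseteq> R"
  unfolding comp_of_def by auto

lemma comp_of_mem: "c \<in> R \<Longrightarrow> c \<in> comp_of R c"
  unfolding comp_of_def by auto

section \<open>Intersection order\<close>

text \<open>iord R lists the chords of R in intersection order: the component containing the
  chord with smallest endpoint is processed first (rooted at that chord, recursively),
  then the remaining components.\<close>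

function iord :: "(nat \<times> nat) set \<Rightarrow> (nat \<times> nat) list" where
  "iord R = (if finite R \<and> minch R \<in> R then
      (let c = minch R; K = comp_of R c in c # iord (K - {c}) @ iord (R - K))
    else [])"
  by pat_completeness auto
termination
proof (relation "measure card", goal_cases)
  case 1 then show ?case by simp
next
  case (2 R c K)
  then have "K - {c} \<subset> R" using comp_of_sub[of R c] by auto
  with 2 show ?case by (simp add: psubset_card_mono)
next
  case (3 R c K)
  then have "R - K \<subset> R" using comp_of_mem[of c R] by auto
  with 3 show ?case by (simp add: psubset_card_mono)
qed

declare iord.simps[simp del]

text \<open>chord with label i (labels 1..|S|)\<close>
definition chord_lab :: "(nat \<times> nat) set \<Rightarrow> nat \<Rightarrow> nat \<times> nat" where
  "chord_lab S i = iord S ! (i - 1)"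

definition terminal :: "(nat \<times> nat) set \<Rightarrow> nat \<Rightarrow> bool" where
  "terminal S i \<longleftrightarrow> 1 \<le> i \<and> i \<le> card S \<and>
     \<not> (\<exists>j. i < j \<and> j \<le> card S \<and> crosses (chord_lab S i) (chord_lab S j))"

definition terminals :: "(nat \<times> nat) set \<Rightarrow> nat list" where
  "terminals S = sorted_list_of_set {i. terminal S i}"

definition base :: "(nat \<times> nat) set \<Rightarrow> nat" where
  "base S = Min {i. terminal S i}"

section \<open>Normalization and insertion of chord diagrams\<close>

definition cd_norm :: "(nat \<times> nat) set \<Rightarrow> (nat \<times> nat) set" where
  "cd_norm S = (let E = fst ` S \<union> snd ` S; rk = (\<lambda>x. card {y \<in> E. y \<le> x})
                in (\<lambda>(x, y). (rk x, rk y)) ` S)"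

text \<open>C \<circ>_k D for normalized C (size n, root chord (1,y1)) and D\<close>
definition cd_ins :: "(nat \<times> nat) set \<Rightarrow> nat \<Rightarrow> (nat \<times> nat) set \<Rightarrow> (nat \<times> nat) set" where
  "cd_ins C k D = (let n = card C; y1 = (THE y. (1, y) \<in> C);
       H = (\<lambda>x. if x \<le> k then x + 1 else x + 2 * n)
     in {(1, y1 + k)} \<union> {(x + k, y + k) | x y. (x, y) \<in> C \<and> x \<noteq> 1}
        \<union> {(H x, H y) | x y. (x, y) \<in> D})"

text \<open>Root share decomposition: C1 = first component of the non-root chords\<close>
definition rs_C1 :: "(nat \<times> nat) set \<Rightarrow> (nat \<times> nat) set" where
  "rs_C1 S = (let R = S - {minch S} in comp_of R (minch R))"

definition rs_idx :: "(nat \<times> nat) set \<Rightarrow> nat" where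
  "rs_idx S = (THE i. 1 \<le> i \<and> i \<le> 2 * card (rs_C1 S) - 1 \<and>
       cd_norm S = cd_ins (cd_norm (S - rs_C1 S)) i (cd_norm (rs_C1 S)))"

section \<open>Trees and the insertion tree\<close>

datatype 'b btree = BLeaf 'b | BNode "'b btree" "'b btree"

fun nverts :: "'b btree \<Rightarrow> nat" where
  "nverts (BLeaf _) = 1"
| "nverts (BNode l r) = 1 + nverts l + nverts r"

text \<open>graft T k T' = T \<circ>_k T': the edge k of T' (edge 1 = virtual edge above the root,
  others numbered in preorder of their lower endpoints) is the edge above the k-th vertex
  of T' in preorder; it is subdivided by a new vertex with left subtree T and right subtree
  the part of T' below.\<close>
fun graft :: "'b btree \<Rightarrow> nat \<Rightarrow> 'b btree \<Rightarrow> 'b btree" where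
  "graft T k (BLeaf a) = (if k = 1 then BNode T (BLeaf a) else BLeaf a)"
| "graft T k (BNode l r) =
     (if k = 1 then BNode T (BNode l r)
      else if k - 1 \<le> nverts l then BNode (graft T (k - 1) l) r
      else BNode l (graft T (k - 1 - nverts l) r))"

text \<open>Insertion tree, with leaves labelled by the chords themselves.\<close>
function itree :: "(nat \<times> nat) set \<Rightarrow> (nat \<times> nat) btree" where
  "itree S = (if finite S \<and> minch S \<in> S then
      (let r = minch S; R = S - {r} in
       if R = {} then BLeaf r
       else if minch R \<in> R then
         graft (itree (S - rs_C1 S)) (rs_idx S) (itree (rs_C1 S))
       else BLeaf r)
    else BLeaf undefined)"
  by pat_completeness auto
termination
proof (relation "measure card", goal_cases)
  case 1 then show ?case by simp
next
  case (2 S r R)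
  then have "S - rs_C1 S \<subset> S"
    using comp_of_mem[of "minch R" R] unfolding rs_C1_def Let_def by auto
  with 2 show ?case by (simp add: psubset_card_mono)
next
  case (3 S r R)
  then have "rs_C1 S \<subset> S"
    using comp_of_sub[of R "minch R"] unfolding rs_C1_def Let_def by auto
  with 3 show ?case by (simp add: psubset_card_mono)
qed

declare itree.simps[simp del]

text \<open>paths from the root to the leaves (True = step to a right child)\<close>
fun leafpaths :: "'b btree \<Rightarrow> ('b \<times> bool list) list" where
  "leafpaths (BLeaf a) = [(a, [])]"
| "leafpaths (BNode l r) =
     map (\<lambda>(a, p). (a, False # p)) (leafpaths l) @ map (\<lambda>(a, p). (a, True # p)) (leafpaths r)"

text \<open>branch-left vector: nu_v = number of trailing right steps on the path to v\<close>
definition nu :: "(nat \<times> nat) set \<Rightarrow> nat \<Rightarrow> nat" where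
  "nu S i = length (takeWhile id (rev (the (map_of (leafpaths (itree S)) (chord_lab S i)))))"

text \<open>In a Q-algebra, the inverse of a positive integer.\<close>
definition qinv :: "nat \<Rightarrow> 'a::comm_ring_1" where
  "qinv n = (SOME y. of_nat n * y = 1)"

text \<open>binom(y, n) = y(y-1)...(y-n+1)/n! for an integer y, in the Q-algebra\<close>
definition abinom :: "int \<Rightarrow> nat \<Rightarrow> 'a::comm_ring_1" where
  "abinom y n = (\<Prod>i<n. of_int (y - int i)) * qinv (fact n)"

section \<open>Decorated diagrams, weights, monomials\<close>

text \<open>Decorated rooted connected chord diagrams: (n, f, d) with f a fixed-point-free involution
  of {1..2n} (n \<ge> 1) whose chord diagram is connected and d the decoration (d i \<ge> 1 on
  the chord labelled i, canonically 0 outside {1..n}).\<close>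
definition Rdec :: "(nat \<times> (nat \<Rightarrow> nat) \<times> (nat \<Rightarrow> nat)) set" where
  "Rdec = {(n, f, d). n \<ge> 1 \<and> fpf_inv n f \<and> connected_cd (chords n f) \<and>
              (\<forall>i\<in>{1..n}. d i \<ge> 1) \<and> (\<forall>i. i \<notin> {1..n} \<longrightarrow> d i = 0)}"

definition dnorm :: "nat \<Rightarrow> (nat \<Rightarrow> nat) \<Rightarrow> nat" where
  "dnorm n d = (\<Sum>i\<in>{1..n}. d i)"

definition cd_weight :: "int \<Rightarrow> (nat \<times> nat) set \<Rightarrow> (nat \<Rightarrow> nat) \<Rightarrow> 'a::comm_ring_1" where
  "cd_weight s S d = (\<Prod>i\<in>{1..card S}. abinom (s * int (d i) + int (nu S i) - 2) (nu S i))"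

definition ahat :: "(nat \<Rightarrow> nat \<Rightarrow> 'a::comm_ring_1) \<Rightarrow> (nat \<times> nat) set \<Rightarrow> (nat \<Rightarrow> nat) \<Rightarrow> 'a" where
  "ahat a S d = (let t = terminals S in
     (\<Prod>c\<in>{1..<length t}. a (d (t ! c)) (t ! c - t ! (c - 1))) *
     (\<Prod>i\<in>{1..card S} - set t. a (d i) 0))"

section \<open>Rational inverses, the series G and the Dyson-Schwinger operator\<close>

text \<open>The variable L of A[L]\<close>
abbreviation polyL :: "'a::comm_ring_1 poly" where
  "polyL \<equiv> [:0, 1:]"

definition Gser :: "(nat \<Rightarrow> nat \<Rightarrow> 'a::comm_ring_1) \<Rightarrow> int \<Rightarrow> 'a poly fps" where
  "Gser a s = Abs_fps (\<lambda>N. (if N = 0 then 1 else 0) -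
     (\<Sum>k\<in>{1..N}. (- polyL) ^ k * smult (qinv (fact k))
        [: \<Sum>(n, f, d) \<in> {(n, f, d) \<in> Rdec. dnorm n d = N \<and> base (chords n f) \<ge> k}.
             cd_weight s (chords n f) d * ahat a (chords n f) d *
             a (d (base (chords n f))) (base (chords n f) - k) :]))"

text \<open>Binomial series G^alpha = sum_n (alpha choose n) (G - 1)^n for G = 1 mod x
  (the terms with n > N do not contribute to the coefficient of x^N).\<close>
definition fps_ipow :: "'a::comm_ring_1 fps \<Rightarrow> int \<Rightarrow> 'a fps" where
  "fps_ipow G \<alpha> = Abs_fps (\<lambda>N. \<Sum>n\<le>N. abinom \<alpha> n * ((G - 1) ^ n) $ N)"

text \<open>e^{-L rho} - 1 in A[L][[rho]]\<close>
definition expm1L :: "'a::comm_ring_1 poly fps" where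
  "expm1L = Abs_fps (\<lambda>n. if n = 0 then 0 else smult (qinv (fact n)) ((- polyL) ^ n))"

text \<open>F_k(rho) = sum_l a_{k,l} rho^(l-1), a Laurent series over A[L]\<close>
definition Fk :: "(nat \<Rightarrow> nat \<Rightarrow> 'a::comm_ring_1) \<Rightarrow> nat \<Rightarrow> 'a poly fls" where
  "Fk a k = fls_shift 1 (fps_to_fls (Abs_fps (\<lambda>l. [: a k l :])))"

text \<open>H(x, d_{-rho}) h(rho) |_{rho = 0} = sum_j c_j(x) (-1)^j h^(j)(0), with h^(j)(0) = j! h_j\<close>
definition apply_op :: "'a::comm_ring_1 poly fps \<Rightarrow> 'a poly fls \<Rightarrow> 'a poly fps" where
  "apply_op H h = Abs_fps (\<lambda>N. \<Sum>j\<le>degree (H $ N).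
       smult (coeff (H $ N) j * (- 1) ^ j * of_nat (fact j)) (fls_nth h (int j)))"

end

theory Submission
  imports Defs "HOL-Library.Multiset" "HOL-Computational_Algebra.Polynomial_FPS"
begin

text \<open>
  Let \<open>g\<close> be the coefficient of \<open>L\<close> in \<open>G\<close> and \<open>D = g (1 - s x \<partial>\<^sub>x)\<close>. The root share decomposition
  \<open>C = C' \<circ>\<^sub>k C''\<close> is a bijection between diagrams with at least two chords and triples
  \<open>(C', C'', k)\<close>. Under it the base chord of \<open>C\<close> is that of \<open>C''\<close>, its label raised by one, the
  monomial of \<open>C\<close> is the product of that of \<open>C''\<close> and the monomial with which \<open>C'\<close> enters \<open>g\<close>, and
  summing \<open>\<omega>\<close> over \<open>k\<close> multiplies \<open>\<omega>\<^bsub>C'\<^esub> \<omega>\<^bsub>C''\<^esub>\<close> by \<open>s \<parallel>C''\<parallel> - 1\<close>, because inserting at an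
  edge of the tree of \<open>C''\<close> raises exactly one branch-left number. Hence raising the base label by
  one is \<open>-D\<close>: the diagrams with base label \<open>j + 1\<close> and base decoration \<open>k\<close> sum to
  \<open>(-D)\<^sup>j x\<^sup>k\<close>, and \<open>\<partial>\<^sub>L G = D G\<close>. The binomial series gives the same flow equation for
  \<open>x\<^sup>k G\<^sup>1\<^sup>-\<^sup>s\<^sup>k\<close>, so its coefficient of \<open>L\<^sup>j\<close> is \<open>D\<^sup>j x\<^sup>k / j!\<close>, and the equation becomes the
  classification of diagrams by base label and base decoration.
\<close>

section \<open>Matchings and order isomorphisms\<close>

text \<open>The shape of the tree drops out of the sum over insertion edges because of the binomial
  weight. If f(v) is the weight of a leaf with decoration d and branch-left number v, then (v+1)
  f(v+1) = (s d - 1 + v) f(v). Exactly v+1 edges raise this number, namely the right chain ending in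
  the leaf and the edge above that chain, so the leaf contributes the factor s d - 1 + v. In a tree
  with n leaves the numbers v count the n - 1 right edges, so the total is the sum of all s d, minus
  1. The obstacle is bookkeeping: labels, trees and monomials belong to diagrams on 1..2n, whereas
  the two parts of a root share sit inside the larger diagram with gaps between their endpoints. All
  statistics are therefore shown to depend only on the relative order of endpoints, and the
  decomposition is carried out on subsets of a single chord set. On the analytic side the ring may
  have zero divisors, so the only divisions are by positive integers and by series with constant
  term 1.\<close>

definition endpts :: "(nat \<times> nat) set \<Rightarrow> nat set" where
  "endpts S = fst ` S \<union> snd ` S"

text \<open>The endpoints need not form an interval, so that subsets of a diagram qualify. Both
  orders of each pair are quantified, hence \<open>fst c \<noteq> snd c'\<close> also excludes
  \<open>snd c = fst c'\<close>.\<close>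

definition matching :: "(nat \<times> nat) set \<Rightarrow> bool" where
  "matching S \<longleftrightarrow> finite S \<and> (\<forall>c\<in>S. fst c < snd c) \<and>
     (\<forall>c\<in>S. \<forall>c'\<in>S. c \<noteq> c' \<longrightarrow> fst c \<noteq> fst c' \<and> fst c \<noteq> snd c' \<and> snd c \<noteq> snd c')"

lemma matching_finite: "matching S \<Longrightarrow> finite S"
  by (simp add: matching_def)

lemma matching_less: "matching S \<Longrightarrow> c \<in> S \<Longrightarrow> fst c < snd c"
  by (simp add: matching_def)

lemma matching_fst_eq: "matching S \<Longrightarrow> c \<in> S \<Longrightarrow> c' \<in> S \<Longrightarrow> fst c = fst c' \<Longrightarrow> c = c'"
  by (auto simp: matching_def)

lemma matching_snd_eq: "matching S \<Longrightarrow> c \<in> S \<Longrightarrow> c' \<in> S \<Longrightarrow> snd c = snd c' \<Longrightarrow> c = c'"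
  by (auto simp: matching_def)

lemma matching_fst_neq_snd: "matching S \<Longrightarrow> c \<in> S \<Longrightarrow> c' \<in> S \<Longrightarrow> fst c \<noteq> snd c'"
  by (metis matching_def less_irrefl)

lemma matching_subset: "matching S \<Longrightarrow> T \<subseteq> S \<Longrightarrow> matching T"
  unfolding matching_def by (meson finite_subset subsetD)

lemma endpts_mono: "T \<subseteq> S \<Longrightarrow> endpts T \<subseteq> endpts S"
  unfolding endpts_def by blast

lemma endptsI: "c \<in> S \<Longrightarrow> fst c \<in> endpts S" "c \<in> S \<Longrightarrow> snd c \<in> endpts S"
  unfolding endpts_def by auto

lemma endpts_Un: "endpts (S \<union> T) = endpts S \<union> endpts T"
  unfolding endpts_def by auto

lemma finite_endpts: "finite S \<Longrightarrow> finite (endpts S)"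
  unfolding endpts_def by auto

lemma card_endpts:
  assumes "matching S" shows "card (endpts S) = 2 * card S"
proof -
  have "inj_on fst S" "inj_on snd S"
    using matching_fst_eq[OF assms] matching_snd_eq[OF assms] by (meson inj_onI)+
  then have "card (fst ` S) = card S" "card (snd ` S) = card S"
    by (simp_all add: card_image)
  moreover have "fst ` S \<inter> snd ` S = {}"
    using matching_fst_neq_snd[OF assms] by auto
  ultimately show ?thesis
    unfolding endpts_def using matching_finite[OF assms] by (simp add: card_Un_disjoint)
qed

lemma minch_in: "S \<noteq> {} \<Longrightarrow> minch S \<in> S"
  unfolding minch_def using arg_min_natI[of "\<lambda>c. c \<in> S"] by blast

lemma minch_le: "c \<in> S \<Longrightarrow> fst (minch S) \<le> fst c"
  unfolding minch_def by (rule arg_min_nat_le)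

lemma minch_eqI:
  assumes "c \<in> S" "\<And>c'. c' \<in> S \<Longrightarrow> c' \<noteq> c \<Longrightarrow> fst c < fst c'"
  shows "minch S = c"
  using assms minch_in[of S] minch_le[of c S] by (metis empty_iff not_le)

lemma crosses_sym: "crosses c c' \<longleftrightarrow> crosses c' c"
  unfolding crosses_def by auto

lemma crel_mono: "T \<subseteq> S \<Longrightarrow> crel T \<subseteq> crel S"
  unfolding crel_def by auto

lemma crel_rtrancl_sym: "(c, c') \<in> (crel S)\<^sup>* \<Longrightarrow> (c', c) \<in> (crel S)\<^sup>*"
proof -
  have "sym (crel S)" unfolding crel_def sym_def using crosses_sym by auto
  then show "(c, c') \<in> (crel S)\<^sup>* \<Longrightarrow> (c', c) \<in> (crel S)\<^sup>*"
    by (meson sym_rtrancl symD)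
qed

text \<open>The form in which connectedness is exploited: a set of chords closed under crossing
  swallows the whole component of each of its chords.\<close>

lemma rtrancl_closed:
  assumes "(c, c') \<in> (crel S)\<^sup>*" "c \<in> T"
    and "\<And>x y. x \<in> T \<Longrightarrow> x \<in> S \<Longrightarrow> y \<in> S \<Longrightarrow> crosses x y \<Longrightarrow> y \<in> T"
  shows "c' \<in> T"
  using assms(1,2) by (induction) (auto simp: crel_def intro: assms(3))

lemma comp_of_connected: "connected_cd S \<Longrightarrow> c \<in> S \<Longrightarrow> comp_of S c = S"
  unfolding connected_cd_def comp_of_def by blast

text \<open>Crossing is symmetric, so any two chords are joined by a path through
  \<open>r\<close>.\<close>

lemma connected_rootI:
  assumes "\<And>c. c \<in> S \<Longrightarrow> (r, c) \<in> (crel S)\<^sup>*" shows "connected_cd S"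
  unfolding connected_cd_def by (meson assms crel_rtrancl_sym rtrancl_trans)

lemma connected_comp_of: "connected_cd (comp_of R c)"
proof (rule connected_rootI)
  fix c' assume "c' \<in> comp_of R c"
  then have "(c, c') \<in> (crel R)\<^sup>*" by (simp add: comp_of_def)
  then show "(c, c') \<in> (crel (comp_of R c))\<^sup>*"
  proof induction
    case (step y z)
    have "(y, z) \<in> crel (comp_of R c)"
      using step(1,2) unfolding crel_def comp_of_def
      by (auto intro: rtrancl_into_rtrancl simp: crel_def)
    with step(3) show ?case by (rule rtrancl_into_rtrancl)
  qed simp
qed

section \<open>Invariance under order-preserving renumbering of the endpoints\<close>

abbreviation relabel :: "(nat \<Rightarrow> nat) \<Rightarrow> nat \<times> nat \<Rightarrow> nat \<times> nat" where
  "relabel \<phi> \<equiv> map_prod \<phi> \<phi>"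

lemma endpts_relabel: "endpts (relabel \<phi> ` S) = \<phi> ` endpts S"
  unfolding endpts_def by (auto simp: image_iff) force+

lemma strict_mono_on_endpts_subset:
  "strict_mono_on (endpts S) \<phi> \<Longrightarrow> T \<subseteq> S \<Longrightarrow> strict_mono_on (endpts T) \<phi>"
  by (rule monotone_on_subset[OF _ endpts_mono])

context
  fixes \<phi> :: "nat \<Rightarrow> nat" and S :: "(nat \<times> nat) set"
  assumes mono: "strict_mono_on (endpts S) \<phi>"
begin

lemma relabel_less:
  "x \<in> endpts S \<Longrightarrow> y \<in> endpts S \<Longrightarrow> \<phi> x < \<phi> y \<longleftrightarrow> x < y"
  using mono by (meson strict_mono_on_less)

lemma relabel_eq:
  "x \<in> endpts S \<Longrightarrow> y \<in> endpts S \<Longrightarrow> \<phi> x = \<phi> y \<longleftrightarrow> x = y"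
  using relabel_less by (metis linorder_neq_iff)

lemma relabel_crosses: "c \<in> S \<Longrightarrow> c' \<in> S \<Longrightarrow> crosses (relabel \<phi> c) (relabel \<phi> c') \<longleftrightarrow> crosses c c'"
  unfolding crosses_def by (simp add: relabel_less endptsI)

lemma inj_on_relabel: "inj_on (relabel \<phi>) S"
  by (rule inj_onI) (metis endptsI fst_map_prod prod_eqI relabel_eq snd_map_prod)

lemma matching_relabel: "matching (relabel \<phi> ` S) \<longleftrightarrow> matching S"
proof -
  have "finite (relabel \<phi> ` S) \<longleftrightarrow> finite S"
    using inj_on_relabel by (rule finite_image_iff)
  moreover have "relabel \<phi> c \<noteq> relabel \<phi> c' \<longleftrightarrow> c \<noteq> c'" if "c \<in> S" "c' \<in> S" for c c'
    using inj_on_relabel that by (metis inj_onD)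
  ultimately show ?thesis
    unfolding matching_def by (simp add: relabel_less relabel_eq endptsI)
qed

lemma crel_relabel: "crel (relabel \<phi> ` S) = map_prod (relabel \<phi>) (relabel \<phi>) ` crel S"
  unfolding crel_def using relabel_crosses by (force simp: image_iff)

lemma crel_rtrancl_relabel:
  assumes "c \<in> S"
  shows "(relabel \<phi> c, e) \<in> (crel (relabel \<phi> ` S))\<^sup>* \<longleftrightarrow> (\<exists>c'\<in>S. e = relabel \<phi> c' \<and> (c, c') \<in> (crel S)\<^sup>*)"
proof
  assume "(relabel \<phi> c, e) \<in> (crel (relabel \<phi> ` S))\<^sup>*"
  then show "\<exists>c'\<in>S. e = relabel \<phi> c' \<and> (c, c') \<in> (crel S)\<^sup>*"
  proof induction
    case base then show ?case using assms by auto
  next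
    case (step y z)
    then obtain u v c' where u: "(u, v) \<in> crel S" "y = relabel \<phi> u" "z = relabel \<phi> v"
      and c': "c' \<in> S" "y = relabel \<phi> c'" "(c, c') \<in> (crel S)\<^sup>*"
      unfolding crel_relabel by auto
    have "u \<in> S" "v \<in> S" using u(1) by (auto simp: crel_def)
    then have "u = c'" using u(2) c' inj_on_relabel by (metis inj_onD)
    with u c' \<open>v \<in> S\<close> show ?case by (metis rtrancl_into_rtrancl)
  qed
next
  assume "\<exists>c'\<in>S. e = relabel \<phi> c' \<and> (c, c') \<in> (crel S)\<^sup>*"
  then obtain c' where "e = relabel \<phi> c'" and c': "(c, c') \<in> (crel S)\<^sup>*" by auto
  from c' have "(relabel \<phi> c, relabel \<phi> c') \<in> (crel (relabel \<phi> ` S))\<^sup>*"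
  proof induction
    case (step y z)
    then show ?case unfolding crel_relabel by (metis map_prod_imageI rtrancl_into_rtrancl)
  qed simp
  then show "(relabel \<phi> c, e) \<in> (crel (relabel \<phi> ` S))\<^sup>*" by (simp add: \<open>e = _\<close>)
qed

lemma comp_of_relabel:
  assumes "c \<in> S" shows "comp_of (relabel \<phi> ` S) (relabel \<phi> c) = relabel \<phi> ` comp_of S c"
proof (rule set_eqI)
  fix e
  have "e \<in> comp_of (relabel \<phi> ` S) (relabel \<phi> c) \<longleftrightarrow>
      e \<in> relabel \<phi> ` S \<and> (\<exists>c'\<in>S. e = relabel \<phi> c' \<and> (c, c') \<in> (crel S)\<^sup>*)"
    unfolding comp_of_def mem_Collect_eq crel_rtrancl_relabel[OF assms] ..
  also have "\<dots> \<longleftrightarrow> e \<in> relabel \<phi> ` comp_of S c"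
    unfolding comp_of_def image_iff Bex_def mem_Collect_eq by metis
  finally show "e \<in> comp_of (relabel \<phi> ` S) (relabel \<phi> c) \<longleftrightarrow> e \<in> relabel \<phi> ` comp_of S c" .
qed

lemma connected_relabel: "connected_cd (relabel \<phi> ` S) \<longleftrightarrow> connected_cd S"
proof -
  have conn: "connected_cd T \<longleftrightarrow> (\<forall>c\<in>T. comp_of T c = T)" for T
    unfolding connected_cd_def comp_of_def by blast
  have "relabel \<phi> ` comp_of S c = relabel \<phi> ` S \<longleftrightarrow> comp_of S c = S" for c
    by (rule inj_on_image_eq_iff[OF inj_on_relabel comp_of_sub subset_refl])
  then show ?thesis unfolding conn by (simp add: comp_of_relabel)
qed

lemma minch_relabel:
  assumes "matching S" "S \<noteq> {}"
  shows "minch (relabel \<phi> ` S) = relabel \<phi> (minch S)"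
proof (rule minch_eqI)
  show "relabel \<phi> (minch S) \<in> relabel \<phi> ` S" using minch_in assms by blast
next
  fix c' assume "c' \<in> relabel \<phi> ` S" "c' \<noteq> relabel \<phi> (minch S)"
  then obtain c where c: "c \<in> S" "c' = relabel \<phi> c" and "c \<noteq> minch S" by (metis imageE)
  then have "fst (minch S) < fst c"
    using minch_le[of c S] matching_fst_eq[OF assms(1) c(1) minch_in[OF assms(2)]] c(1)
    by (metis nat_less_le)
  then show "fst (relabel \<phi> (minch S)) < fst c'"
    using c relabel_less minch_in[OF assms(2)] by (simp add: endptsI)
qed

text \<open>Normalization records ranks only, and \<open>\<phi>\<close> maps the endpoints up to
  \<open>x\<close> bijectively onto the new endpoints up to \<open>\<phi> x\<close>.\<close>

lemma cd_norm_relabel: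
  assumes "finite S" shows "cd_norm (relabel \<phi> ` S) = cd_norm S"
proof -
  have rk: "card {y \<in> \<phi> ` endpts S. y \<le> \<phi> x} = card {y \<in> endpts S. y \<le> x}" if "x \<in> endpts S" for x
  proof -
    have "{y \<in> \<phi> ` endpts S. y \<le> \<phi> x} = \<phi> ` {y \<in> endpts S. y \<le> x}"
      using that relabel_less by (auto simp: not_less[symmetric])
    moreover have "inj_on \<phi> {y \<in> endpts S. y \<le> x}"
      by (rule inj_onI) (simp add: relabel_eq)
    ultimately show ?thesis by (simp add: card_image)
  qed
  have "cd_norm T = (\<lambda>c. (card {y \<in> endpts T. y \<le> fst c}, card {y \<in> endpts T. y \<le> snd c})) ` T" for T
    unfolding cd_norm_def endpts_def by (simp add: case_prod_beta')
  then show ?thesis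
    by (auto simp: endpts_relabel image_image rk endptsI intro!: image_cong)
qed

end

section \<open>Intersection order\<close>

lemma iord_empty [simp]: "iord {} = []"
  by (simp add: iord.simps)

lemma iord_rec:
  "finite R \<Longrightarrow> R \<noteq> {} \<Longrightarrow> iord R = minch R # iord (comp_of R (minch R) - {minch R})
      @ iord (R - comp_of R (minch R))"
  by (subst iord.simps) (simp add: Let_def minch_in)

lemma iord_enumerates: "finite R \<Longrightarrow> set (iord R) = R \<and> distinct (iord R)"
proof (induction "card R" arbitrary: R rule: less_induct)
  case less
  show ?case
  proof (cases "R = {}")
    case False
    let ?c = "minch R" and ?K = "comp_of R (minch R)"
    have c: "?c \<in> R" "?c \<in> ?K" "?K \<subseteq> R"
      using False by (auto simp: minch_in comp_of_mem comp_of_sub)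
    have "?K - {?c} \<subset> R" "R - ?K \<subset> R" using c by auto
    with less have "set (iord (?K - {?c})) = ?K - {?c} \<and> distinct (iord (?K - {?c}))"
      "set (iord (R - ?K)) = R - ?K \<and> distinct (iord (R - ?K))"
      by (meson finite_subset psubset_card_mono psubset_imp_subset)+
    then show ?thesis using c less.prems False by (auto simp: iord_rec)
  qed simp
qed

lemmas set_iord = iord_enumerates[THEN conjunct1]
lemmas distinct_iord = iord_enumerates[THEN conjunct2]

lemma length_iord: "finite R \<Longrightarrow> length (iord R) = card R"
  by (metis distinct_card iord_enumerates)

lemma iord_connected:
  assumes "finite S" "S \<noteq> {}" "connected_cd S"
  shows "iord S = minch S # iord (S - {minch S})"
  using iord_rec[OF assms(1,2)] comp_of_connected[OF assms(3)] minch_in[OF assms(2)] by simp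

lemma iord_relabel:
  "matching S \<Longrightarrow> strict_mono_on (endpts S) \<phi> \<Longrightarrow> iord (relabel \<phi> ` S) = map (relabel \<phi>) (iord S)"
proof (induction "card S" arbitrary: S rule: less_induct)
  case less
  note fin = matching_finite[OF less.prems(1)]
  show ?case
  proof (cases "S = {}")
    case False
    let ?c = "minch S" and ?K = "comp_of S (minch S)"
    have c: "?c \<in> S" "?c \<in> ?K" "?K \<subseteq> S"
      using False by (auto simp: minch_in comp_of_mem comp_of_sub)
    note inj = inj_on_relabel[OF less.prems(2)]
    have IH: "iord (relabel \<phi> ` T) = map (relabel \<phi>) (iord T)" if "T \<subset> S" for T
      using that less.hyps[of T] less.prems fin
      by (meson matching_subset psubset_card_mono psubset_imp_subset strict_mono_on_endpts_subset)
    have "relabel \<phi> ` ?K - {relabel \<phi> ?c} = relabel \<phi> ` (?K - {?c})"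
      "relabel \<phi> ` S - relabel \<phi> ` ?K = relabel \<phi> ` (S - ?K)"
      using inj_on_image_set_diff[OF inj, of ?K "{?c}"] inj_on_image_set_diff[OF inj, of S ?K] c by auto
    moreover have "?K - {?c} \<subset> S" "S - ?K \<subset> S" using c by auto
    ultimately show ?thesis
      using False fin c
      by (simp add: iord_rec[of S] iord_rec[of "relabel \<phi> ` S"] minch_relabel[OF less.prems(2,1)]
          comp_of_relabel[OF less.prems(2)] IH)
  qed simp
qed

lemma chord_lab_bij: "finite S \<Longrightarrow> bij_betw (chord_lab S) {1..card S} S"
proof -
  assume fin: "finite S"
  have "bij_betw ((!) (iord S)) {..<card S} S"
    by (rule bij_betw_nth) (auto simp: fin set_iord distinct_iord length_iord)
  moreover have "bij_betw (\<lambda>i. i - 1) {1..card S} {..<card S}"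
    by (rule bij_betw_byWitness[where f' = Suc]) auto
  ultimately have "bij_betw ((!) (iord S) \<circ> (\<lambda>i. i - 1)) {1..card S} S"
    by (rule bij_betw_trans[rotated])
  then show ?thesis by (simp add: chord_lab_def[abs_def] comp_def)
qed

lemma chord_lab_in: "finite S \<Longrightarrow> 1 \<le> i \<Longrightarrow> i \<le> card S \<Longrightarrow> chord_lab S i \<in> S"
  using bij_betw_apply[OF chord_lab_bij] by simp

lemma chord_lab_relabel:
  assumes "matching S" "strict_mono_on (endpts S) \<phi>" "1 \<le> i" "i \<le> card S"
  shows "chord_lab (relabel \<phi> ` S) i = relabel \<phi> (chord_lab S i)"
  using assms length_iord[OF matching_finite[OF assms(1)]]
  by (simp add: chord_lab_def iord_relabel)

definition chord_pos :: "(nat \<times> nat) set \<Rightarrow> nat \<times> nat \<Rightarrow> nat" where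
  "chord_pos S = inv_into {1..card S} (chord_lab S)"

lemma chord_pos_lab: "finite S \<Longrightarrow> 1 \<le> i \<Longrightarrow> i \<le> card S \<Longrightarrow> chord_pos S (chord_lab S i) = i"
  unfolding chord_pos_def
  by (rule inv_into_f_f) (use chord_lab_bij in \<open>auto simp: bij_betw_def\<close>)

lemma chord_lab_exists:
  assumes "finite S" "c \<in> S" obtains i where "1 \<le> i" "i \<le> card S" "c = chord_lab S i"
proof -
  from assms have "c \<in> chord_lab S ` {1..card S}" using chord_lab_bij[of S] by (simp add: bij_betw_def)
  then show thesis using that by (auto simp del: One_nat_def)
qed

lemma terminal_relabel:
  assumes "matching S" "strict_mono_on (endpts S) \<phi>"
  shows "terminal (relabel \<phi> ` S) = terminal S"
proof
  fix i
  have card: "card (relabel \<phi> ` S) = card S"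
    by (rule card_image[OF inj_on_relabel[OF assms(2)]])
  show "terminal (relabel \<phi> ` S) i = terminal S i"
    unfolding terminal_def card using assms chord_lab_in[OF matching_finite[OF assms(1)]]
    by (auto simp: chord_lab_relabel relabel_crosses)
qed

lemma base_relabel:
  assumes "matching S" "strict_mono_on (endpts S) \<phi>"
  shows "base (relabel \<phi> ` S) = base S"
  by (simp add: base_def terminal_relabel[OF assms])

lemma ahat_relabel:
  assumes "matching S" "strict_mono_on (endpts S) \<phi>"
  shows "ahat a (relabel \<phi> ` S) = ahat a S"
  by (rule ext) (simp add: ahat_def terminals_def terminal_relabel[OF assms]
      card_image[OF inj_on_relabel[OF assms(2)]])

section \<open>The root share decomposition\<close>

lemma terminalD:
  "terminal S i \<Longrightarrow> i < j \<Longrightarrow> j \<le> card S \<Longrightarrow> \<not> crosses (chord_lab S i) (chord_lab S j)"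
  unfolding terminal_def by blast

lemma terminalI:
  "1 \<le> i \<Longrightarrow> i \<le> card S \<Longrightarrow> (\<And>j. i < j \<Longrightarrow> j \<le> card S \<Longrightarrow> \<not> crosses (chord_lab S i) (chord_lab S j))
    \<Longrightarrow> terminal S i"
  unfolding terminal_def by blast

text \<open>\<open>P\<close> and \<open>Q\<close> are the parts C' and C'' of a root share, left in
  place inside one diagram. \<open>connQ\<close>, \<open>nocross\<close> and \<open>Qmin\<close>
  make \<open>Q\<close> the first component to be processed once \<open>r\<close> is removed;
  \<open>cross\<close> attaches it to the root.\<close>

locale root_share =
  fixes P Q :: "(nat \<times> nat) set" and r :: "nat \<times> nat"
  assumes matching: "matching (P \<union> Q)"
    and disjoint: "P \<inter> Q = {}"
    and connP: "connected_cd P" and connQ: "connected_cd Q"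
    and rP: "r \<in> P" and Qne: "Q \<noteq> {}"
    and rmin: "\<And>c. c \<in> P \<union> Q \<Longrightarrow> c \<noteq> r \<Longrightarrow> fst r < fst c"
    and Qmin: "\<And>c. c \<in> P \<Longrightarrow> c \<noteq> r \<Longrightarrow> fst (minch Q) < fst c"
    and nocross: "\<And>c q. c \<in> P \<Longrightarrow> c \<noteq> r \<Longrightarrow> q \<in> Q \<Longrightarrow> \<not> crosses c q"
    and cross: "\<exists>q\<in>Q. crosses r q"
begin

lemma finPQ: "finite P" "finite Q"
  using matching_finite[OF matching] by auto

lemma matchingPQ: "matching P" "matching Q"
  by (auto intro: matching_subset[OF matching])

lemma rQ: "r \<notin> Q"
  using rP disjoint by auto

lemma minch_union: "minch (P \<union> Q) = r"
  using rP rmin by (intro minch_eqI) auto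

lemma minch_P: "minch P = r"
  using rP rmin by (intro minch_eqI) auto

lemma fst_minch_Q_less: "q \<in> Q \<Longrightarrow> q \<noteq> minch Q \<Longrightarrow> fst (minch Q) < fst q"
  using matching_fst_eq[OF matchingPQ(2), of q "minch Q"] minch_in[OF Qne] minch_le[of q Q]
  by (metis le_neq_implies_less)

lemma minch_rest: "minch (P \<union> Q - {r}) = minch Q"
proof (rule minch_eqI)
  show "minch Q \<in> P \<union> Q - {r}" using minch_in[OF Qne] rQ by auto
next
  fix c assume "c \<in> P \<union> Q - {r}" "c \<noteq> minch Q"
  then show "fst (minch Q) < fst c" using Qmin[of c] fst_minch_Q_less[of c] by blast
qed

lemma comp_rest: "comp_of (P \<union> Q - {r}) (minch Q) = Q"
proof
  show "comp_of (P \<union> Q - {r}) (minch Q) \<subseteq> Q"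
  proof
    fix c assume "c \<in> comp_of (P \<union> Q - {r}) (minch Q)"
    then have "(minch Q, c) \<in> (crel (P \<union> Q - {r}))\<^sup>*" by (simp add: comp_of_def)
    then show "c \<in> Q"
    proof (rule rtrancl_closed)
      fix x y assume "x \<in> Q" "y \<in> P \<union> Q - {r}" "crosses x y"
      then show "y \<in> Q" using nocross[of y x] crosses_sym[of x y] by blast
    qed (rule minch_in[OF Qne])
  qed
  show "Q \<subseteq> comp_of (P \<union> Q - {r}) (minch Q)"
  proof
    fix c assume c: "c \<in> Q"
    then have "(minch Q, c) \<in> (crel Q)\<^sup>*" using connQ minch_in[OF Qne] by (simp add: connected_cd_def)
    moreover have "(crel Q)\<^sup>* \<subseteq> (crel (P \<union> Q - {r}))\<^sup>*" using rQ by (intro rtrancl_mono crel_mono) auto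
    moreover have "c \<in> P \<union> Q - {r}" using c rQ by blast
    ultimately show "c \<in> comp_of (P \<union> Q - {r}) (minch Q)"
      unfolding comp_of_def by (simp add: subsetD)
  qed
qed

lemma rs_C1_union: "rs_C1 (P \<union> Q) = Q"
  by (simp add: rs_C1_def minch_union minch_rest comp_rest)

lemma diff_rs_C1: "P \<union> Q - Q = P"
  using disjoint by auto

lemma connected_union: "connected_cd (P \<union> Q)"
proof (rule connected_rootI)
  have mono: "(crel P)\<^sup>* \<subseteq> (crel (P \<union> Q))\<^sup>*" "(crel Q)\<^sup>* \<subseteq> (crel (P \<union> Q))\<^sup>*"
    by (auto intro!: rtrancl_mono crel_mono)
  obtain q where q: "q \<in> Q" "crosses r q" using cross by auto
  then have "(r, q) \<in> crel (P \<union> Q)" using rP by (simp add: crel_def)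
  moreover have "(q, c) \<in> (crel (P \<union> Q))\<^sup>*" if "c \<in> Q" for c
    using that connQ q(1) mono by (auto simp: connected_cd_def)
  moreover have "(r, c) \<in> (crel (P \<union> Q))\<^sup>*" if "c \<in> P" for c
    using that connP rP mono by (auto simp: connected_cd_def)
  ultimately show "(r, c) \<in> (crel (P \<union> Q))\<^sup>*" if "c \<in> P \<union> Q" for c
    using that by (meson Un_iff converse_rtrancl_into_rtrancl)
qed

lemma iord_P: "iord P = r # iord (P - {r})"
  using iord_connected[of P] finPQ rP connP minch_P by auto

text \<open>Deleting \<open>r\<close> makes \<open>Q\<close> the first component, listed as one
  block; what follows is the recursion on \<open>P - {r}\<close>, which is also the tail of
  \<open>iord P\<close>. Hence both parts keep their internal order.\<close>

lemma iord_union: "iord (P \<union> Q) = r # iord Q @ iord (P - {r})"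
proof -
  have "iord (P \<union> Q) = r # iord (P \<union> Q - {r})"
    using iord_connected[of "P \<union> Q"] finPQ rP connected_union minch_union by auto
  also have "iord (P \<union> Q - {r}) = minch Q # iord (Q - {minch Q}) @ iord (P \<union> Q - {r} - Q)"
    using iord_rec[of "P \<union> Q - {r}"] finPQ Qne rQ by (auto simp: minch_rest comp_rest)
  also have "P \<union> Q - {r} - Q = P - {r}" using disjoint by auto
  finally show ?thesis
    using iord_connected[of Q] finPQ Qne connQ by simp
qed

lemma card_union: "card (P \<union> Q) = card P + card Q"
  using finPQ disjoint by (simp add: card_Un_disjoint)

lemma card_ge1: "1 \<le> card P" "1 \<le> card Q"
  using finPQ Qne rP by (auto simp: Suc_le_eq card_gt_0_iff)

lemma chord_lab_root: "chord_lab (P \<union> Q) (Suc 0) = r" "chord_lab P (Suc 0) = r"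
  by (simp_all add: chord_lab_def iord_union iord_P)

lemma chord_lab_Q: "1 \<le> i \<Longrightarrow> i \<le> card Q \<Longrightarrow> chord_lab (P \<union> Q) (Suc i) = chord_lab Q i"
  using length_iord[OF finPQ(2)]
  by (cases i) (simp_all add: chord_lab_def iord_union nth_append)

lemma chord_lab_P:
  assumes "2 \<le> i" "i \<le> card P" shows "chord_lab (P \<union> Q) (i + card Q) = chord_lab P i"
proof -
  have j: "i = Suc (Suc (i - 2))" using assms by simp
  show ?thesis using length_iord[OF finPQ(2)]
    by (subst (1 2) j) (simp add: chord_lab_def iord_union iord_P nth_append)
qed

lemma chord_lab_P_nonroot:
  assumes "2 \<le> i" "i \<le> card P" shows "chord_lab P i \<in> P - {r}"
proof -
  have "inj_on (chord_lab P) {1..card P}" using chord_lab_bij[OF finPQ(1)] by (simp add: bij_betw_def)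
  then have "chord_lab P i \<noteq> chord_lab P 1" using assms by (auto simp: inj_on_eq_iff)
  then show ?thesis using chord_lab_in[OF finPQ(1)] assms by (simp add: chord_lab_root)
qed

lemma label_cases:
  assumes "1 \<le> i" "i \<le> card P + card Q"
  obtains "i = 1" | j where "i = Suc j" "1 \<le> j" "j \<le> card Q"
  | j where "i = j + card Q" "2 \<le> j" "j \<le> card P"
proof -
  consider "i = 1" | "2 \<le> i \<and> i \<le> Suc (card Q)" | "Suc (card Q) < i" using assms by linarith
  then show thesis
  proof cases
    case 1 then show thesis by (rule that(1))
  next
    case 2 then show thesis by (intro that(2)[of "i - 1"]) auto
  next
    case 3 then show thesis using assms by (intro that(3)[of "i - card Q"]) auto
  qed
qed

lemma not_terminal_root: "\<not> terminal (P \<union> Q) (Suc 0)"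
proof -
  obtain q where q: "q \<in> Q" "crosses r q" using cross by auto
  obtain i where i: "1 \<le> i" "i \<le> card Q" "q = chord_lab Q i"
    using chord_lab_exists[OF finPQ(2) q(1)] .
  have "Suc 0 < Suc i" "Suc i \<le> card (P \<union> Q)"
    "crosses (chord_lab (P \<union> Q) (Suc 0)) (chord_lab (P \<union> Q) (Suc i))"
    using i q chord_lab_Q[of i] card_ge1 by (auto simp: chord_lab_root card_union)
  then show ?thesis unfolding terminal_def by blast
qed

text \<open>The chords with later labels that do not lie in \<open>Q\<close> come from
  \<open>P - {r}\<close> and do not cross \<open>Q\<close>, while the root, which may cross, has the
  smaller label 1.\<close>

lemma terminal_Q:
  assumes i: "1 \<le> i" "i \<le> card Q" shows "terminal (P \<union> Q) (Suc i) \<longleftrightarrow> terminal Q i"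
proof
  assume t: "terminal (P \<union> Q) (Suc i)"
  show "terminal Q i"
  proof (rule terminalI[OF i])
    fix j assume j: "i < j" "j \<le> card Q"
    have "\<not> crosses (chord_lab (P \<union> Q) (Suc i)) (chord_lab (P \<union> Q) (Suc j))"
      using terminalD[OF t, of "Suc j"] j card_ge1 by (simp add: card_union)
    then show "\<not> crosses (chord_lab Q i) (chord_lab Q j)" using i j by (simp add: chord_lab_Q)
  qed
next
  assume t: "terminal Q i"
  show "terminal (P \<union> Q) (Suc i)"
  proof (rule terminalI)
    show "1 \<le> Suc i" "Suc i \<le> card (P \<union> Q)" using i card_ge1 by (auto simp: card_union)
    fix j assume j: "Suc i < j" "j \<le> card (P \<union> Q)"
    have "1 \<le> j" "j \<le> card P + card Q" using j by (auto simp: card_union)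
    then show "\<not> crosses (chord_lab (P \<union> Q) (Suc i)) (chord_lab (P \<union> Q) j)"
    proof (cases rule: label_cases)
      case 1 then show ?thesis using j by simp
    next
      case (2 l)
      then show ?thesis using terminalD[OF t, of l] j i by (simp add: chord_lab_Q)
    next
      case (3 l)
      then have "\<not> crosses (chord_lab P l) (chord_lab Q i)"
        using nocross[of "chord_lab P l" "chord_lab Q i"] chord_lab_P_nonroot[of l]
          chord_lab_in[OF finPQ(2) i] by blast
      then show ?thesis using 3 i by (simp add: chord_lab_Q chord_lab_P crosses_sym)
    qed
  qed
qed

text \<open>For \<open>i \<ge> 2\<close> all chords with a later label lie in \<open>P\<close>, so
  \<open>Q\<close> cannot interfere.\<close>

lemma terminal_P:
  assumes i: "2 \<le> i" "i \<le> card P" shows "terminal (P \<union> Q) (i + card Q) \<longleftrightarrow> terminal P i"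
proof
  assume t: "terminal (P \<union> Q) (i + card Q)"
  show "terminal P i"
  proof (rule terminalI)
    fix j assume j: "i < j" "j \<le> card P"
    then show "\<not> crosses (chord_lab P i) (chord_lab P j)"
      using terminalD[OF t, of "j + card Q"] i by (simp add: chord_lab_P card_union)
  qed (use i in auto)
next
  assume t: "terminal P i"
  show "terminal (P \<union> Q) (i + card Q)"
  proof (rule terminalI)
    show "1 \<le> i + card Q" "i + card Q \<le> card (P \<union> Q)" using i by (auto simp: card_union)
    fix j assume j: "i + card Q < j" "j \<le> card (P \<union> Q)"
    then obtain l where l: "j = l + card Q" by (metis add.commute less_imp_add_positive add.assoc)
    then show "\<not> crosses (chord_lab (P \<union> Q) (i + card Q)) (chord_lab (P \<union> Q) j)"
      using terminalD[OF t, of l] j i by (simp add: chord_lab_P card_union)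
  qed
qed

end

section \<open>Terminal labels and the monomial\<close>

lemma terminal_last: "S \<noteq> {} \<Longrightarrow> finite S \<Longrightarrow> terminal S (card S)"
  unfolding terminal_def by (auto simp: Suc_le_eq card_gt_0_iff)

lemma finite_terminal: "finite {i. terminal S i}"
  by (rule finite_subset[of _ "{..card S}"]) (auto simp: terminal_def)

lemma terminals_props:
  "set (terminals S) = {i. terminal S i}" "sorted_wrt (<) (terminals S)"
  by (simp_all add: terminals_def finite_terminal)

lemma terminals_eqI:
  assumes "sorted_wrt (<) xs" "set xs = {i. terminal S i}" shows "terminals S = xs"
  by (rule strict_sorted_equal) (use assms terminals_props in auto)

lemma terminals_nonempty: "S \<noteq> {} \<Longrightarrow> finite S \<Longrightarrow> terminals S \<noteq> []"
  using terminal_last[of S] terminals_props(1)[of S] by auto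

lemma base_hd:
  assumes "S \<noteq> {}" "finite S" shows "base S = hd (terminals S)"
proof -
  obtain x xs where x: "terminals S = x # xs" using terminals_nonempty[OF assms] by (cases "terminals S") auto
  show ?thesis unfolding base_def terminals_props(1)[symmetric] x
    using terminals_props(2)[of S] x by (auto intro!: Min_eqI simp: less_imp_le)
qed

lemma last_terminals:
  assumes "S \<noteq> {}" "finite S" shows "last (terminals S) = card S"
proof -
  obtain x xs where x: "terminals S = xs @ [x]"
    using terminals_nonempty[OF assms] by (cases "terminals S" rule: rev_cases) auto
  have "card S \<in> set (terminals S)" using terminal_last[OF assms] terminals_props(1) by auto
  moreover have "x \<le> card S" using terminals_props(1)[of S] x by (auto simp: terminal_def)
  ultimately show ?thesis using terminals_props(2)[of S] x by (auto simp: sorted_wrt_append)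
qed

lemma base_bounds:
  assumes "S \<noteq> {}" "finite S" shows "terminal S (base S)" "1 \<le> base S" "base S \<le> card S"
proof -
  show "terminal S (base S)"
    using base_hd[OF assms] terminals_nonempty[OF assms] terminals_props(1)[of S] hd_in_set by fastforce
  then show "1 \<le> base S" "base S \<le> card S" by (auto simp: terminal_def)
qed

lemma root_not_terminal:
  assumes "matching S" "connected_cd S" "2 \<le> card S" shows "\<not> terminal S (Suc 0)"
proof -
  note fin = matching_finite[OF assms(1)]
  have ne: "S \<noteq> {}" using assms by auto
  have root: "chord_lab S (Suc 0) = minch S"
    using iord_connected[OF fin ne assms(2)] by (simp add: chord_lab_def)
  have "chord_lab S 2 \<in> S" "chord_lab S 2 \<noteq> minch S"
    using chord_lab_in[OF fin, of 2] chord_lab_bij[OF fin] assms(3) root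
    unfolding bij_betw_def by (auto dest: inj_onD[of _ _ 2 "Suc 0"])
  then have "(minch S, chord_lab S 2) \<in> (crel S)\<^sup>+"
    using assms(2) minch_in[OF ne] unfolding connected_cd_def by (metis rtranclD)
  then obtain c where "(minch S, c) \<in> crel S" by (meson tranclD)
  then have c: "c \<in> S" "crosses (minch S) c" by (auto simp: crel_def)
  then obtain i where i: "1 \<le> i" "i \<le> card S" "c = chord_lab S i" using chord_lab_exists[OF fin] by metis
  have "i \<noteq> 1" using c i root by (auto simp: crosses_def)
  then show ?thesis using c i root unfolding terminal_def by (metis One_nat_def le_neq_implies_less)
qed

text \<open>The product over consecutive terminal labels in \<open>ahat\<close>, in a form that can
  be split along a concatenation of label lists.\<close>

fun consec_prod :: "(nat \<Rightarrow> nat \<Rightarrow> 'a) \<Rightarrow> nat list \<Rightarrow> 'a::comm_ring_1" where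
  "consec_prod f (x # y # xs) = f x y * consec_prod f (y # xs)"
| "consec_prod f _ = 1"

lemma consec_prod_append:
  "xs \<noteq> [] \<Longrightarrow> ys \<noteq> [] \<Longrightarrow>
    consec_prod f (xs @ ys) = consec_prod f xs * f (last xs) (hd ys) * consec_prod f ys"
proof (induction f xs rule: consec_prod.induct)
  case (1 f x y xs)
  then show ?case by (simp add: mult.assoc)
next
  case ("2_2" f v)
  then show ?case by (cases ys) simp_all
qed simp

lemma consec_prod_map: "consec_prod f (map g xs) = consec_prod (\<lambda>x y. f (g x) (g y)) xs"
  by (induction "\<lambda>x y. f (g x) (g y)" xs rule: consec_prod.induct) auto

lemma consec_prod_cong:
  "(\<And>x y. x \<in> set xs \<Longrightarrow> y \<in> set xs \<Longrightarrow> f x y = g x y) \<Longrightarrow> consec_prod f xs = consec_prod g xs"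
  by (induction f xs rule: consec_prod.induct) auto

lemma prod_consec: "(\<Prod>c\<in>{1..<length t}. f (t ! (c - 1)) (t ! c)) = consec_prod f t"
proof (induction f t rule: consec_prod.induct)
  case (1 f x y xs)
  have "(\<Prod>c\<in>{1..<length (x # y # xs)}. f ((x # y # xs) ! (c - 1)) ((x # y # xs) ! c))
      = f x y * (\<Prod>c\<in>{Suc 1..<Suc (length (y # xs))}. f ((x # y # xs) ! (c - 1)) ((x # y # xs) ! c))"
    by (subst prod.atLeast_Suc_lessThan) auto
  also have "(\<Prod>c\<in>{Suc 1..<Suc (length (y # xs))}. f ((x # y # xs) ! (c - 1)) ((x # y # xs) ! c))
      = (\<Prod>c\<in>{1..<length (y # xs)}. f ((y # xs) ! (c - 1)) ((y # xs) ! c))"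
    by (subst prod.atLeast_Suc_lessThan_Suc_shift) (auto intro!: prod.cong simp: nth_Cons')
  finally show ?case using 1 by simp
qed auto

lemma ahat_consec:
  "ahat a S d = consec_prod (\<lambda>x y. a (d y) (y - x)) (terminals S) *
     (\<Prod>i\<in>{1..card S} - {i. terminal S i}. a (d i) 0)"
  unfolding ahat_def Let_def terminals_props(1)
  using prod_consec[of "\<lambda>x y. a (d y) (y - x)" "terminals S"] by simp

text \<open>Labels of a root share \<open>C' \<circ> C''\<close>: the root of \<open>C'\<close>, then the \<open>m\<close> chords of \<open>C''\<close>,
  then the remaining chords of \<open>C'\<close>.\<close>
definition djoin :: "nat \<Rightarrow> (nat \<Rightarrow> nat) \<Rightarrow> (nat \<Rightarrow> nat) \<Rightarrow> nat \<Rightarrow> nat" where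
  "djoin m d' d'' i = (if i = 1 then d' 1 else if i \<le> Suc m then d'' (i - 1) else d' (i - m))"

lemma djoin_simps:
  "djoin m d' d'' (Suc 0) = d' (Suc 0)"
  "1 \<le> i \<Longrightarrow> i \<le> m \<Longrightarrow> djoin m d' d'' (Suc i) = d'' i"
  "2 \<le> i \<Longrightarrow> djoin m d' d'' (i + m) = d' i"
  by (auto simp: djoin_def)

context root_share begin

text \<open>If \<open>P\<close> is a single chord, its label is terminal in \<open>P\<close> but not
  in the union, where the root crosses \<open>Q\<close>; no other terminal label is ever
  lost.\<close>

lemma terminals_union:
  "terminals (P \<union> Q) = map Suc (terminals Q) @
     (if card P = 1 then [] else map (\<lambda>i. i + card Q) (terminals P))"
proof (rule terminals_eqI)
  have P2: "2 \<le> i" if "card P \<noteq> 1" "terminal P i" for i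
  proof -
    have "\<not> terminal P (Suc 0)"
      using root_not_terminal[OF matchingPQ(1) connP] that card_ge1 by simp
    then show ?thesis using that(2) by (cases "i = 1") (auto simp: terminal_def)
  qed
  have Qb: "terminal Q i \<Longrightarrow> i \<le> card Q" for i by (simp add: terminal_def)
  show "sorted_wrt (<) (map Suc (terminals Q) @
     (if card P = 1 then [] else map (\<lambda>i. i + card Q) (terminals P)))"
    using terminals_props(2) P2 Qb by (fastforce simp: sorted_wrt_append sorted_wrt_map terminals_props(1))
  have "terminal (P \<union> Q) i \<longleftrightarrow> (\<exists>j. i = Suc j \<and> terminal Q j) \<or>
      (card P \<noteq> 1 \<and> (\<exists>j. i = j + card Q \<and> terminal P j))" (is "?L \<longleftrightarrow> ?R") for i
  proof
    assume t: ?L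
    then have "1 \<le> i" "i \<le> card P + card Q" by (auto simp: terminal_def card_union)
    then show ?R
    proof (cases rule: label_cases)
      case 1 then show ?thesis using t not_terminal_root by simp
    next
      case (2 j) then show ?thesis using t terminal_Q by auto
    next
      case (3 j) then show ?thesis using t terminal_P[of j] by auto
    qed
  next
    assume ?R
    then consider j where "i = Suc j" "terminal Q j" | j where "card P \<noteq> 1" "i = j + card Q" "terminal P j" by auto
    then show ?L
    proof cases
      case 1 then show ?thesis using terminal_Q[of j] by (auto simp: terminal_def[of Q])
    next
      case 2 then show ?thesis using terminal_P[of j] P2[of j] by (auto simp: terminal_def[of P])
    qed
  qed
  then show "set (map Suc (terminals Q) @ (if card P = 1 then [] else map (\<lambda>i. i + card Q) (terminals P)))
    = {i. terminal (P \<union> Q) i}"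
    by (auto simp: terminals_props(1))
qed

lemma base_union: "base (P \<union> Q) = Suc (base Q)"
proof -
  have "terminals Q \<noteq> []" by (rule terminals_nonempty[OF Qne finPQ(2)])
  then show ?thesis
    using base_hd[of "P \<union> Q"] base_hd[OF Qne finPQ(2)] finPQ Qne
    by (simp add: terminals_union hd_map)
qed

text \<open>The label 1 is listed separately and \<open>P\<close> starts at 2, because the root is
  non-terminal in the union even when it is terminal in a one-chord \<open>P\<close>.\<close>

lemma nonterminals_union:
  "{1..card (P \<union> Q)} - {i. terminal (P \<union> Q) i} =
     insert 1 (Suc ` ({1..card Q} - {i. terminal Q i}) \<union>
       (\<lambda>i. i + card Q) ` ({2..card P} - {i. terminal P i}))" (is "?L = ?R")
proof (rule set_eqI)
  fix i
  show "i \<in> ?L \<longleftrightarrow> i \<in> ?R"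
  proof (cases "1 \<le> i \<and> i \<le> card P + card Q")
    case True
    then have "1 \<le> i" "i \<le> card P + card Q" by auto
    then show ?thesis
    proof (cases rule: label_cases)
      case 1 then show ?thesis using not_terminal_root card_ge1 by (auto simp: card_union)
    next
      case (2 j) then show ?thesis using terminal_Q[of j] card_ge1 by (auto simp: card_union)
    next
      case (3 j) then show ?thesis using terminal_P[of j] card_ge1 by (auto simp: card_union)
    qed
  next
    case False
    then show ?thesis using card_ge1 by (auto simp: card_union)
  qed
qed

text \<open>The last label \<open>card Q\<close> of \<open>Q\<close> is always terminal and becomes
  \<open>card Q + 1\<close>; the base of \<open>P\<close> becomes \<open>base P + card Q\<close>.
  Their difference \<open>base P - 1\<close> yields the extra factor, the one that C' carries in the
  coefficient of L. If \<open>P\<close> is a single chord there is no such junction, but the root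
  turns non-terminal and supplies the same factor \<open>a (d' 1) 0\<close>.\<close>

lemma ahat_union:
  "ahat a (P \<union> Q) (djoin (card Q) d' d'') =
     ahat a P d' * a (d' (base P)) (base P - 1) * ahat a Q d''"
proof -
  let ?d = "djoin (card Q) d' d''" and ?m = "card Q"
  have dQ: "?d (Suc i) = d'' i" if "terminal Q i" for i
    using that djoin_simps(2)[of i ?m] by (simp add: terminal_def)
  have cQ: "consec_prod (\<lambda>x y. a (?d y) (y - x)) (map Suc (terminals Q)) =
      consec_prod (\<lambda>x y. a (d'' y) (y - x)) (terminals Q)"
    unfolding consec_prod_map
    by (rule consec_prod_cong) (simp add: terminals_props(1) dQ)
  have "(\<Prod>i\<in>{1..card (P \<union> Q)} - {i. terminal (P \<union> Q) i}. a (?d i) 0) =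
      a (d' 1) 0 * (\<Prod>i\<in>Suc ` ({1..card Q} - {i. terminal Q i}) \<union>
       (\<lambda>i. i + card Q) ` ({2..card P} - {i. terminal P i}). a (?d i) 0)"
    unfolding nonterminals_union by (subst prod.insert) (use card_ge1 in \<open>auto simp: djoin_simps\<close>)
  also have "(\<Prod>i\<in>Suc ` ({1..card Q} - {i. terminal Q i}) \<union>
       (\<lambda>i. i + card Q) ` ({2..card P} - {i. terminal P i}). a (?d i) 0) =
      (\<Prod>i\<in>Suc ` ({1..card Q} - {i. terminal Q i}). a (?d i) 0) *
      (\<Prod>i\<in>(\<lambda>i. i + card Q) ` ({2..card P} - {i. terminal P i}). a (?d i) 0)"
    by (rule prod.union_disjoint) auto
  also have "(\<Prod>i\<in>Suc ` ({1..card Q} - {i. terminal Q i}). a (?d i) 0) =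
      (\<Prod>i\<in>{1..card Q} - {i. terminal Q i}. a (d'' i) 0)"
    by (subst prod.reindex) (auto simp: djoin_simps intro!: prod.cong)
  also have "(\<Prod>i\<in>(\<lambda>i. i + card Q) ` ({2..card P} - {i. terminal P i}). a (?d i) 0) =
      (\<Prod>i\<in>{2..card P} - {i. terminal P i}. a (d' i) 0)"
    by (subst prod.reindex) (auto simp: djoin_simps intro!: prod.cong)
  finally have nt: "(\<Prod>i\<in>{1..card (P \<union> Q)} - {i. terminal (P \<union> Q) i}. a (?d i) 0) =
      a (d' 1) 0 * ((\<Prod>i\<in>{1..card Q} - {i. terminal Q i}. a (d'' i) 0) *
        (\<Prod>i\<in>{2..card P} - {i. terminal P i}. a (d' i) 0))" .
  have Pne: "P \<noteq> {}" using rP by auto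
  show ?thesis
  proof (cases "card P = 1")
    case True
    then have term1: "{i. terminal P i} = {1}"
      by (auto simp: terminal_def)
    then have "terminals P = [1]" by (intro terminals_eqI) auto
    moreover have "base P = 1" by (simp add: base_def term1)
    ultimately show ?thesis
      using True unfolding ahat_consec nt terminals_union by (simp add: cQ term1 mult_ac)
  next
    case False
    then have "2 \<le> card P" using card_ge1 by simp
    then have nt1: "\<not> terminal P (Suc 0)" using root_not_terminal[OF matchingPQ(1) connP] by simp
    have "{1..card P} - {i. terminal P i} = insert 1 ({2..card P} - {i. terminal P i})"
      using nt1 \<open>2 \<le> card P\<close> by (auto simp: numeral_2_eq_2 not_less_eq_eq[symmetric])
    then have ntP: "(\<Prod>i\<in>{1..card P} - {i. terminal P i}. a (d' i) 0) =
       a (d' 1) 0 * (\<Prod>i\<in>{2..card P} - {i. terminal P i}. a (d' i) 0)"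
      by simp
    have tP: "2 \<le> i" if "terminal P i" for i
      using that nt1 by (cases "i = 1") (auto simp: terminal_def)
    have cP: "consec_prod (\<lambda>x y. a (?d y) (y - x)) (map (\<lambda>i. i + ?m) (terminals P)) =
      consec_prod (\<lambda>x y. a (d' y) (y - x)) (terminals P)"
      unfolding consec_prod_map
      by (rule consec_prod_cong) (simp add: terminals_props(1) djoin_simps tP)
    have ne: "terminals P \<noteq> []" "terminals Q \<noteq> []"
      using terminals_nonempty[OF Pne finPQ(1)] terminals_nonempty[OF Qne finPQ(2)] by auto
    have "last (map Suc (terminals Q)) = Suc ?m" using ne last_terminals[OF Qne finPQ(2)] by (simp add: last_map)
    moreover have "hd (map (\<lambda>i. i + ?m) (terminals P)) = base P + ?m"
      using ne base_hd[OF Pne finPQ(1)] by (simp add: hd_map)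
    moreover have "?d (base P + ?m) = d' (base P)"
      using base_bounds(1)[OF Pne finPQ(1)] tP by (simp add: djoin_simps)
    ultimately have "consec_prod (\<lambda>x y. a (?d y) (y - x)) (terminals (P \<union> Q)) =
      consec_prod (\<lambda>x y. a (d'' y) (y - x)) (terminals Q) * a (d' (base P)) (base P - 1) *
      consec_prod (\<lambda>x y. a (d' y) (y - x)) (terminals P)"
      using False ne by (simp add: terminals_union consec_prod_append cP cQ)
    then show ?thesis
      unfolding ahat_consec nt ntP by (simp add: mult_ac)
  qed
qed

lemma chord_pos_union:
  "chord_pos (P \<union> Q) r = 1"
  "c \<in> Q \<Longrightarrow> chord_pos (P \<union> Q) c = Suc (chord_pos Q c)"
  "c \<in> P \<Longrightarrow> c \<noteq> r \<Longrightarrow> chord_pos (P \<union> Q) c = chord_pos P c + card Q"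
proof -
  have fin: "finite (P \<union> Q)" using finPQ by simp
  show "chord_pos (P \<union> Q) r = 1"
    using chord_pos_lab[OF fin, of 1] card_ge1 by (simp add: chord_lab_root card_union)
  show "chord_pos (P \<union> Q) c = Suc (chord_pos Q c)" if c: "c \<in> Q"
  proof -
    obtain i where i: "1 \<le> i" "i \<le> card Q" "c = chord_lab Q i" using chord_lab_exists[OF finPQ(2) c] .
    then show ?thesis using chord_pos_lab[OF fin, of "Suc i"] chord_pos_lab[OF finPQ(2), of i] card_ge1
      by (simp add: chord_lab_Q card_union)
  qed
  show "chord_pos (P \<union> Q) c = chord_pos P c + card Q" if c: "c \<in> P" "c \<noteq> r"
  proof -
    obtain i where i: "1 \<le> i" "i \<le> card P" "c = chord_lab P i" using chord_lab_exists[OF finPQ(1) c(1)] .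
    then have "2 \<le> i" using c(2) chord_lab_root(2) by (cases "i = 1") auto
    then show ?thesis using i chord_pos_lab[OF fin, of "i + card Q"] chord_pos_lab[OF finPQ(1), of i]
      by (simp add: chord_lab_P card_union)
  qed
qed

lemma djoin_chord_pos:
  "c \<in> P \<Longrightarrow> djoin (card Q) d' d'' (chord_pos (P \<union> Q) c) = d' (chord_pos P c)"
  "c \<in> Q \<Longrightarrow> djoin (card Q) d' d'' (chord_pos (P \<union> Q) c) = d'' (chord_pos Q c)"
proof -
  assume c: "c \<in> P"
  obtain i where i: "1 \<le> i" "i \<le> card P" "c = chord_lab P i" using chord_lab_exists[OF finPQ(1) c] .
  then have p: "chord_pos P c = i" using chord_pos_lab[OF finPQ(1)] by simp
  show "djoin (card Q) d' d'' (chord_pos (P \<union> Q) c) = d' (chord_pos P c)"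
  proof (cases "c = r")
    case True
    then have "i = 1" using i chord_lab_P_nonroot[of i] by force
    then show ?thesis using True p by (simp add: chord_pos_union djoin_simps)
  next
    case False
    then have "2 \<le> i" using i chord_lab_root(2) by (cases "i = 1") auto
    then show ?thesis using False p c by (simp add: chord_pos_union djoin_simps)
  qed
next
  assume c: "c \<in> Q"
  obtain i where i: "1 \<le> i" "i \<le> card Q" "c = chord_lab Q i" using chord_lab_exists[OF finPQ(2) c] .
  then have "chord_pos Q c = i" using chord_pos_lab[OF finPQ(2)] by simp
  then show "djoin (card Q) d' d'' (chord_pos (P \<union> Q) c) = d'' (chord_pos Q c)"
    using i c by (simp add: chord_pos_union djoin_simps)
qed

end

section \<open>Weights of plane binary trees\<close>

text \<open>Leaves with their branch-left numbers, the path to the root of the tree being prolonged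
  by \<open>m\<close> right steps.\<close>
fun lnu :: "nat \<Rightarrow> 'b btree \<Rightarrow> ('b \<times> nat) list" where
  "lnu m (BLeaf b) = [(b, m)]"
| "lnu m (BNode l r) = lnu 0 l @ lnu (Suc m) r"

lemma takeWhile_id_append_False: "takeWhile id (xs @ False # ys) = takeWhile id xs"
  by (induction xs) auto

text \<open>A left step ends the run of right steps counted from the leaf upwards, so a left subtree
  restarts at 0.\<close>

lemma lnu_leafpaths:
  "lnu m t = map (\<lambda>(b, p). (b, length (takeWhile id (rev (replicate m True @ p))))) (leafpaths t)"
proof (induction t arbitrary: m)
  case (BNode l r)
  have l: "takeWhile id (rev (replicate m True @ False # p)) = takeWhile id (rev p)" for p
    using takeWhile_id_append_False by simp
  have r: "replicate m True @ True # p = replicate (Suc m) True @ p" for p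
    by (simp add: replicate_app_Cons_same)
  show ?case
    unfolding lnu.simps leafpaths.simps BNode(1)[of 0] BNode(2)[of "Suc m"] map_append map_map
      comp_def case_prod_beta'
    by (simp only: fst_conv snd_conv l r replicate_0 append_Nil)
qed (simp add: takeWhile_eq_all_conv[THEN iffD2] del: takeWhile_eq_all_conv)

definition leaves :: "'b btree \<Rightarrow> 'b list" where
  "leaves t = map fst (leafpaths t)"

lemma leaves_simps [simp]:
  "leaves (BLeaf b) = [b]" "leaves (BNode l r) = leaves l @ leaves r"
  by (simp_all add: leaves_def comp_def case_prod_beta')

lemma map_fst_lnu: "map fst (lnu m t) = leaves t"
  by (induction t arbitrary: m) simp_all

lemma leaves_map: "leaves (map_btree h t) = map h (leaves t)"
  by (induction t) auto

lemma nverts_leaves: "nverts t + 1 = 2 * length (leaves t)"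
  by (induction t) auto

lemma nverts_map [simp]: "nverts (map_btree h t) = nverts t"
  by (induction t) auto

lemma graft_map: "map_btree h (graft T k t) = graft (map_btree h T) k (map_btree h t)"
  by (induction T k t rule: graft.induct) auto

lemma mset_leaves_graft:
  "1 \<le> k \<Longrightarrow> k \<le> nverts t \<Longrightarrow> mset (leaves (graft T k t)) = mset (leaves T) + mset (leaves t)"
  by (induction T k t rule: graft.induct) auto

lemma set_btree_graft_subset: "set_btree (graft T k t) \<subseteq> set_btree T \<union> set_btree t"
  by (induction T k t rule: graft.induct) auto

lemma lnu_map: "lnu m (map_btree h t) = map (\<lambda>(b, v). (h b, v)) (lnu m t)"
  by (induction t arbitrary: m) auto

definition tree_weight :: "('b \<Rightarrow> nat \<Rightarrow> 'a::comm_ring_1) \<Rightarrow> nat \<Rightarrow> 'b btree \<Rightarrow> 'a" where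
  "tree_weight f m t = prod_list (map (\<lambda>(b, v). f b v) (lnu m t))"

lemma tree_weight_simps:
  "tree_weight f m (BLeaf b) = f b m"
  "tree_weight f m (BNode l r) = tree_weight f 0 l * tree_weight f (Suc m) r"
  by (simp_all add: tree_weight_def)

text \<open>The rightmost leaf is the only one whose branch-left number depends on the offset
  \<open>m\<close> of \<open>lnu\<close>; that number is \<open>m + rspine t\<close>.\<close>

fun rspine :: "'b btree \<Rightarrow> nat" where
  "rspine (BLeaf b) = 0"
| "rspine (BNode l r) = Suc (rspine r)"

fun rleaf :: "'b btree \<Rightarrow> 'b" where
  "rleaf (BLeaf b) = b"
| "rleaf (BNode l r) = rleaf r"

context
  fixes f :: "'b \<Rightarrow> nat \<Rightarrow> 'a::comm_ring_1" and g :: "'b \<Rightarrow> 'a"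
  assumes f_Suc: "\<And>b v. of_nat (Suc v) * f b (Suc v) = (g b + of_nat v) * f b v"
begin

text \<open>Raising the offset changes only the factor of \<open>rleaf t\<close>, from the number
  \<open>m + rspine t\<close> to its successor, and \<open>f_Suc\<close> compares the two.\<close>

lemma tree_weight_Suc:
  "of_nat (Suc (m + rspine t)) * tree_weight f (Suc m) t =
     (g (rleaf t) + of_nat (m + rspine t)) * tree_weight f m t"
proof (induction t arbitrary: m)
  case (BLeaf b)
  then show ?case using f_Suc by (simp add: tree_weight_simps)
next
  case (BNode l r)
  have "of_nat (Suc (m + Suc (rspine r))) * (tree_weight f 0 l * tree_weight f (Suc (Suc m)) r)
     = tree_weight f 0 l * (of_nat (Suc (Suc m + rspine r)) * tree_weight f (Suc (Suc m)) r)"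
    by (simp add: mult_ac)
  also have "\<dots> = tree_weight f 0 l * ((g (rleaf r) + of_nat (Suc m + rspine r)) * tree_weight f (Suc m) r)"
    unfolding BNode(2) ..
  finally show ?case by (simp add: tree_weight_simps mult_ac)
qed

abbreviation graft_sum :: "'b btree \<Rightarrow> 'b btree \<Rightarrow> nat \<Rightarrow> 'a" where
  "graft_sum T t m \<equiv> (\<Sum>k\<in>{1..nverts t}. tree_weight f m (graft T k t))"

text \<open>The summands collect the virtual edge, the edges from the left child downwards and those
  from the right child downwards, as in preorder. On the virtual edge the old root becomes a right
  child, which moves \<open>r\<close> to offset \<open>m + 2\<close>.\<close>

lemma graft_sum_BNode:
  "graft_sum T (BNode l r) m = tree_weight f 0 T * (tree_weight f 0 l * tree_weight f (Suc (Suc m)) r)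
     + graft_sum T l 0 * tree_weight f (Suc m) r + tree_weight f 0 l * graft_sum T r (Suc m)"
proof -
  let ?G = "\<lambda>k. tree_weight f m (graft T k (BNode l r))"
  let ?a = "nverts l" and ?b = "nverts r"
  have "{1..nverts (BNode l r)} = {1} \<union> (Suc ` {1..?a} \<union> (\<lambda>k. k + Suc ?a) ` {1..?b})" (is "_ = ?R")
  proof (rule set_eqI)
    fix k show "k \<in> {1..nverts (BNode l r)} \<longleftrightarrow> k \<in> ?R"
    proof
      assume k: "k \<in> {1..nverts (BNode l r)}"
      consider "k = 1" | "2 \<le> k" "k \<le> Suc ?a" | "Suc ?a < k" using k by fastforce
      then show "k \<in> ?R"
      proof cases
        case 2 then have "k = Suc (k - 1)" "k - 1 \<in> {1..?a}" by auto
        then show ?thesis by blast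
      next
        case 3 then have "k = (k - Suc ?a) + Suc ?a" "k - Suc ?a \<in> {1..?b}" using k by auto
        then show ?thesis by blast
      qed simp
    qed auto
  qed
  then have "graft_sum T (BNode l r) m = sum ?G ({1} \<union> (Suc ` {1..?a} \<union> (\<lambda>k. k + Suc ?a) ` {1..?b}))"
    by simp
  also have "\<dots> = ?G 1 + (sum ?G (Suc ` {1..?a}) + sum ?G ((\<lambda>k. k + Suc ?a) ` {1..?b}))"
    by (subst sum.union_disjoint, (force+)[3])+ simp
  also have "sum ?G (Suc ` {1..?a}) = graft_sum T l 0 * tree_weight f (Suc m) r"
    by (subst sum.reindex) (auto simp: sum_distrib_right tree_weight_simps intro!: sum.cong)
  also have "sum ?G ((\<lambda>k. k + Suc ?a) ` {1..?b}) = tree_weight f 0 l * graft_sum T r (Suc m)"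
    by (subst sum.reindex) (auto simp: sum_distrib_left tree_weight_simps inj_on_def intro!: sum.cong)
  finally show ?thesis by (simp add: tree_weight_simps add.assoc)
qed

text \<open>Every leaf \<open>b\<close> other than \<open>rleaf t\<close>, with number v,
  contributes \<open>g b + v\<close> times the product of the two weights. The offset adds
  \<open>m\<close> to the number of \<open>rleaf t\<close> but no edges to \<open>t\<close>, so this
  leaf is raised by only \<open>rspine t + 1\<close> edges and keeps a term of its own. The other
  numbers sum to n - 1 - \<open>rspine t\<close> for n leaves, which explains the bracket. The
  offset stays general because the induction enters the right child with
  \<open>Suc m\<close>.\<close>

lemma graft_sum_general:
  "graft_sum T t m = tree_weight f 0 T * (of_nat (Suc (rspine t)) * tree_weight f (Suc m) t +
     (sum_list (map (\<lambda>b. g b + 1) (leaves t)) - 1 - g (rleaf t) - of_nat (rspine t)) * tree_weight f m t)"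
proof (induction t arbitrary: m)
  case (BLeaf b)
  then show ?case by (simp add: tree_weight_simps)
next
  case (BNode l r)
  let ?\<sigma> = "\<lambda>t. sum_list (map (\<lambda>b. g b + 1) (leaves t)) - 1"
  \<comment> \<open>A left child starts at offset 0, where \<open>tree_weight_Suc\<close> absorbs
    the separate term of its rightmost leaf.\<close>
  have l: "graft_sum T l 0 = tree_weight f 0 T * (?\<sigma> l * tree_weight f 0 l)"
    unfolding BNode(1) using tree_weight_Suc[of 0 l] by (simp add: algebra_simps)
  show ?case
    unfolding graft_sum_BNode l BNode(2) by (simp add: tree_weight_simps algebra_simps)
qed

lemma graft_sum:
  "graft_sum T t 0 = tree_weight f 0 T * ((sum_list (map (\<lambda>b. g b + 1) (leaves t)) - 1) * tree_weight f 0 t)"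
  unfolding graft_sum_general using tree_weight_Suc[of 0 t] by (simp add: algebra_simps)

end

section \<open>Insertion of connected diagrams\<close>

text \<open>The counterpart of the involutions in \<open>Rdec\<close>; the condition on
  \<open>endpts\<close> is normalization.\<close>

definition cdiag :: "(nat \<times> nat) set set" where
  "cdiag = {S. S \<noteq> {} \<and> matching S \<and> endpts S = {1..2 * card S} \<and> connected_cd S}"

lemma cdiagD:
  assumes "S \<in> cdiag"
  shows "S \<noteq> {}" "matching S" "endpts S = {1..2 * card S}" "connected_cd S" "finite S" "1 \<le> card S"
  using assms matching_finite by (auto simp: cdiag_def Suc_le_eq card_gt_0_iff)

section \<open>Insertion trees and renumbering\<close>

lemma rs_C1_subset:
  assumes "finite S" "2 \<le> card S"
  shows "rs_C1 S \<subseteq> S - {minch S}" "rs_C1 S \<noteq> {}" "minch S \<in> S" "S - {minch S} \<noteq> {}"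
proof -
  have "S \<noteq> {}" using assms(2) by auto
  then show S: "minch S \<in> S" by (rule minch_in)
  show ne: "S - {minch S} \<noteq> {}"
  proof
    assume "S - {minch S} = {}"
    then have "S = {minch S}" using S by blast
    then have "card S = card {minch S}" by (rule arg_cong)
    then show False using assms by simp
  qed
  show "rs_C1 S \<subseteq> S - {minch S}" unfolding rs_C1_def Let_def by (rule comp_of_sub)
  show "rs_C1 S \<noteq> {}" unfolding rs_C1_def Let_def using comp_of_mem[OF minch_in[OF ne]] by blast
qed

lemma itree_rec:
  assumes "finite S" "2 \<le> card S"
  shows "itree S = graft (itree (S - rs_C1 S)) (rs_idx S) (itree (rs_C1 S))"
  using rs_C1_subset(3,4)[OF assms] minch_in[of "S - {minch S}"] assms(1)
  by (subst itree.simps) (simp add: Let_def)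

lemma itree_singleton: "itree {c} = BLeaf c"
proof -
  have "minch {c} = c" by (rule minch_eqI) auto
  then show ?thesis by (subst itree.simps) (simp add: Let_def)
qed

lemma rs_C1_relabel:
  assumes "matching S" "2 \<le> card S" and mono: "strict_mono_on (endpts S) \<phi>"
  shows "rs_C1 (relabel \<phi> ` S) = relabel \<phi> ` rs_C1 S"
proof -
  let ?R = "S - {minch S}"
  note sub = rs_C1_subset[OF matching_finite[OF assms(1)] assms(2)]
  have S: "S \<noteq> {}" using sub by auto
  have "relabel \<phi> ` S - {minch (relabel \<phi> ` S)} = relabel \<phi> ` ?R"
    unfolding minch_relabel[OF mono assms(1) S]
    using inj_on_image_set_diff[OF inj_on_relabel[OF mono], of S "{minch S}"] sub(3) by auto
  moreover have mR: "matching ?R" "strict_mono_on (endpts ?R) \<phi>"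
    using matching_subset[OF assms(1)] strict_mono_on_endpts_subset[OF mono] by auto
  ultimately show ?thesis
    unfolding rs_C1_def Let_def
    using minch_relabel[OF mR(2,1) sub(4)] comp_of_relabel[OF mR(2) minch_in[OF sub(4)]] by simp
qed

lemma rs_idx_relabel:
  assumes "matching S" "2 \<le> card S" and mono: "strict_mono_on (endpts S) \<phi>"
  shows "rs_idx (relabel \<phi> ` S) = rs_idx S"
proof -
  note fin = matching_finite[OF assms(1)]
  have sub: "rs_C1 S \<subseteq> S" "S - rs_C1 S \<subseteq> S" using rs_C1_subset(1)[OF fin assms(2)] by auto
  have "relabel \<phi> ` S - relabel \<phi> ` rs_C1 S = relabel \<phi> ` (S - rs_C1 S)"
    using inj_on_image_set_diff[OF inj_on_relabel[OF mono], of S "rs_C1 S"] sub by simp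
  moreover have "cd_norm (relabel \<phi> ` T) = cd_norm T" "card (relabel \<phi> ` T) = card T" if "T \<subseteq> S" for T
    using cd_norm_relabel[OF strict_mono_on_endpts_subset[OF mono that] finite_subset[OF that fin]]
      card_image[OF inj_on_subset[OF inj_on_relabel[OF mono] that]] by auto
  ultimately show ?thesis
    unfolding rs_idx_def rs_C1_relabel[OF assms] using sub by simp
qed

lemma itree_relabel:
  "matching S \<Longrightarrow> S \<noteq> {} \<Longrightarrow> strict_mono_on (endpts S) \<phi> \<Longrightarrow>
     itree (relabel \<phi> ` S) = map_btree (relabel \<phi>) (itree S)"
proof (induction "card S" arbitrary: S rule: less_induct)
  case less
  note fin = matching_finite[OF less.prems(1)]
  note inj = inj_on_relabel[OF less.prems(3)]
  show ?case
  proof (cases "2 \<le> card S")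
    case True
    note sub = rs_C1_subset[OF fin True]
    have IH: "itree (relabel \<phi> ` T) = map_btree (relabel \<phi>) (itree T)" if "T \<subset> S" "T \<noteq> {}" for T
      using less.hyps[OF psubset_card_mono[OF fin that(1)] matching_subset[OF less.prems(1)] that(2)
        strict_mono_on_endpts_subset[OF less.prems(3)]] that(1) by auto
    have "relabel \<phi> ` S - relabel \<phi> ` rs_C1 S = relabel \<phi> ` (S - rs_C1 S)"
      by (rule inj_on_image_set_diff[OF inj, symmetric]) (use sub(1) in auto)
    moreover have "S - rs_C1 S \<subset> S" "S - rs_C1 S \<noteq> {}" "rs_C1 S \<subset> S" using sub by blast+
    moreover have "2 \<le> card (relabel \<phi> ` S)" using True card_image[OF inj] by simp
    ultimately show ?thesis
      using itree_rec[OF fin True] itree_rec[of "relabel \<phi> ` S"] fin sub(2)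
      by (simp add: rs_C1_relabel[OF less.prems(1) True less.prems(3)]
          rs_idx_relabel[OF less.prems(1) True less.prems(3)] IH graft_map)
  next
    case False
    then have "card S = 1" using fin less.prems(2) by (simp add: not_le less_2_cases_iff card_eq_0_iff)
    then obtain c where "S = {c}" by (metis card_1_singletonE)
    then show ?thesis by (simp add: itree_singleton)
  qed
qed

text \<open>Inclusion is enough for changing leaf labels and holds whatever the value of
  \<open>rs_idx\<close>; equality is obtained only once every diagram is known to be an
  insertion.\<close>

lemma set_itree_subset: "finite S \<Longrightarrow> S \<noteq> {} \<Longrightarrow> set_btree (itree S) \<subseteq> S"
proof (induction "card S" arbitrary: S rule: less_induct)
  case less
  show ?case
  proof (cases "2 \<le> card S")
    case True
    note sub = rs_C1_subset[OF less.prems(1) True]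
    have IH: "set_btree (itree T) \<subseteq> T" if "T \<subset> S" "T \<noteq> {}" for T
      using less.hyps[OF psubset_card_mono[OF less.prems(1) that(1)] _ that(2)] that(1)
        finite_subset[OF _ less.prems(1)] by blast
    have "S - rs_C1 S \<subset> S" "S - rs_C1 S \<noteq> {}" "rs_C1 S \<subset> S" using sub by blast+
    then have "set_btree (itree (S - rs_C1 S)) \<subseteq> S - rs_C1 S" "set_btree (itree (rs_C1 S)) \<subseteq> rs_C1 S"
      using IH sub(2) by auto
    then show ?thesis unfolding itree_rec[OF less.prems(1) True] using set_btree_graft_subset sub(1) by fast
  next
    case False
    then have "card S = 1" using less.prems by (simp add: not_le less_2_cases_iff card_eq_0_iff)
    then obtain c where "S = {c}" by (metis card_1_singletonE)
    then show ?thesis by (simp add: itree_singleton)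
  qed
qed

text \<open>Leaves carry decorations instead of chords: the weight needs no more, and such trees can
  be compared across renumberings of the endpoints.\<close>

definition dtree :: "(nat \<times> nat) set \<Rightarrow> (nat \<Rightarrow> nat) \<Rightarrow> nat btree" where
  "dtree S d = map_btree (\<lambda>c. d (chord_pos S c)) (itree S)"

lemma chord_pos_relabel:
  assumes "matching S" "strict_mono_on (endpts S) \<phi>" "c \<in> S"
  shows "chord_pos (relabel \<phi> ` S) (relabel \<phi> c) = chord_pos S c"
proof -
  note fin = matching_finite[OF assms(1)]
  obtain i where i: "1 \<le> i" "i \<le> card S" "c = chord_lab S i" using chord_lab_exists[OF fin assms(3)] .
  show ?thesis
    using chord_pos_lab[OF fin i(1,2)] chord_pos_lab[of "relabel \<phi> ` S" i] i fin
      card_image[OF inj_on_relabel[OF assms(2)]] chord_lab_relabel[OF assms(1,2) i(1,2)] by simp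
qed

lemma dtree_relabel:
  assumes "matching S" "S \<noteq> {}" "strict_mono_on (endpts S) \<phi>"
  shows "dtree (relabel \<phi> ` S) d = dtree S d"
proof -
  have "dtree (relabel \<phi> ` S) d = map_btree (\<lambda>c. d (chord_pos (relabel \<phi> ` S) (relabel \<phi> c))) (itree S)"
    unfolding dtree_def itree_relabel[OF assms] by (simp add: btree.map_comp comp_def)
  also have "\<dots> = dtree S d"
    unfolding dtree_def using set_itree_subset[OF matching_finite[OF assms(1)] assms(2)]
      chord_pos_relabel[OF assms(1,3)] by (intro btree.map_cong) auto
  finally show ?thesis .
qed

section \<open>Insertions are root shares\<close>

lemma matching_Un:
  assumes "matching P" "matching Q" "endpts P \<inter> endpts Q = {}" shows "matching (P \<union> Q)"
proof -
  have ne: "fst p \<noteq> fst q \<and> fst p \<noteq> snd q \<and> snd p \<noteq> fst q \<and> snd p \<noteq> snd q" if "p \<in> P" "q \<in> Q" for p q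
    using endptsI[OF that(1)] endptsI[OF that(2)] assms(3) by (metis IntI empty_iff)
  have "fst c \<noteq> fst c' \<and> fst c \<noteq> snd c' \<and> snd c \<noteq> snd c'"
    if "c \<in> P \<union> Q" "c' \<in> P \<union> Q" "c \<noteq> c'" for c c'
    using that ne[of c c'] ne[of c' c] assms(1,2) unfolding matching_def by (metis Un_iff)
  then show ?thesis using assms(1,2) unfolding matching_def by blast
qed

lemma cd_norm_cdiag:
  assumes "S \<in> cdiag" shows "cd_norm S = S"
proof -
  have rk: "card {y \<in> endpts S. y \<le> x} = x" if "x \<in> endpts S" for x
  proof -
    have "{y \<in> endpts S. y \<le> x} = {1..x}" using that cdiagD(3)[OF assms] by auto
    then show ?thesis by simp
  qed
  have "cd_norm S = (\<lambda>c. (card {y \<in> endpts S. y \<le> fst c}, card {y \<in> endpts S. y \<le> snd c})) ` S"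
    unfolding cd_norm_def endpts_def by (simp add: case_prod_beta')
  also have "\<dots> = (\<lambda>c. c) ` S" by (rule image_cong) (simp_all add: rk endptsI)
  finally show ?thesis by simp
qed

lemma cdiag_root:
  assumes "S \<in> cdiag" shows "fst (minch S) = 1"
proof -
  note S = cdiagD[OF assms]
  have "1 \<in> endpts S" using S by auto
  then obtain c where c: "c \<in> S" "fst c = 1 \<or> snd c = 1" unfolding endpts_def by auto
  have "1 \<le> fst c" using endptsI(1)[OF c(1)] S by auto
  then have "fst c = 1" using c matching_less[OF S(2) c(1)] by auto
  then have "fst (minch S) \<le> 1" using minch_le[OF c(1)] by simp
  moreover have "1 \<le> fst (minch S)" using endptsI(1)[OF minch_in[OF S(1)]] S by auto
  ultimately show ?thesis by simp
qed

text \<open>The two renumberings of endpoints in the definition of \<open>C \<circ>\<^sub>k D\<close> with \<open>n = |C|\<close>.\<close>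
definition insP :: "nat \<Rightarrow> nat \<Rightarrow> nat" where
  "insP k x = (if x = 1 then 1 else x + k)"
definition insQ :: "nat \<Rightarrow> nat \<Rightarrow> nat \<Rightarrow> nat" where
  "insQ n k x = (if x \<le> k then x + 1 else x + 2 * n)"

lemma insP_image: "1 \<le> n \<Longrightarrow> insP k ` {1..2 * n} = insert 1 {k + 2..k + 2 * n}"
proof (rule set_eqI)
  fix x assume n: "1 \<le> n"
  show "x \<in> insP k ` {1..2 * n} \<longleftrightarrow> x \<in> insert 1 {k + 2..k + 2 * n}"
  proof
    assume "x \<in> insert 1 {k + 2..k + 2 * n}"
    then consider "x = 1" | "x \<in> {k + 2..k + 2 * n}" by blast
    then show "x \<in> insP k ` {1..2 * n}"
    proof cases
      case 1 then have "x = insP k 1" "1 \<in> {1..2 * n}" using n by (auto simp: insP_def)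
      then show ?thesis by blast
    next
      case 2 then have "x = insP k (x - k)" "x - k \<in> {1..2 * n}" by (auto simp: insP_def)
      then show ?thesis by blast
    qed
  qed (auto simp: insP_def n split: if_splits)
qed

lemma insQ_image:
  "k \<le> 2 * m \<Longrightarrow> insQ n k ` {1..2 * m} = {2..k + 1} \<union> {k + 2 * n + 1..2 * n + 2 * m}"
proof (rule set_eqI)
  fix x assume k: "k \<le> 2 * m"
  show "x \<in> insQ n k ` {1..2 * m} \<longleftrightarrow> x \<in> {2..k + 1} \<union> {k + 2 * n + 1..2 * n + 2 * m}"
  proof
    assume "x \<in> {2..k + 1} \<union> {k + 2 * n + 1..2 * n + 2 * m}"
    then consider "x \<in> {2..k + 1}" | "x \<in> {k + 2 * n + 1..2 * n + 2 * m}" by blast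
    then show "x \<in> insQ n k ` {1..2 * m}"
    proof cases
      case 1 then have "x = insQ n k (x - 1)" "x - 1 \<in> {1..2 * m}" using k by (auto simp: insQ_def)
      then show ?thesis by blast
    next
      case 2 then have "x = insQ n k (x - 2 * n)" "x - 2 * n \<in> {1..2 * m}" by (auto simp: insQ_def)
      then show ?thesis by blast
    qed
  qed (use k in \<open>auto simp: insQ_def split: if_splits\<close>)
qed

locale insertion =
  fixes S' S'' :: "(nat \<times> nat) set" and k :: nat
  assumes S': "S' \<in> cdiag" and S'': "S'' \<in> cdiag" and k: "1 \<le> k" "k \<le> 2 * card S'' - 1"
begin

abbreviation "P \<equiv> relabel (insP k) ` S'"
abbreviation "Q \<equiv> relabel (insQ (card S') k) ` S''"
abbreviation "r \<equiv> (1, snd (minch S') + k)"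

lemma monoP: "strict_mono_on (endpts S') (insP k)"
  by (rule strict_mono_onI) (auto simp: insP_def cdiagD(3)[OF S'])

lemma monoQ: "strict_mono_on (endpts S'') (insQ (card S') k)"
  using cdiagD(6)[OF S'] by (intro strict_mono_onI) (auto simp: insQ_def)

lemma cards: "card P = card S'" "card Q = card S''"
  using card_image[OF inj_on_relabel[OF monoP]] card_image[OF inj_on_relabel[OF monoQ]] by auto

lemma endpts_PQ:
  "endpts P = insert 1 {k + 2..k + 2 * card S'}"
  "endpts Q = {2..k + 1} \<union> {k + 2 * card S' + 1..2 * card S' + 2 * card S''}"
proof -
  show "endpts P = insert 1 {k + 2..k + 2 * card S'}"
    unfolding endpts_relabel cdiagD(3)[OF S'] by (rule insP_image[OF cdiagD(6)[OF S']])
  show "endpts Q = {2..k + 1} \<union> {k + 2 * card S' + 1..2 * card S' + 2 * card S''}"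
    unfolding endpts_relabel cdiagD(3)[OF S''] by (rule insQ_image) (use k in simp)
qed

lemma endpts_disjoint: "endpts P \<inter> endpts Q = {}"
  unfolding endpts_PQ using k by auto

lemma snd_root: "2 \<le> snd (minch S')" "snd (minch S') \<le> 2 * card S'"
  using matching_less[OF cdiagD(2)[OF S'] minch_in[OF cdiagD(1)[OF S']]] cdiag_root[OF S']
    endptsI(2)[OF minch_in[OF cdiagD(1)[OF S']]] cdiagD(3)[OF S'] by auto

lemma root_image: "r = relabel (insP k) (minch S')" "r \<in> P"
proof -
  show *: "r = relabel (insP k) (minch S')"
    using snd_root cdiag_root[OF S'] by (intro prod_eqI) (auto simp: insP_def)
  show "r \<in> P" unfolding * using minch_in[OF cdiagD(1)[OF S']] by blast
qed

lemma cd_ins_eq: "cd_ins S' k S'' = P \<union> Q"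
proof -
  have root: "(1, y) \<in> S' \<longleftrightarrow> y = snd (minch S')" for y
  proof
    assume "(1, y) \<in> S'"
    then have "(1, y) = minch S'"
      using matching_fst_eq[OF cdiagD(2)[OF S'] _ minch_in[OF cdiagD(1)[OF S']]] cdiag_root[OF S'] by simp
    then show "y = snd (minch S')" by (metis snd_conv)
  next
    assume "y = snd (minch S')"
    then show "(1, y) \<in> S'" using minch_in[OF cdiagD(1)[OF S']] cdiag_root[OF S'] by (metis prod.collapse)
  qed
  then have the: "(THE y. (1, y) \<in> S') = snd (minch S')" by simp
  have pos: "1 < y" if "(x, y) \<in> S'" for x y
    using matching_less[OF cdiagD(2)[OF S'] that] endptsI(1)[OF that] cdiagD(3)[OF S'] by auto
  have "P = {r} \<union> {(x + k, y + k) | x y. (x, y) \<in> S' \<and> x \<noteq> 1}" (is "_ = ?R")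
  proof (rule set_eqI, rule iffI)
    fix c assume "c \<in> P"
    then obtain x y where xy: "(x, y) \<in> S'" "c = (insP k x, insP k y)" by auto
    show "c \<in> ?R"
    proof (cases "x = 1")
      case True
      then have "y = snd (minch S')" using root xy by simp
      then show ?thesis using xy True pos[OF xy(1)] by (simp add: insP_def)
    next
      case False
      then show ?thesis using xy pos[OF xy(1)] by (auto simp: insP_def)
    qed
  next
    fix c assume "c \<in> ?R"
    then consider "c = r" | x y where "(x, y) \<in> S'" "x \<noteq> 1" "c = (x + k, y + k)" by blast
    then show "c \<in> P"
    proof cases
      case 1 then show ?thesis using root_image by simp
    next
      case 2
      then have "c = relabel (insP k) (x, y)" using pos[OF 2(1)] by (simp add: insP_def)
      then show ?thesis using 2(1) by blast
    qed
  qed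
  moreover have "Q = {(insQ (card S') k x, insQ (card S') k y) | x y. (x, y) \<in> S''}"
    by force
  ultimately show ?thesis
    unfolding cd_ins_def Let_def the insQ_def by simp
qed

text \<open>Without a chord of \<open>S''\<close> across the cut between \<open>k\<close> and
  \<open>k + 1\<close>, the chords left of the cut would be closed under crossing; they contain the
  root but not the chord ending at \<open>2 * card S''\<close>, which lies beyond the cut as
  \<open>k \<le> 2 * card S'' - 1\<close>. The straddling chord is what the inserted root
  crosses.\<close>

lemma straddling_chord: "\<exists>q\<in>Q. fst q \<le> k + 1 \<and> k + 2 * card S' + 1 \<le> snd q"
proof -
  note S = cdiagD[OF S'']
  have "\<exists>c\<in>S''. fst c \<le> k \<and> k < snd c"
  proof (rule ccontr)
    assume no: "\<not> (\<exists>c\<in>S''. fst c \<le> k \<and> k < snd c)"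
    have "2 * card S'' \<in> endpts S''" using S by auto
    then obtain c where c: "c \<in> S''" "fst c = 2 * card S'' \<or> snd c = 2 * card S''" unfolding endpts_def by auto
    have "snd c \<le> 2 * card S''" using endptsI(2)[OF c(1)] S by auto
    then have "snd c = 2 * card S''" using c(2) matching_less[OF S(2) c(1)] by auto
    then have ck: "k < snd c" using k by linarith
    have m: "minch S'' \<in> S''" by (rule minch_in[OF S(1)])
    have "(minch S'', c) \<in> (crel S'')\<^sup>*" using S(4) m c(1) unfolding connected_cd_def by blast
    then have "c \<in> {c \<in> S''. snd c \<le> k}"
    proof (rule rtrancl_closed)
      have "fst (minch S'') \<le> k" using cdiag_root[OF S''] k by simp
      then show "minch S'' \<in> {c \<in> S''. snd c \<le> k}" using no m by (metis (mono_tags, lifting) mem_Collect_eq not_le)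
      fix x y assume "x \<in> {c \<in> S''. snd c \<le> k}" "y \<in> S''" "crosses x y"
      moreover from this have "fst y \<le> k" by (auto simp: crosses_def)
      ultimately show "y \<in> {c \<in> S''. snd c \<le> k}" using no by (metis (mono_tags, lifting) mem_Collect_eq not_le)
    qed
    then show False using ck by simp
  qed
  then obtain c where c: "c \<in> S''" "fst c \<le> k" "k < snd c" by blast
  then have "relabel (insQ (card S') k) c \<in> Q" "fst (relabel (insQ (card S') k) c) \<le> k + 1"
    "k + 2 * card S' + 1 \<le> snd (relabel (insQ (card S') k) c)"
    by (auto simp: insQ_def)
  then show ?thesis by (intro bexI[of _ "relabel (insQ (card S') k) c"] conjI)
qed

lemma P_nonroot:
  assumes "c \<in> P" "c \<noteq> r"
  shows "fst c \<in> {k + 2..k + 2 * card S'}" "snd c \<in> {k + 2..k + 2 * card S'}"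
proof -
  have mP: "matching P" using matching_relabel[OF monoP] cdiagD(2)[OF S'] by simp
  have "fst c \<noteq> 1" using matching_fst_eq[OF mP assms(1) root_image(2)] assms(2) by auto
  moreover have "fst c \<in> endpts P" "snd c \<in> endpts P" using endptsI assms(1) by blast+
  moreover have "fst c < snd c" by (rule matching_less[OF mP assms(1)])
  ultimately show "fst c \<in> {k + 2..k + 2 * card S'}" "snd c \<in> {k + 2..k + 2 * card S'}"
    unfolding endpts_PQ by auto
qed

lemma Q_endpts:
  assumes "q \<in> Q"
  shows "fst q \<in> {2..k + 1} \<union> {k + 2 * card S' + 1..2 * card S' + 2 * card S''}"
    "snd q \<in> {2..k + 1} \<union> {k + 2 * card S' + 1..2 * card S' + 2 * card S''}"
  using endptsI[OF assms] by (simp_all only: endpts_PQ)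

sublocale root_share P Q r
proof
  show "matching (P \<union> Q)"
    by (rule matching_Un[OF _ _ endpts_disjoint])
      (use matching_relabel[OF monoP] matching_relabel[OF monoQ] cdiagD(2)[OF S'] cdiagD(2)[OF S''] in auto)
  show "P \<inter> Q = {}"
    using endpts_disjoint endptsI(1)[of _ P] endptsI(1)[of _ Q] by (metis disjoint_iff)
  show "connected_cd P" "connected_cd Q"
    using connected_relabel[OF monoP] connected_relabel[OF monoQ] cdiagD(4)[OF S'] cdiagD(4)[OF S''] by auto
  show "r \<in> P" by (rule root_image)
  show "Q \<noteq> {}" using cdiagD(1)[OF S''] by simp
  show "fst r < fst c" if "c \<in> P \<union> Q" "c \<noteq> r" for c
  proof (cases "c \<in> P")
    case True then show ?thesis using P_nonroot(1)[OF True that(2)] by simp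
  next
    case False then show ?thesis using Q_endpts(1)[of c] that k by auto
  qed
  obtain q where q: "q \<in> Q" "fst q \<le> k + 1" "k + 2 * card S' + 1 \<le> snd q"
    using straddling_chord by blast
  \<comment> \<open>The straddling chord starts before the block of \<open>P\<close>, hence so does
    \<open>Q\<close>.\<close>
  have "fst (minch Q) \<le> fst q" by (rule minch_le[OF q(1)])
  then show "fst (minch Q) < fst c" if "c \<in> P" "c \<noteq> r" for c
    using P_nonroot(1)[OF that] q by simp
  show "\<not> crosses c q" if "c \<in> P" "c \<noteq> r" "q \<in> Q" for c q
    using P_nonroot[OF that(1,2)] Q_endpts[OF that(3)] unfolding crosses_def by auto
  \<comment> \<open>The right end of \<open>r\<close> falls into the block
    \<open>k + 2..k + 2 * card S'\<close>, strictly between the ends of \<open>q\<close>.\<close>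
  have "2 \<le> fst q" using Q_endpts(1)[OF q(1)] k by auto
  then have "crosses r q" using q snd_root unfolding crosses_def by auto
  then show "\<exists>q\<in>Q. crosses r q" using q(1) by blast
qed

lemma ins_card: "card (cd_ins S' k S'') = card S' + card S''"
  using card_union by (simp add: cd_ins_eq cards)

lemma ins_cdiag: "cd_ins S' k S'' \<in> cdiag"
proof -
  have "endpts (P \<union> Q) = {1..2 * (card S' + card S'')}"
    unfolding endpts_Un endpts_PQ using k by auto
  then show ?thesis
    unfolding cdiag_def using ins_card matching connected_union Qne by (simp add: cd_ins_eq)
qed

lemma ins_norm:
  "cd_norm (rs_C1 (cd_ins S' k S'')) = S''"
  "cd_norm (cd_ins S' k S'' - rs_C1 (cd_ins S' k S'')) = S'"
  using cd_norm_relabel[OF monoP] cd_norm_relabel[OF monoQ] cdiagD(5)[OF S'] cdiagD(5)[OF S'']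
    cd_norm_cdiag[OF S'] cd_norm_cdiag[OF S'']
  unfolding cd_ins_eq rs_C1_union diff_rs_C1 by auto

lemma root_in_ins: "(1, snd (minch S') + k) \<in> cd_ins S' k S''"
  unfolding cd_ins_eq using root_image(2) by simp

end

text \<open>Once C' is known, the right end \<open>snd (minch S') + k\<close> of the root reveals
  \<open>k\<close>, so the index in \<open>rs_idx\<close> is unique.\<close>

lemma rs_idx_ins:
  assumes "insertion S' S'' k" shows "rs_idx (cd_ins S' k S'') = k"
proof -
  interpret insertion S' S'' k by fact
  have "card (rs_C1 (cd_ins S' k S'')) = card S''"
    unfolding cd_ins_eq rs_C1_union by (rule cards)
  moreover have "i = k" if "1 \<le> i" "i \<le> 2 * card S'' - 1" "cd_ins S' k S'' = cd_ins S' i S''" for i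
  proof -
    interpret i: insertion S' S'' i using S' S'' that(1,2) by (rule insertion.intro)
    have "(1, snd (minch S') + i) \<in> cd_ins S' k S''" using i.root_in_ins that(3) by simp
    then show "i = k"
      using matching_fst_eq[OF cdiagD(2)[OF ins_cdiag] root_in_ins, of "(1, snd (minch S') + i)"] by simp
  qed
  ultimately show ?thesis
    unfolding rs_idx_def ins_norm cd_norm_cdiag[OF ins_cdiag]
    by (intro the_equality conjI) (elim conjE | simp only: k refl)+
qed

context insertion begin

lemma itree_ins: "itree (cd_ins S' k S'') = graft (itree P) k (itree Q)"
  using itree_rec[of "cd_ins S' k S''"] rs_idx_ins[OF insertion_axioms] cdiagD(5)[OF ins_cdiag]
    cdiagD(6)[OF S'] cdiagD(6)[OF S''] ins_card
  unfolding cd_ins_eq rs_C1_union diff_rs_C1 by simp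

lemma dtree_ins:
  "dtree (cd_ins S' k S'') (djoin (card S'') d' d'') = graft (dtree S' d') k (dtree S'' d'')"
proof -
  let ?\<delta> = "\<lambda>c. djoin (card S'') d' d'' (chord_pos (P \<union> Q) c)"
  have "P \<noteq> {}" using rP by blast
  have "?\<delta> c = d' (chord_pos P c)" if "c \<in> set_btree (itree P)" for c
    using djoin_chord_pos(1)[OF subsetD[OF set_itree_subset[OF finPQ(1) \<open>P \<noteq> {}\<close>] that]]
    by (simp only: cards)
  then have "map_btree ?\<delta> (itree P) = dtree P d'"
    unfolding dtree_def by (rule btree.map_cong0)
  also have "\<dots> = dtree S' d'" by (rule dtree_relabel[OF cdiagD(2,1)[OF S'] monoP])
  finally have p: "map_btree ?\<delta> (itree P) = dtree S' d'" .
  have "?\<delta> c = d'' (chord_pos Q c)" if "c \<in> set_btree (itree Q)" for c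
    using djoin_chord_pos(2)[OF subsetD[OF set_itree_subset[OF finPQ(2) Qne] that]]
    by (simp only: cards)
  then have "map_btree ?\<delta> (itree Q) = dtree Q d''"
    unfolding dtree_def by (rule btree.map_cong0)
  also have "\<dots> = dtree S'' d''" by (rule dtree_relabel[OF cdiagD(2,1)[OF S''] monoQ])
  finally have q: "map_btree ?\<delta> (itree Q) = dtree S'' d''" .
  show ?thesis
    unfolding dtree_def[of "cd_ins S' k S''"] itree_ins graft_map
    using p q by (simp add: cd_ins_eq)
qed

lemma ahat_ins:
  "ahat a (cd_ins S' k S'') (djoin (card S'') d' d'') =
     ahat a S' d' * a (d' (base S')) (base S' - 1) * ahat a S'' d''"
  using ahat_union[of a d' d''] unfolding cards cd_ins_eq
    ahat_relabel[OF cdiagD(2)[OF S'] monoP] ahat_relabel[OF cdiagD(2)[OF S''] monoQ]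
    base_relabel[OF cdiagD(2)[OF S'] monoP] .

lemma base_ins: "base (cd_ins S' k S'') = Suc (base S'')"
  using base_union unfolding cd_ins_eq base_relabel[OF cdiagD(2)[OF S''] monoQ] .

end

text \<open>Every chord of the rest lies in the gap of the first component \<open>Q\<close> that contains the
  right end of the root; \<open>N\<close> is the relation of lying in the same gap of \<open>Q\<close>.\<close>
lemma cdiag_is_insertion:
  assumes S: "S \<in> cdiag" and card2: "2 \<le> card S"
  obtains S' S'' k where "insertion S' S'' k" "S = cd_ins S' k S''"
proof -
  note D = cdiagD[OF S]
  define r R Q P where "r = minch S" and "R = S - {r}" and "Q = rs_C1 S" and "P = S - Q"
  note sub = rs_C1_subset[OF D(5) card2, folded r_def Q_def]
  have Q_comp: "Q = comp_of R (minch R)" unfolding Q_def rs_C1_def Let_def R_def r_def ..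
  have R: "R \<noteq> {}" "Q \<subseteq> R" using sub(1,4) by (auto simp: R_def)
  have mR: "minch R \<in> Q" unfolding Q_comp by (rule comp_of_mem[OF minch_in[OF R(1)]])
  have PQ: "P \<inter> Q = {}" "P \<union> Q = S" "r \<in> P" "r \<notin> Q" using sub by (auto simp: P_def)
  have mP: "matching P" and mQ: "matching Q" using matching_subset[OF D(2)] PQ(2) by auto
  have r1: "fst r = 1" unfolding r_def by (rule cdiag_root[OF S])
  have fst2: "2 \<le> fst c" if "c \<in> S" "c \<noteq> r" for c
  proof -
    have "fst c \<noteq> fst r" using matching_fst_eq[OF D(2) that(1)] that(2) PQ(2,3) by blast
    moreover have "1 \<le> fst c" using endptsI(1)[OF that(1)] D(3) by simp
    ultimately show ?thesis using r1 by simp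
  qed
  have closed: "y \<in> Q" if "x \<in> Q" "y \<in> S" "y \<noteq> r" "crosses x y" for x y
  proof -
    have "(x, y) \<in> crel R" using that R(2) by (auto simp: crel_def R_def)
    then show ?thesis using that unfolding Q_comp comp_of_def R_def
      by (auto intro: rtrancl_into_rtrancl)
  qed
  then have nocross: "\<not> crosses c q" if "c \<in> P" "c \<noteq> r" "q \<in> Q" for c q
    using that PQ crosses_sym[of c q] by blast
  have connQ: "connected_cd Q" unfolding Q_comp by (rule connected_comp_of)
  have reach: "(r, c) \<in> (crel S)\<^sup>*" if "c \<in> S" for c
    using D(4) that PQ(2,3) unfolding connected_cd_def by blast

  \<comment> \<open>Otherwise \<open>Q\<close>, already closed under crossing apart from the root,
    would be a component of the connected set \<open>S\<close> that misses \<open>r\<close>.\<close>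
  have "\<exists>q\<in>Q. crosses r q"
  proof (rule ccontr)
    assume "\<not> (\<exists>q\<in>Q. crosses r q)"
    then have no: "\<not> crosses r q" if "q \<in> Q" for q using that by blast
    have "(minch R, r) \<in> (crel S)\<^sup>*"
      using reach[of "minch R"] mR PQ(2) crel_rtrancl_sym by blast
    then have "r \<in> Q"
    proof (rule rtrancl_closed[OF _ mR])
      fix x y assume "x \<in> Q" "y \<in> S" "crosses x y"
      then show "y \<in> Q" using closed[of x y] no[of x] crosses_sym[of x y] by blast
    qed
    then show False using PQ(4) by simp
  qed
  then obtain q0 where q0: "q0 \<in> Q" "crosses r q0" by blast
  have "2 \<le> fst q0" by (rule fst2) (use q0(1) PQ(2,4) in auto)
  then have q0': "1 < fst q0" "fst q0 < snd r" "snd r < snd q0"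
    using q0(2) r1 unfolding crosses_def by auto

  have distinct_pts: "p \<noteq> fst c \<and> p \<noteq> snd c" if p: "p \<in> endpts Q" "c \<in> P" for p c
  proof -
    obtain q where q: "q \<in> Q" "p = fst q \<or> p = snd q" using p(1) unfolding endpts_def by blast
    have "q \<noteq> c" "q \<in> S" "c \<in> S" using q p(2) PQ by auto
    then show ?thesis using q(2) D(2) unfolding matching_def by metis
  qed

  define N where "N u v \<longleftrightarrow> (\<forall>p\<in>endpts Q. p < u \<and> p < v \<or> u < p \<and> v < p)" for u v
  have gap: "N (fst c) (snd c)" if c: "c \<in> P" "c \<noteq> r" for c
  proof -
    have lt: "fst c < snd c" by (rule matching_less[OF mP c(1)])
    \<comment> \<open>Without a crossing, \<open>c\<close> either encloses \<open>q\<close> or has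
      neither end of \<open>q\<close> inside it. The first case is then excluded: it would propagate
      along \<open>Q\<close> to \<open>minch R\<close>, whose left end is the smallest in
      \<open>R\<close>.\<close>
    have inout: "fst c < fst q \<and> snd q < snd c \<or>
        (fst q < fst c \<or> snd c < fst q) \<and> (snd q < fst c \<or> snd c < snd q)" if "q \<in> Q" for q
      using nocross[OF c that] distinct_pts[OF endptsI(1)[OF that] c(1)]
        distinct_pts[OF endptsI(2)[OF that] c(1)] matching_less[OF mQ that] lt
      unfolding crosses_def by linarith
    have "\<not> (fst c < fst q \<and> snd q < snd c)" if q: "q \<in> Q" for q
    proof
      assume inside: "fst c < fst q \<and> snd q < snd c"
      have "(q, minch R) \<in> (crel Q)\<^sup>*" using connQ q mR unfolding connected_cd_def by blast
      then have "minch R \<in> {q \<in> Q. fst c < fst q \<and> snd q < snd c}"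
      proof (rule rtrancl_closed)
        show "q \<in> {q \<in> Q. fst c < fst q \<and> snd q < snd c}" using q inside by blast
        fix x y assume xy: "x \<in> {q \<in> Q. fst c < fst q \<and> snd q < snd c}" "y \<in> Q" "crosses x y"
        then have "fst c < fst y \<and> snd y < snd c"
          using inout[of y] matching_less[OF mQ, of x] unfolding crosses_def mem_Collect_eq by linarith
        then show "y \<in> {q \<in> Q. fst c < fst q \<and> snd q < snd c}" using xy by blast
      qed
      moreover have "fst (minch R) \<le> fst c" by (rule minch_le) (use c PQ(2) in \<open>auto simp: R_def\<close>)
      ultimately show False by simp
    qed
    then have out: "(fst q < fst c \<or> snd c < fst q) \<and> (snd q < fst c \<or> snd c < snd q)" if "q \<in> Q" for q
      using inout that by blast
    show ?thesis
      unfolding N_def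
    proof
      fix p assume "p \<in> endpts Q"
      then obtain q where "q \<in> Q" "p = fst q \<or> p = snd q" unfolding endpts_def by blast
      then show "p < fst c \<and> p < snd c \<or> fst c < p \<and> snd c < p" using out[of q] lt by auto
    qed
  qed
  \<comment> \<open>Each of two crossing chords lies in a single gap, so they lie in the same
    one.\<close>
  have N_cross: "N (fst z) w" if "N (fst z) (snd z)" "N (fst y) (snd y)" "N (fst y) w" "crosses y z" for y z w
    unfolding N_def
  proof
    fix p assume p: "p \<in> endpts Q"
    then show "p < fst z \<and> p < w \<or> fst z < p \<and> w < p"
      using that(1)[unfolded N_def, rule_format, OF p] that(2)[unfolded N_def, rule_format, OF p]
        that(3)[unfolded N_def, rule_format, OF p] that(4) unfolding crosses_def by linarith
  qed

  \<comment> \<open>A path from the root may visit \<open>Q\<close> but can leave it only through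
    \<open>r\<close>, so after its last visit to \<open>r\<close> a path to a chord of
    \<open>P\<close> stays in \<open>P\<close>. The induction keeps this remainder and the fact that
    it stays in the gap around \<open>snd r\<close>.\<close>
  have path: "c \<in> Q \<or> c = r \<or> c \<in> P \<and> c \<noteq> r \<and> N (fst c) (snd r) \<and> (r, c) \<in> (crel P)\<^sup>*" if "c \<in> S" for c
    using reach[OF that]
  proof induction
    case (step y z)
    have z: "z \<in> S" "y \<in> S" "crosses y z" using step(2) by (auto simp: crel_def)
    show ?case
    proof (cases "z \<in> Q \<or> z = r")
      case False
      then have zP: "z \<in> P" "z \<noteq> r" using z PQ(2) by auto
      then have "y \<notin> Q" using nocross[of z y] z(3) crosses_sym[of y z] by blast
      then have yP: "y \<in> P" using z(2) PQ(2) by blast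
      then have "(y, z) \<in> crel P" using zP z(3) by (simp add: crel_def)
      moreover have "(r, y) \<in> (crel P)\<^sup>*" using step(3) \<open>y \<notin> Q\<close> by auto
      ultimately have "(r, z) \<in> (crel P)\<^sup>*" by (rule rtrancl_into_rtrancl[rotated])
      moreover have "N (fst z) (snd r)"
      proof (cases "y = r")
        case True
        \<comment> \<open>\<open>r\<close> starts at 1, before \<open>z\<close>, so a crossing puts
          \<open>snd r\<close> between the ends of \<open>z\<close>.\<close>
        then have "fst z < snd r \<and> snd r < snd z"
          using z(3) fst2[OF z(1) zP(2)] r1 unfolding crosses_def by auto
        then show ?thesis using gap[OF zP] unfolding N_def by force
      next
        case False
        then have "N (fst y) (snd r)" using step(3) \<open>y \<notin> Q\<close> by blast
        then show ?thesis using N_cross[OF gap[OF zP] gap[OF yP False]] z(3) by blast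
      qed
      ultimately show ?thesis using zP by blast
    qed blast
  qed blast
  have connP: "connected_cd P"
  proof (rule connected_rootI)
    fix c assume "c \<in> P"
    then show "(r, c) \<in> (crel P)\<^sup>*" using path[of c] PQ by blast
  qed

  have ptsN: "N p (snd r)" if p: "p \<in> endpts P - {1}" for p
  proof -
    obtain c where c: "c \<in> P" "p = fst c \<or> p = snd c" using p unfolding endpts_def by blast
    show ?thesis
    proof (cases "c = r")
      case True
      then have "p = snd r" using c(2) p r1 by auto
      then show ?thesis using distinct_pts[OF _ PQ(3)] unfolding N_def by (metis linorder_neq_iff)
    next
      case False
      then have "N (fst c) (snd r)" using path[of c] c PQ by blast
      then show ?thesis using gap[OF c(1) False] c(2) unfolding N_def by (metis order.asym)
    qed
  qed
  define A where "A = endpts P - {1}"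
  have finA: "finite A" unfolding A_def using finite_endpts[OF matching_finite[OF mP]] by simp
  have yA: "snd r \<in> A" unfolding A_def using endptsI(2)[OF PQ(3)] matching_less[OF mP PQ(3)] r1 by simp
  have cover: "endpts P \<union> endpts Q = {1..2 * card S}" using PQ(2) D(3) endpts_Un by metis
  have disj: "endpts P \<inter> endpts Q = {}"
  proof -
    have False if p: "p \<in> endpts P" "p \<in> endpts Q" for p
    proof -
      obtain c where "c \<in> P" "p = fst c \<or> p = snd c" using p(1) unfolding endpts_def by blast
      then show False using distinct_pts[OF p(2)] by blast
    qed
    then show ?thesis by blast
  qed
  have one: "1 \<in> endpts P" using endptsI(1)[OF PQ(3)] r1 by simp
  \<comment> \<open>Both ends of \<open>A\<close> lie in the gap of \<open>snd r\<close>, so no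
    endpoint of \<open>Q\<close> separates them: the endpoints of \<open>P\<close> other than 1 form
    one block of consecutive positions.\<close>
  define u v where "u = Min A" and "v = Max A"
  have "A \<noteq> {}" using yA by blast
  then have uv: "u \<in> A" "v \<in> A" "u \<le> snd r" "snd r \<le> v"
    unfolding u_def v_def using finA yA Min_in[of A] Max_in[of A] by auto
  have A_eq: "A = {u..v}"
  proof
    show "A \<subseteq> {u..v}" unfolding u_def v_def using finA by auto
    show "{u..v} \<subseteq> A"
    proof
      fix p assume p: "p \<in> {u..v}"
      have "u \<in> {1..2 * card S}" "u \<noteq> 1" "v \<in> {1..2 * card S}"
        using uv(1,2) unfolding cover[symmetric] A_def by auto
      then have "p \<in> endpts P \<union> endpts Q" "p \<noteq> 1" using p unfolding cover by auto
      moreover have "p \<notin> endpts Q"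
        using ptsN[of u] ptsN[of v] uv p unfolding N_def A_def by force
      ultimately show "p \<in> A" unfolding A_def by blast
    qed
  qed
  have cardA: "card A = 2 * card P - 1"
    unfolding A_def using one card_endpts[OF mP] finite_endpts[OF matching_finite[OF mP]] by simp
  have cP: "1 \<le> card P" using PQ(3) matching_finite[OF mP] by (auto simp: Suc_le_eq card_gt_0_iff)
  have v_eq: "v = u + 2 * card P - 2" using cardA cP uv unfolding A_eq by simp
  have card_S: "card S = card P + card Q"
    using card_Un_disjoint[OF matching_finite[OF mP] matching_finite[OF mQ] PQ(1)] PQ(2) by simp
  \<comment> \<open>Position 1 belongs to the root, and the left end of \<open>minch R\<close>, at
    least 2, still precedes the block; this gives \<open>k \<ge> 1\<close>.\<close>
  have u3: "3 \<le> u"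
  proof -
    have mR2: "2 \<le> fst (minch R)" using fst2[of "minch R"] mR PQ(2,4) by auto
    have "fst (minch R) < u"
    proof -
      have notP: "fst (minch R) \<notin> endpts P" using disj endptsI(1)[OF mR] by blast
      obtain c where c: "c \<in> P" "u = fst c \<or> u = snd c" using uv(1) unfolding A_def endpts_def by blast
      show ?thesis
      proof (cases "c = r")
        case True
        then have "u = snd r" using c(2) uv(1) r1 unfolding A_def by auto
        moreover have "fst (minch R) \<le> fst q0" by (rule minch_le) (use q0 R in auto)
        ultimately show ?thesis using q0' by simp
      next
        case False
        then have "fst (minch R) \<le> fst c" by (intro minch_le) (use c PQ(2) in \<open>auto simp: R_def\<close>)
        moreover have "fst (minch R) \<noteq> fst c" using notP endptsI(1)[OF c(1)] by metis
        ultimately show ?thesis using c(2) matching_less[OF mP c(1)] by auto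
      qed
    qed
    then show ?thesis using mR2 by simp
  qed
  \<comment> \<open>In an insertion the block of C' starts at position \<open>k + 2\<close>, compare
    \<open>endpts_PQ\<close>.\<close>
  define k where "k = u - 2"
  \<comment> \<open>\<open>q0\<close> ends to the right of the block, so some endpoint of
    \<open>Q\<close> follows it; this gives the upper bound on \<open>k\<close>.\<close>
  have v2: "v < 2 * card S"
  proof -
    have "snd q0 \<in> endpts Q" by (rule endptsI(2)[OF q0(1)])
    then have "snd q0 \<notin> A" "snd q0 \<le> 2 * card S" using disj cover unfolding A_def by auto
    then show ?thesis using q0'(3) uv(3) unfolding A_eq by auto
  qed
  have uk: "u = k + 2" "v = k + 2 * card P" using u3 v_eq cP unfolding k_def by auto
  have k: "1 \<le> k" "k \<le> 2 * card Q - 1" using u3 v2 uk card_S by auto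
  have eP: "endpts P = insert 1 {k + 2..k + 2 * card P}"
    using A_eq one uk unfolding A_def by blast
  have eQ: "endpts Q = {2..k + 1} \<union> {k + 2 * card P + 1..2 * card P + 2 * card Q}"
  proof -
    have "endpts Q = {1..2 * card S} - endpts P" using cover disj by blast
    moreover have "x \<in> {1..2 * (card P + card Q)} - insert 1 {k + 2..k + 2 * card P} \<longleftrightarrow>
        x \<in> {2..k + 1} \<union> {k + 2 * card P + 1..2 * card P + 2 * card Q}" for x
      unfolding Diff_iff insert_iff Un_iff atLeastAtMost_iff using k cP by arith
    ultimately show ?thesis unfolding eP card_S by blast
  qed

  \<comment> \<open>Inverses of \<open>insP k\<close> and \<open>insQ (card P) k\<close> on the
    endpoints in question.\<close>
  define \<alpha> \<beta> where "\<alpha> x = (if x = 1 then 1 else x - k)"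
    and "\<beta> x = (if x \<le> k + 1 then x - 1 else x - 2 * card P)" for x :: nat
  have ma: "strict_mono_on (endpts P) \<alpha>"
    unfolding eP by (rule strict_mono_onI) (auto simp: \<alpha>_def)
  have mb: "strict_mono_on (endpts Q) \<beta>"
    unfolding eQ by (rule strict_mono_onI) (auto simp: \<beta>_def)
  have inv_a: "insP k (\<alpha> x) = x" if "x \<in> endpts P" for x
    using that unfolding eP by (auto simp: \<alpha>_def insP_def)
  have inv_b: "insQ (card P) k (\<beta> x) = x" if "x \<in> endpts Q" for x
    using that unfolding eQ by (auto simp: \<beta>_def insQ_def)
  let ?S' = "relabel \<alpha> ` P" and ?S'' = "relabel \<beta> ` Q"
  have cards: "card ?S' = card P" "card ?S'' = card Q"
    using card_image[OF inj_on_relabel[OF ma]] card_image[OF inj_on_relabel[OF mb]] by auto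
  have imP: "\<alpha> ` endpts P = {1..2 * card P}"
  proof -
    have "\<alpha> ` endpts P = \<alpha> ` insP k ` {1..2 * card P}" unfolding eP insP_image[OF cP] ..
    also have "\<dots> = (\<lambda>x. x) ` {1..2 * card P}"
      unfolding image_image by (rule image_cong) (auto simp: \<alpha>_def insP_def)
    finally show ?thesis by simp
  qed
  have imQ: "\<beta> ` endpts Q = {1..2 * card Q}"
  proof -
    have kk: "k \<le> 2 * card Q" using k by simp
    have "\<beta> ` endpts Q = \<beta> ` insQ (card P) k ` {1..2 * card Q}" unfolding eQ insQ_image[OF kk] ..
    also have "\<dots> = (\<lambda>x. x) ` {1..2 * card Q}"
      unfolding image_image by (rule image_cong) (use cP in \<open>auto simp: \<beta>_def insQ_def\<close>)
    finally show ?thesis by simp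
  qed
  have S': "?S' \<in> cdiag"
    unfolding cdiag_def using PQ(3) cards imP matching_relabel[OF ma] connected_relabel[OF ma] mP connP
    by (auto simp: endpts_relabel)
  have S'': "?S'' \<in> cdiag"
    unfolding cdiag_def using mR cards imQ matching_relabel[OF mb] connected_relabel[OF mb] mQ connQ
    by (auto simp: endpts_relabel)
  have ins: "insertion ?S' ?S'' k"
    using S' S'' k unfolding cards(2)[symmetric] by (rule insertion.intro)
  have "relabel (insP k) ` ?S' = P"
  proof -
    have "relabel (insP k) ` ?S' = (\<lambda>c. c) ` P"
      unfolding image_image by (rule image_cong) (simp_all add: prod_eq_iff inv_a endptsI)
    then show ?thesis by simp
  qed
  moreover have "relabel (insQ (card P) k) ` ?S'' = Q"
  proof -
    have "relabel (insQ (card P) k) ` ?S'' = (\<lambda>c. c) ` Q"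
      unfolding image_image by (rule image_cong) (simp_all add: prod_eq_iff inv_b endptsI)
    then show ?thesis by simp
  qed
  ultimately have "cd_ins ?S' k ?S'' = S"
    using insertion.cd_ins_eq[OF ins] PQ(2) cards by simp
  then show thesis using that[OF ins] by simp
qed

section \<open>Weights of decorated diagrams\<close>

context
  assumes Qalg: "\<And>n::nat. n > 0 \<Longrightarrow> (of_nat n :: 'a::comm_ring_1) dvd 1"
begin

lemma qinv_right: "n > 0 \<Longrightarrow> of_nat n * (qinv n :: 'a) = 1"
  unfolding qinv_def using Qalg[of n] by (intro someI_ex[of "\<lambda>y. of_nat n * y = 1"]) (auto simp: dvd_def)

lemma qinv_unique:
  assumes "n > 0" "of_nat n * y = (1 :: 'a)" shows "qinv n = y"
  using qinv_right[OF assms(1)] assms(2) by (metis mult.assoc mult.commute mult_1)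

lemma qinv_one: "qinv (Suc 0) = (1 :: 'a)"
  by (rule qinv_unique) auto

lemma qinv_fact_Suc: "of_nat (Suc n) * qinv (fact (Suc n)) = (qinv (fact n) :: 'a)"
proof (rule qinv_unique[symmetric])
  have "of_nat (fact n) * (of_nat (Suc n) * qinv (fact (Suc n))) =
      of_nat (fact (Suc n)) * (qinv (fact (Suc n)) :: 'a)"
    by (simp only: fact_Suc of_nat_id of_nat_mult mult_ac)
  also have "\<dots> = 1" by (rule qinv_right) simp
  finally show "of_nat (fact n) * (of_nat (Suc n) * qinv (fact (Suc n))) = (1 :: 'a)" .
qed simp

lemma abinom_0: "abinom y 0 = (1 :: 'a)"
  by (simp add: abinom_def qinv_one)

text \<open>Both arguments of the binomial grow by one, so the numerator only gains the factor
  \<open>y + v - 1\<close> in front. With \<open>y = s * d\<close> this is the hypothesis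
  \<open>f_Suc\<close> for \<open>g = s * d - 1\<close>.\<close>

lemma abinom_rising_Suc:
  "of_nat (Suc v) * (abinom (y + int (Suc v) - 2) (Suc v) :: 'a) =
     (of_int y - 1 + of_nat v) * abinom (y + int v - 2) v"
proof -
  have "(\<Prod>i<Suc v. of_int (y + int (Suc v) - 2 - int i)) =
      (of_int (y + int v - 1) :: 'a) * (\<Prod>i<v. of_int (y + int v - 2 - int i))"
    by (subst prod.lessThan_Suc_shift) (simp add: algebra_simps)
  then have "of_nat (Suc v) * (abinom (y + int (Suc v) - 2) (Suc v) :: 'a) =
      of_int (y + int v - 1) * (\<Prod>i<v. of_int (y + int v - 2 - int i)) * (of_nat (Suc v) * qinv (fact (Suc v)))"
    unfolding abinom_def by (simp only: mult_ac)
  then show ?thesis unfolding qinv_fact_Suc abinom_def by (simp add: mult_ac algebra_simps)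
qed

end

text \<open>An index out of range would make \<open>graft\<close> drop its first tree, so the
  argument goes through \<open>cdiag_is_insertion\<close>, which bounds \<open>k\<close>. Counting
  with multiplicity also yields distinctness of the leaves.\<close>

lemma mset_leaves_itree: "S \<in> cdiag \<Longrightarrow> mset (leaves (itree S)) = mset_set S"
proof (induction "card S" arbitrary: S rule: less_induct)
  case less
  show ?case
  proof (cases "2 \<le> card S")
    case True
    from less.prems True obtain S' S'' k where ins: "insertion S' S'' k" and S: "S = cd_ins S' k S''"
      by (rule cdiag_is_insertion)
    interpret insertion S' S'' k by (rule ins)
    have IH: "mset (leaves (itree S')) = mset_set S'" "mset (leaves (itree S'')) = mset_set S''"
      using less.hyps[OF _ S'] less.hyps[OF _ S''] ins_card cdiagD(6)[OF S'] cdiagD(6)[OF S''] S by auto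
    have "length (leaves (itree S'')) = card S''"
      using IH(2) by (metis size_mset size_mset_set)
    moreover have "itree Q = map_btree (relabel (insQ (card S') k)) (itree S'')"
      "itree P = map_btree (relabel (insP k)) (itree S')"
      using itree_relabel[OF cdiagD(2,1)[OF S'']  monoQ] itree_relabel[OF cdiagD(2,1)[OF S'] monoP] by auto
    moreover from calculation have "k \<le> nverts (itree Q)"
      using nverts_leaves[of "itree S''"] k by simp
    ultimately have "mset (leaves (itree S)) = image_mset (relabel (insP k)) (mset_set S') +
        image_mset (relabel (insQ (card S') k)) (mset_set S'')"
      using k by (simp add: S itree_ins mset_leaves_graft leaves_map IH)
    also have "\<dots> = mset_set P + mset_set Q"
      by (simp add: image_mset_mset_set inj_on_relabel monoP monoQ)
    also have "\<dots> = mset_set S"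
      unfolding S cd_ins_eq using mset_set_Union[OF finPQ disjoint] by simp
    finally show ?thesis .
  next
    case False
    then have "card S = 1" using cdiagD(6)[OF less.prems] by simp
    then obtain c where "S = {c}" by (metis card_1_singletonE)
    then show ?thesis by (simp add: itree_singleton)
  qed
qed

lemma leaves_itree:
  assumes "S \<in> cdiag" shows "set (leaves (itree S)) = S" "distinct (leaves (itree S))"
proof -
  note * = mset_leaves_itree[OF assms]
  show "set (leaves (itree S)) = S"
    using arg_cong[OF *, of set_mset] cdiagD(5)[OF assms] by simp
  then show "distinct (leaves (itree S))"
    using arg_cong[OF *, of size] by (intro card_distinct) simp
qed

definition chord_weight :: "int \<Rightarrow> nat \<Rightarrow> nat \<Rightarrow> 'a::comm_ring_1" where
  "chord_weight s e v = abinom (s * int e + int v - 2) v"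

text \<open>\<open>nu\<close> looks leaves up by \<open>map_of\<close>; as the leaves are distinct
  and are exactly the chords, the lookup is unambiguous and the product over labels becomes one over
  leaves.\<close>

lemma cd_weight_dtree:
  assumes S: "S \<in> cdiag" shows "cd_weight s S d = (tree_weight (chord_weight s) 0 (dtree S d) :: 'a::comm_ring_1)"
proof -
  let ?t = "itree S" and ?\<delta> = "\<lambda>c. d (chord_pos S c)"
  let ?n = "\<lambda>c. the (map_of (lnu 0 ?t) c)"
  note fin = cdiagD(5)[OF S] and leaves = leaves_itree[OF S]
  have lnu0: "lnu 0 ?t = map (\<lambda>(b, p). (b, length (takeWhile id (rev p)))) (leafpaths ?t)"
    by (simp add: lnu_leafpaths)
  have nu: "nu S i = ?n (chord_lab S i)" if "i \<in> {1..card S}" for i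
  proof -
    have "chord_lab S i \<in> set (map fst (leafpaths ?t))"
      using chord_lab_in[OF fin, of i] that leaves(1) unfolding leaves_def by simp
    then obtain p where "map_of (leafpaths ?t) (chord_lab S i) = Some p"
      by (metis map_of_eq_None_iff not_Some_eq set_map)
    then show ?thesis unfolding nu_def lnu0 map_of_map by simp
  qed
  have "(cd_weight s S d :: 'a) = (\<Prod>i\<in>{1..card S}. chord_weight s (?\<delta> (chord_lab S i)) (?n (chord_lab S i)))"
    unfolding cd_weight_def chord_weight_def
    by (rule prod.cong) (simp_all add: nu chord_pos_lab[OF fin])
  also have "\<dots> = (\<Prod>c\<in>S. chord_weight s (?\<delta> c) (?n c))"
    by (rule prod.reindex_bij_betw[OF chord_lab_bij[OF fin]])
  also have "\<dots> = prod_list (map (\<lambda>c. chord_weight s (?\<delta> c) (?n c)) (leaves ?t))"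
    using prod.distinct_set_conv_list[OF leaves(2)] leaves(1) by simp
  also have "\<dots> = prod_list (map (\<lambda>(c, v). chord_weight s (?\<delta> c) v) (lnu 0 ?t))"
  proof -
    have "?n c = v" if "(c, v) \<in> set (lnu 0 ?t)" for c v
      using map_of_is_SomeI[OF _ that] leaves(2) by (simp add: map_fst_lnu)
    then have "map (\<lambda>(c, v). chord_weight s (?\<delta> c) v :: 'a) (lnu 0 ?t) =
        map (\<lambda>x. chord_weight s (?\<delta> (fst x)) (?n (fst x))) (lnu 0 ?t)"
      by (intro map_cong) auto
    also have "\<dots> = map (\<lambda>c. chord_weight s (?\<delta> c) (?n c)) (map fst (lnu 0 ?t))" by simp
    finally show ?thesis by (simp only: map_fst_lnu)
  qed
  also have "\<dots> = tree_weight (chord_weight s) 0 (dtree S d)"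
    unfolding tree_weight_def dtree_def lnu_map by (simp add: comp_def case_prod_beta')
  finally show ?thesis .
qed

lemma nverts_dtree: "S \<in> cdiag \<Longrightarrow> nverts (dtree S d) = 2 * card S - 1"
  using nverts_leaves[of "itree S"] leaves_itree[of S] distinct_card[of "leaves (itree S)"]
  by (simp add: dtree_def)

lemma sum_leaves_dtree:
  assumes S: "S \<in> cdiag"
  shows "sum_list (map h (leaves (dtree S d))) = (\<Sum>i\<in>{1..card S}. h (d i))"
proof -
  note fin = cdiagD(5)[OF S] and leaves = leaves_itree[OF S]
  have "sum_list (map h (leaves (dtree S d))) = sum_list (map (\<lambda>c. h (d (chord_pos S c))) (leaves (itree S)))"
    by (simp add: dtree_def leaves_map comp_def)
  also have "\<dots> = (\<Sum>c\<in>S. h (d (chord_pos S c)))"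
    using sum.distinct_set_conv_list[OF leaves(2)] leaves(1) by metis
  also have "\<dots> = (\<Sum>i\<in>{1..card S}. h (d (chord_pos S (chord_lab S i))))"
    by (rule sum.reindex_bij_betw[OF chord_lab_bij[OF fin], symmetric])
  also have "\<dots> = (\<Sum>i\<in>{1..card S}. h (d i))"
    by (rule sum.cong) (simp_all add: chord_pos_lab[OF fin])
  finally show ?thesis .
qed

text \<open>With \<open>g e = s * e - 1\<close> the sum in \<open>graft_sum\<close> becomes
  \<open>s\<close> times the norm of C''; the indices \<open>1..2 * card S'' - 1\<close> are exactly
  the vertices of its tree.\<close>

lemma sum_cd_weight_ins:
  assumes Qalg: "\<And>n::nat. n > 0 \<Longrightarrow> (of_nat n :: 'a::comm_ring_1) dvd 1"
    and S': "S' \<in> cdiag" and S'': "S'' \<in> cdiag"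
  shows "(\<Sum>k\<in>{1..2 * card S'' - 1}. cd_weight s (cd_ins S' k S'') (djoin (card S'') d' d'')) =
    cd_weight s S' d' * ((of_int (s * int (dnorm (card S'') d'')) - 1) * (cd_weight s S'' d'' :: 'a))"
proof -
  let ?f = "chord_weight s :: nat \<Rightarrow> nat \<Rightarrow> 'a" and ?g = "\<lambda>e. of_int (s * int e) - 1 :: 'a"
  have f: "of_nat (Suc v) * ?f e (Suc v) = (?g e + of_nat v) * ?f e v" for e v
    unfolding chord_weight_def by (rule abinom_rising_Suc[OF Qalg])
  have "(\<Sum>k\<in>{1..2 * card S'' - 1}. cd_weight s (cd_ins S' k S'') (djoin (card S'') d' d'')) =
      (\<Sum>k\<in>{1..nverts (dtree S'' d'')}. tree_weight ?f 0 (graft (dtree S' d') k (dtree S'' d'')))"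
  proof (rule sum.cong)
    fix k assume "k \<in> {1..nverts (dtree S'' d'')}"
    then interpret insertion S' S'' k
      using S' S'' by unfold_locales (auto simp: nverts_dtree)
    show "cd_weight s (cd_ins S' k S'') (djoin (card S'') d' d'') =
       tree_weight ?f 0 (graft (dtree S' d') k (dtree S'' d''))"
      by (simp only: cd_weight_dtree[OF ins_cdiag] dtree_ins)
  qed (simp add: nverts_dtree[OF S''])
  also have "\<dots> = tree_weight ?f 0 (dtree S' d') *
      ((sum_list (map (\<lambda>e. ?g e + 1) (leaves (dtree S'' d''))) - 1) * tree_weight ?f 0 (dtree S'' d''))"
    by (rule graft_sum[OF f])
  also have "sum_list (map (\<lambda>e. ?g e + 1) (leaves (dtree S'' d''))) = of_int (s * int (dnorm (card S'') d''))"
    by (simp add: sum_leaves_dtree[OF S''] dnorm_def sum_distrib_left)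
  finally show ?thesis by (simp only: cd_weight_dtree S' S'')
qed

section \<open>Sums over decorated diagrams\<close>

definition decs :: "nat \<Rightarrow> (nat \<Rightarrow> nat) set" where
  "decs n = {d. (\<forall>i\<in>{1..n}. 1 \<le> d i) \<and> (\<forall>i. i \<notin> {1..n} \<longrightarrow> d i = 0)}"

definition ddiag :: "nat \<Rightarrow> ((nat \<times> nat) set \<times> (nat \<Rightarrow> nat)) set" where
  "ddiag N = {(S, d). S \<in> cdiag \<and> d \<in> decs (card S) \<and> dnorm (card S) d = N}"

lemma decs_dnorm:
  assumes "d \<in> decs n" shows "n \<le> dnorm n d" "i \<in> {1..n} \<Longrightarrow> d i \<le> dnorm n d" "d i \<le> dnorm n d"
proof -
  have "(\<Sum>i\<in>{1..n}. 1) \<le> (\<Sum>i\<in>{1..n}. d i)"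
    using assms by (intro sum_mono) (auto simp: decs_def)
  then show "n \<le> dnorm n d" by (simp add: dnorm_def)
  show *: "d i \<le> dnorm n d" if "i \<in> {1..n}" for i
    unfolding dnorm_def using that by (intro member_le_sum) auto
  then show "d i \<le> dnorm n d" using assms by (cases "i \<in> {1..n}") (auto simp: decs_def)
qed

lemma ddiagD:
  assumes "(S, d) \<in> ddiag N"
  shows "S \<in> cdiag" "d \<in> decs (card S)" "dnorm (card S) d = N" "card S \<le> N"
    "1 \<le> base S" "base S \<le> N" "1 \<le> d (base S)" "d (base S) \<le> N"
proof -
  show S: "S \<in> cdiag" and d: "d \<in> decs (card S)" and N: "dnorm (card S) d = N"
    using assms by (auto simp: ddiag_def)
  note b = base_bounds[OF cdiagD(1,5)[OF S]]
  show "card S \<le> N" using decs_dnorm(1)[OF d] N by simp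
  then show "1 \<le> base S" "base S \<le> N" using b by auto
  have "base S \<in> {1..card S}" using b by simp
  then show "1 \<le> d (base S)" "d (base S) \<le> N" using d N decs_dnorm(2)[OF d] by (auto simp: decs_def)
qed

text \<open>Decorations are positive, so the size of a diagram is at most its norm \<open>N\<close>;
  this bounds both endpoints and decorations.\<close>

lemma finite_ddiag: "finite (ddiag N)"
proof (rule finite_subset)
  show "ddiag N \<subseteq> Pow ({1..2 * N} \<times> {1..2 * N}) \<times>
      {d. \<forall>i. (i \<in> {..N} \<longrightarrow> d i \<in> {..N}) \<and> (i \<notin> {..N} \<longrightarrow> d i = 0)}"
  proof (rule subsetI)
    fix p assume p: "p \<in> ddiag N"
    obtain S d where pS: "p = (S, d)" by (cases p)
    note D = ddiagD[OF p[unfolded pS]]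
    have "fst c \<in> {1..2 * N}" "snd c \<in> {1..2 * N}" if "c \<in> S" for c
      using endptsI[OF that] cdiagD(3)[OF D(1)] D(4) by auto
    then have "S \<subseteq> {1..2 * N} \<times> {1..2 * N}" by (auto simp: mem_Times_iff)
    moreover have "d i \<le> N" for i using decs_dnorm(3)[OF D(2)] D(3) by simp
    moreover have "d i = 0" if "\<not> i \<le> N" for i using that D(2,4) by (auto simp: decs_def)
    ultimately show "p \<in> Pow ({1..2 * N} \<times> {1..2 * N}) \<times>
      {d. \<forall>i. (i \<in> {..N} \<longrightarrow> d i \<in> {..N}) \<and> (i \<notin> {..N} \<longrightarrow> d i = 0)}"
      unfolding pS by auto
  qed
  show "finite (Pow ({1..2 * N} \<times> {1..2 * N}) \<times>
      {d. \<forall>i. (i \<in> {..N} \<longrightarrow> d i \<in> {..N}) \<and> (i \<notin> {..N} \<longrightarrow> d i = (0::nat))})"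
    by (intro finite_cartesian_product finite_set_of_finite_funs) auto
qed

lemma card1_cdiag:
  assumes "S \<in> cdiag" "card S = 1" shows "S = {(1, 2)}"
proof -
  note D = cdiagD[OF assms(1)]
  obtain x y where S: "S = {(x, y)}" using assms(2) by (metis card_1_singletonE surj_pair)
  have "x < y" using matching_less[OF D(2)] S by force
  moreover have "{1..2} = {1, 2 :: nat}" by auto
  then have "{x, y} = {1, 2}" using D(3) assms(2) S unfolding endpts_def by (simp add: insert_commute)
  ultimately show ?thesis using S by (auto simp: doubleton_eq_iff)
qed

lemma cdiag_single: "{(1, 2)} \<in> cdiag"
proof -
  have "endpts {(1, 2)} = {1..2}" unfolding endpts_def by auto
  then show ?thesis by (auto simp: cdiag_def matching_def connected_cd_def)
qed

lemma single_stats: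
  assumes Qalg: "\<And>n::nat. n > 0 \<Longrightarrow> (of_nat n :: 'a::comm_ring_1) dvd 1"
  shows "base {(1, 2)} = 1" "ahat a {(1, 2)} d = (1 :: 'a)" "cd_weight s {(1, 2)} d = (1 :: 'a)"
proof -
  have t: "{i. terminal {(1, 2)} i} = {1}" by (auto simp: terminal_def)
  then show "base {(1, 2)} = 1" by (simp add: base_def del: One_nat_def)
  have "terminals {(1, 2)} = [1]" by (rule terminals_eqI) (simp_all add: t del: One_nat_def)
  then show "ahat a {(1, 2)} d = 1" by (simp add: ahat_consec t One_nat_def[symmetric] del: One_nat_def)
  show "cd_weight s {(1, 2)} d = (1 :: 'a)"
    by (simp add: cd_weight_dtree[OF cdiag_single] dtree_def itree_singleton tree_weight_simps
        chord_weight_def abinom_0[OF Qalg] del: One_nat_def)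
qed

lemma ddiag_single:
  "{(S, d) \<in> ddiag N. card S = 1} =
    (if 1 \<le> N then {({(1, 2)}, \<lambda>i. if i = 1 then N else 0)} else {})"
proof -
  have dec: "d \<in> decs 1 \<and> dnorm 1 d = N \<longleftrightarrow> 1 \<le> N \<and> d = (\<lambda>i. if i = 1 then N else 0)" for d
    by (auto simp: decs_def dnorm_def fun_eq_iff)
  have "(S, d) \<in> ddiag N \<and> card S = 1 \<longleftrightarrow> S = {(1, 2)} \<and> d \<in> decs 1 \<and> dnorm 1 d = N" for S d
    using card1_cdiag[of S] cdiag_single unfolding ddiag_def by auto
  then show ?thesis unfolding dec by auto
qed

section \<open>Root shares of decorated diagrams\<close>

lemma label_range_split:
  assumes "1 \<le> n"
  shows "{1..n + m} = insert 1 (Suc ` {1..m} \<union> (\<lambda>i. i + m) ` {2..n})" (is "_ = ?R")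
proof (rule set_eqI)
  fix i
  show "i \<in> {1..n + m} \<longleftrightarrow> i \<in> ?R"
  proof
    assume i: "i \<in> {1..n + m}"
    consider "i = 1" | "2 \<le> i" "i \<le> Suc m" | "Suc m < i" using i by fastforce
    then show "i \<in> ?R"
    proof cases
      case 2 then have "i = Suc (i - 1)" "i - 1 \<in> {1..m}" by auto
      then show ?thesis by blast
    next
      case 3 then have "i = (i - m) + m" "i - m \<in> {2..n}" using i by auto
      then show ?thesis by blast
    qed simp
  qed (use assms in auto)
qed

lemma djoin_decs:
  assumes "d' \<in> decs n" "d'' \<in> decs m" "1 \<le> n" shows "djoin m d' d'' \<in> decs (n + m)"
proof -
  have "1 \<le> djoin m d' d'' i" if i: "i \<in> {1..n + m}" for i
  proof -
    consider "i = 1" | "2 \<le> i" "i \<le> Suc m" | "Suc m < i" using i by fastforce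
    moreover have "1 \<le> d' j" if "1 \<le> j" "j \<le> n" for j using assms(1) that by (simp add: decs_def)
    moreover have "1 \<le> d'' j" if "1 \<le> j" "j \<le> m" for j using assms(2) that by (simp add: decs_def)
    ultimately show ?thesis using assms(3) i by cases (simp_all add: djoin_def)
  qed
  moreover have "djoin m d' d'' i = 0" if i: "i \<notin> {1..n + m}" for i
  proof -
    have "d' j = 0" if "n < j" for j using assms(1) that by (simp add: decs_def)
    moreover have "d'' 0 = 0" using assms(2) by (simp add: decs_def)
    moreover have "i = 0 \<or> n + m < i" using i by auto
    ultimately show ?thesis using assms(3) by (auto simp: djoin_def)
  qed
  ultimately show ?thesis by (simp add: decs_def)
qed

lemma djoin_dnorm:
  assumes "1 \<le> n" shows "dnorm (n + m) (djoin m d' d'') = dnorm n d' + dnorm m d''"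
proof -
  let ?d = "djoin m d' d''"
  have "dnorm (n + m) ?d = ?d 1 + sum ?d (Suc ` {1..m} \<union> (\<lambda>i. i + m) ` {2..n})"
    unfolding dnorm_def label_range_split[OF assms] by (subst sum.insert) auto
  also have "sum ?d (Suc ` {1..m} \<union> (\<lambda>i. i + m) ` {2..n}) = sum ?d (Suc ` {1..m}) + sum ?d ((\<lambda>i. i + m) ` {2..n})"
    by (rule sum.union_disjoint) auto
  also have "sum ?d (Suc ` {1..m}) = dnorm m d''"
    unfolding dnorm_def by (subst sum.reindex) (auto simp: djoin_simps)
  also have "sum ?d ((\<lambda>i. i + m) ` {2..n}) = sum d' {2..n}"
    by (subst sum.reindex) (auto simp: djoin_simps)
  also have "{1..n} = insert 1 {2..n}" using assms by auto
  then have "dnorm n d' = d' 1 + sum d' {2..n}" unfolding dnorm_def by simp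
  ultimately show ?thesis by (simp add: djoin_simps)
qed

lemma djoin_inj:
  assumes "d' \<in> decs n" "e' \<in> decs n" "d'' \<in> decs m" "e'' \<in> decs m"
    and eq: "djoin m d' d'' = djoin m e' e''"
  shows "d' = e'" "d'' = e''"
proof -
  show "d' = e'"
  proof
    fix i :: nat consider "i = 0" | "i = 1" | "2 \<le> i" by linarith
    then show "d' i = e' i"
    proof cases
      case 1 then show ?thesis using assms by (simp add: decs_def)
    next
      case 2 then show ?thesis using fun_cong[OF eq, of 1] by (simp add: djoin_simps)
    next
      case 3 then show ?thesis using fun_cong[OF eq, of "i + m"] by (simp add: djoin_simps)
    qed
  qed
  show "d'' = e''"
  proof
    fix i show "d'' i = e'' i"
    proof (cases "1 \<le> i \<and> i \<le> m")
      case True then show ?thesis using fun_cong[OF eq, of "Suc i"] by (simp add: djoin_simps)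
    next
      case False then show ?thesis using assms by (auto simp: decs_def)
    qed
  qed
qed

lemma djoin_surj:
  assumes "d \<in> decs (n + m)" "1 \<le> n"
  obtains d' d'' where "d' \<in> decs n" "d'' \<in> decs m" "d = djoin m d' d''"
proof -
  define d' d'' where "d' i = (if i = 0 then 0 else if i = 1 then d 1 else d (i + m))"
    and "d'' i = (if 1 \<le> i \<and> i \<le> m then d (Suc i) else 0)" for i
  have d0: "d i = 0" if "i = 0 \<or> n + m < i" for i using assms(1) that by (auto simp: decs_def)
  have "d' \<in> decs n" "d'' \<in> decs m"
    using assms by (auto simp: decs_def d'_def d''_def)
  moreover have "d = djoin m d' d''"
  proof
    fix i consider "i = 0" | "i = 1" | "2 \<le> i" "i \<le> Suc m" | "Suc m < i" by linarith
    then show "d i = djoin m d' d'' i"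
      by cases (auto simp: djoin_def d'_def d''_def d0)
  qed
  ultimately show thesis by (rule that)
qed

text \<open>The norm \<open>i\<close> of C' is stored as well, so that sums over this set become
  convolutions.\<close>

definition root_shares :: "nat \<Rightarrow> (nat \<times> ((nat \<times> nat) set \<times> (nat \<Rightarrow> nat)) \<times> ((nat \<times> nat) set \<times> (nat \<Rightarrow> nat)) \<times> nat) set" where
  "root_shares N = Sigma {..N} (\<lambda>i. Sigma (ddiag i) (\<lambda>p. Sigma (ddiag (N - i)) (\<lambda>q. {1..2 * card (fst q) - 1})))"

definition dins :: "nat \<times> ((nat \<times> nat) set \<times> (nat \<Rightarrow> nat)) \<times> ((nat \<times> nat) set \<times> (nat \<Rightarrow> nat)) \<times> nat
    \<Rightarrow> (nat \<times> nat) set \<times> (nat \<Rightarrow> nat)" where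
  "dins = (\<lambda>(i, p, q, k). (cd_ins (fst p) k (fst q), djoin (card (fst q)) (snd p) (snd q)))"

lemma root_sharesE:
  assumes "x \<in> root_shares N"
  obtains i S' d' S'' d'' k where "x = (i, (S', d'), (S'', d''), k)" "i \<le> N" "(S', d') \<in> ddiag i"
    "(S'', d'') \<in> ddiag (N - i)" "insertion S' S'' k"
proof -
  obtain i S' d' S'' d'' k where x: "x = (i, (S', d'), (S'', d''), k)" by (metis surj_pair)
  then have *: "i \<le> N" "(S', d') \<in> ddiag i" "(S'', d'') \<in> ddiag (N - i)" "1 \<le> k" "k \<le> 2 * card S'' - 1"
    using assms by (auto simp: root_shares_def)
  then have "insertion S' S'' k" by (intro insertion.intro) (auto dest: ddiagD(1))
  with x * show thesis using that by blast
qed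

text \<open>Injectivity: \<open>ins_norm\<close> recovers both diagrams, \<open>rs_idx_ins\<close>
  the index and \<open>djoin_inj\<close> the decorations. Surjectivity is
  \<open>cdiag_is_insertion\<close> together with \<open>djoin_surj\<close>.\<close>

lemma dins_bij: "bij_betw dins (root_shares N) {(S, d) \<in> ddiag N. card S \<noteq> 1}"
proof (rule bij_betwI')
  fix x y assume "x \<in> root_shares N" "y \<in> root_shares N"
  show "dins x = dins y \<longleftrightarrow> x = y"
  proof
    assume eq: "dins x = dins y"
    from \<open>x \<in> root_shares N\<close> obtain i S' d' S'' d'' k where x: "x = (i, (S', d'), (S'', d''), k)"
      "(S', d') \<in> ddiag i" "(S'', d'') \<in> ddiag (N - i)" "insertion S' S'' k" by (rule root_sharesE)
    from \<open>y \<in> root_shares N\<close> obtain j T' e' T'' e'' l where y: "y = (j, (T', e'), (T'', e''), l)"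
      "(T', e') \<in> ddiag j" "(T'', e'') \<in> ddiag (N - j)" "insertion T' T'' l" by (rule root_sharesE)
    have U: "cd_ins S' k S'' = cd_ins T' l T''" using eq by (simp add: dins_def x y)
    have S: "S'' = T''" "S' = T'"
      using insertion.ins_norm[OF x(4)] insertion.ins_norm[OF y(4)] U by auto
    moreover have "k = l" using rs_idx_ins[OF x(4)] rs_idx_ins[OF y(4)] U by simp
    moreover have "djoin (card S'') d' d'' = djoin (card S'') e' e''"
      using eq S by (simp add: dins_def x y)
    then have "d' = e'" "d'' = e''"
      using djoin_inj ddiagD(2)[OF x(2)] ddiagD(2)[OF x(3)] ddiagD(2)[OF y(2)] ddiagD(2)[OF y(3)] S by metis+
    moreover have "i = j" using ddiagD(3)[OF x(2)] ddiagD(3)[OF y(2)] calculation by simp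
    ultimately show "x = y" by (simp add: x y)
  qed simp
next
  fix x assume "x \<in> root_shares N"
  then obtain i S' d' S'' d'' k where x: "x = (i, (S', d'), (S'', d''), k)" "i \<le> N"
    "(S', d') \<in> ddiag i" "(S'', d'') \<in> ddiag (N - i)" and ins: "insertion S' S'' k" by (rule root_sharesE)
  interpret insertion S' S'' k by (rule ins)
  note D = ddiagD[OF x(3)] ddiagD[OF x(4)] and c = cdiagD(6)[OF S'] cdiagD(6)[OF S'']
  have "djoin (card S'') d' d'' \<in> decs (card S' + card S'')"
    by (rule djoin_decs) (use D c in auto)
  moreover have "dnorm (card S' + card S'') (djoin (card S'') d' d'') = N"
    using djoin_dnorm[OF c(1)] ddiagD(3)[OF x(3)] ddiagD(3)[OF x(4)] x(2) by simp
  ultimately show "dins x \<in> {(S, d) \<in> ddiag N. card S \<noteq> 1}"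
    using ins_cdiag c by (simp add: x dins_def ddiag_def ins_card)
next
  fix y assume "y \<in> {(S, d) \<in> ddiag N. card S \<noteq> 1}"
  then obtain S d where y: "y = (S, d)" "(S, d) \<in> ddiag N" "card S \<noteq> 1" by blast
  note D = ddiagD[OF y(2)]
  have "2 \<le> card S" using cdiagD(6)[OF D(1)] y(3) by simp
  with D(1) obtain S' S'' k where ins: "insertion S' S'' k" and S: "S = cd_ins S' k S''"
    by (rule cdiag_is_insertion)
  interpret insertion S' S'' k by (rule ins)
  have "d \<in> decs (card S' + card S'')" using D(2) S ins_card by simp
  then obtain d' d'' where d: "d' \<in> decs (card S')" "d'' \<in> decs (card S'')" "d = djoin (card S'') d' d''"
    using djoin_surj cdiagD(6)[OF S'] by metis
  have N: "dnorm (card S') d' + dnorm (card S'') d'' = N"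
    using djoin_dnorm[OF cdiagD(6)[OF S']] D(3) S ins_card d(3) by metis
  let ?x = "(dnorm (card S') d', (S', d'), (S'', d''), k)"
  have "?x \<in> root_shares N"
    using N d S' S'' k by (auto simp: root_shares_def ddiag_def)
  moreover have "y = dins ?x" by (simp add: y dins_def S d)
  ultimately show "\<exists>x\<in>root_shares N. y = dins x" by blast
qed

text \<open>An arbitrary function \<open>\<psi>\<close> of base label and base decoration replaces
  the base factor; the coefficients of G and the diagrams with prescribed base data then obey one
  recursion.\<close>

definition wsum :: "(nat \<Rightarrow> nat \<Rightarrow> 'a::comm_ring_1) \<Rightarrow> int \<Rightarrow> (nat \<Rightarrow> nat \<Rightarrow> 'a) \<Rightarrow> nat \<Rightarrow> 'a" where
  "wsum a s \<psi> N = (\<Sum>(S, d)\<in>ddiag N. cd_weight s S d * ahat a S d * \<psi> (base S) (d (base S)))"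

lemma wsum_0: "wsum a s \<psi> 0 = 0"
proof -
  have "ddiag 0 = {}" using ddiagD(5,6) by fastforce
  then show ?thesis by (simp add: wsum_def)
qed

lemma wsum_rec:
  assumes Qalg: "\<And>n::nat. n > 0 \<Longrightarrow> (of_nat n :: 'a::comm_ring_1) dvd 1"
  shows "wsum a s \<psi> N = (if 1 \<le> N then \<psi> 1 N else 0) +
    (\<Sum>i\<le>N. wsum a s (\<lambda>b e. a e (b - 1)) i *
       ((of_int (s * int (N - i)) - 1) * (wsum a s (\<lambda>b. \<psi> (Suc b)) (N - i) :: 'a)))"
proof -
  define F where "F = (\<lambda>(S, d). cd_weight s S d * ahat a S d * \<psi> (base S) (d (base S)))"
  define F1 where "F1 = (\<lambda>(S, d). cd_weight s S d * ahat a S d * a (d (base S)) (base S - 1))"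
  define F2 where "F2 = (\<lambda>(S, d). cd_weight s S d * ahat a S d * \<psi> (Suc (base S)) (d (base S)))"
  have w: "wsum a s \<psi> N = sum F (ddiag N)" "wsum a s (\<lambda>b e. a e (b - 1)) i = sum F1 (ddiag i)"
    "wsum a s (\<lambda>b. \<psi> (Suc b)) i = sum F2 (ddiag i)" for i
    by (simp_all add: wsum_def F_def F1_def F2_def)
  have split: "ddiag N = {(S, d) \<in> ddiag N. card S = 1} \<union> {(S, d) \<in> ddiag N. card S \<noteq> 1}" by auto
  have "sum F (ddiag N) = sum F {(S, d) \<in> ddiag N. card S = 1} + sum F {(S, d) \<in> ddiag N. card S \<noteq> 1}"
    by (subst split, rule sum.union_disjoint) (auto intro: finite_subset[OF _ finite_ddiag[of N]])
  also have "sum F {(S, d) \<in> ddiag N. card S = 1} = (if 1 \<le> N then \<psi> 1 N else 0)"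
    unfolding ddiag_single by (simp add: F_def single_stats[OF Qalg] del: One_nat_def)
  also have "sum F {(S, d) \<in> ddiag N. card S \<noteq> 1} = (\<Sum>x\<in>root_shares N. F (dins x))"
    by (rule sum.reindex_bij_betw[OF dins_bij, symmetric])
  also have "\<dots> = (\<Sum>i\<le>N. \<Sum>p\<in>ddiag i. \<Sum>q\<in>ddiag (N - i). \<Sum>k\<in>{1..2 * card (fst q) - 1}. F (dins (i, p, q, k)))"
    unfolding root_shares_def by (simp add: sum.Sigma finite_ddiag case_prod_beta')
  \<comment> \<open>Only the weight of the insertion depends on \<open>k\<close>; monomial, base
    label and base decoration are constant along the inner sum.\<close>
  also have "\<dots> = (\<Sum>i\<le>N. \<Sum>p\<in>ddiag i. \<Sum>q\<in>ddiag (N - i). F1 p * ((of_int (s * int (N - i)) - 1) * F2 q))"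
  proof (intro sum.cong refl)
    fix i p q assume p: "p \<in> ddiag i" and q: "q \<in> ddiag (N - i)"
    obtain S' d' S'' d'' where pq: "p = (S', d')" "q = (S'', d'')" by (metis surj_pair)
    note D' = ddiagD[OF p[unfolded pq]] and D'' = ddiagD[OF q[unfolded pq]]
    let ?d = "djoin (card S'') d' d''"
    have b: "base S'' \<le> card S''" using base_bounds(3)[OF cdiagD(1,5)[OF D''(1)]] .
    have "F (dins (i, p, q, k)) = cd_weight s (cd_ins S' k S'') ?d *
        (ahat a S' d' * a (d' (base S')) (base S' - 1) * ahat a S'' d'' * \<psi> (Suc (base S'')) (d'' (base S'')))"
      if "k \<in> {1..2 * card S'' - 1}" for k
    proof -
      interpret insertion S' S'' k using D'(1) D''(1) that by unfold_locales auto
      have "?d (Suc (base S'')) = d'' (base S'')" using djoin_simps(2) D''(5) b by simp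
      then show ?thesis by (simp add: F_def dins_def pq ahat_ins base_ins mult.assoc)
    qed
    then have "(\<Sum>k\<in>{1..2 * card (fst q) - 1}. F (dins (i, p, q, k))) =
      (\<Sum>k\<in>{1..2 * card S'' - 1}. cd_weight s (cd_ins S' k S'') ?d) *
        (ahat a S' d' * a (d' (base S')) (base S' - 1) * ahat a S'' d'' * \<psi> (Suc (base S'')) (d'' (base S'')))"
      unfolding sum_distrib_right by (intro sum.cong) (auto simp: pq)
    also have "(\<Sum>k\<in>{1..2 * card S'' - 1}. cd_weight s (cd_ins S' k S'') ?d :: 'a) =
        cd_weight s S' d' * ((of_int (s * int (N - i)) - 1) * cd_weight s S'' d'')"
      using sum_cd_weight_ins[of S' S'' s d' d'', OF Qalg D'(1) D''(1)] unfolding D''(3) by simp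
    also have "\<dots> * (ahat a S' d' * a (d' (base S')) (base S' - 1) * ahat a S'' d'' *
        \<psi> (Suc (base S'')) (d'' (base S''))) = F1 p * ((of_int (s * int (N - i)) - 1) * F2 q)"
      by (simp add: F1_def F2_def pq mult_ac)
    finally show "(\<Sum>k\<in>{1..2 * card (fst q) - 1}. F (dins (i, p, q, k))) =
      F1 p * ((of_int (s * int (N - i)) - 1) * F2 q)" .
  qed
  also have "\<dots> = (\<Sum>i\<le>N. sum F1 (ddiag i) * ((of_int (s * int (N - i)) - 1) * sum F2 (ddiag (N - i))))"
    by (simp only: sum_distrib_left[symmetric] sum_distrib_right[symmetric])
  finally show ?thesis unfolding w .
qed

text \<open>\<open>fpf_inv\<close> fixes the values outside \<open>{1..2 * n}\<close>, so
  \<open>f\<close> is determined by its chords and \<open>n\<close> by their number; conversely,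
  \<open>f\<close> is the map exchanging the two ends of each chord.\<close>

lemma chords_bij:
  "bij_betw (\<lambda>(n, f, d). (chords n f, d)) {(n, f, d) \<in> Rdec. dnorm n d = N} (ddiag N)"
proof -
  have props: "chords n f \<in> cdiag \<and> card (chords n f) = n"
    if "1 \<le> n" "fpf_inv n f" "connected_cd (chords n f)" for n f
  proof -
    have f: "f x \<in> {1..2 * n}" "f x \<noteq> x" "f (f x) = x" if "x \<in> {1..2 * n}" for x
      using \<open>fpf_inv n f\<close> that unfolding fpf_inv_def by auto
    have c: "fst c \<in> {1..2 * n}" "snd c = f (fst c)" "fst c < snd c" if "c \<in> chords n f" for c
      using that by (auto simp: chords_def)
    have m: "matching (chords n f)"
      unfolding matching_def
    proof (intro conjI ballI impI)
      have "chords n f \<subseteq> (\<lambda>x. (x, f x)) ` {1..2 * n}" by (auto simp: chords_def)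
      then show "finite (chords n f)" by (rule finite_subset) simp
      show "fst x < snd x" if "x \<in> chords n f" for x using c(3)[OF that] .
      fix x y assume xy: "x \<in> chords n f" "y \<in> chords n f" "x \<noteq> y"
      show fst: "fst x \<noteq> fst y" using c(2)[OF xy(1)] c(2)[OF xy(2)] xy(3) by (metis prod_eqI)
      show "fst x \<noteq> snd y" using c[OF xy(1)] c[OF xy(2)] f(3)[of "fst y"] by auto
      show "snd x \<noteq> snd y" using c(1,2)[OF xy(1)] c(1,2)[OF xy(2)] f(3)[of "fst y"] f(3)[of "fst x"] fst by metis
    qed
    have e: "endpts (chords n f) = {1..2 * n}"
    proof
      show "endpts (chords n f) \<subseteq> {1..2 * n}"
      proof
        fix x assume "x \<in> endpts (chords n f)"
        then obtain e where e: "e \<in> chords n f" "x = fst e \<or> x = snd e" unfolding endpts_def by blast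
        then show "x \<in> {1..2 * n}" using c(1,2)[OF e(1)] f(1)[of "fst e"] by metis
      qed
      show "{1..2 * n} \<subseteq> endpts (chords n f)"
      proof
        fix x assume x: "x \<in> {1..2 * n}"
        show "x \<in> endpts (chords n f)"
        proof (cases "x < f x")
          case True
          then have "(x, f x) \<in> chords n f" using x by (auto simp: chords_def)
          then show ?thesis using endptsI(1) by fastforce
        next
          case False
          then have "(f x, x) \<in> chords n f" using f[OF x] by (auto simp: chords_def)
          then show ?thesis using endptsI(2) by fastforce
        qed
      qed
    qed
    have "card (chords n f) = n" using card_endpts[OF m] e by simp
    moreover have "chords n f \<noteq> {}" using e \<open>1 \<le> n\<close> unfolding endpts_def by auto
    ultimately show ?thesis using m e that(3) by (simp add: cdiag_def)
  qed
  have inj: "f = f'" if "fpf_inv n f" "fpf_inv n f'" and eq: "chords n f = chords n f'" for n f f'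
  proof
    fix x
    have f: "f x \<in> {1..2 * n}" "f x \<noteq> x" "f (f x) = x" "f' (f' x) = x" if "x \<in> {1..2 * n}" for x
      using \<open>fpf_inv n f\<close> \<open>fpf_inv n f'\<close> that unfolding fpf_inv_def by auto
    have graph: "f' y = f y" if "y \<in> {1..2 * n}" "y < f y" for y
    proof -
      have "(y, f y) \<in> chords n f'" using that unfolding eq[symmetric] by (auto simp: chords_def)
      then show ?thesis by (auto simp: chords_def)
    qed
    show "f x = f' x"
    proof (cases "x \<in> {1..2 * n}")
      case True
      show ?thesis
      proof (cases "x < f x")
        case False
        then have "f' (f x) = x" using graph[of "f x"] f[OF True] by simp
        then show ?thesis using f(4)[of "f x"] f(1)[OF True] by metis
      qed (use graph True in simp)
    next
      case False
      then show ?thesis using that(1,2) unfolding fpf_inv_def by simp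
    qed
  qed
  have surj: "\<exists>f. fpf_inv (card S) f \<and> chords (card S) f = S" if S: "S \<in> cdiag" for S
  proof -
    note D = cdiagD[OF S]
    have ex: "\<exists>!y. (x, y) \<in> S \<or> (y, x) \<in> S" if x: "x \<in> endpts S" for x
    proof -
      obtain c where c: "c \<in> S" "x = fst c \<or> x = snd c" using x unfolding endpts_def by blast
      then have "\<exists>y. (x, y) \<in> S \<or> (y, x) \<in> S" by (metis prod.collapse)
      moreover have "y = z" if "(x, y) \<in> S \<or> (y, x) \<in> S" "(x, z) \<in> S \<or> (z, x) \<in> S" for y z
        using that matching_fst_eq[OF D(2), of "(x, y)" "(x, z)"] matching_snd_eq[OF D(2), of "(y, x)" "(z, x)"]
          matching_fst_neq_snd[OF D(2), of "(x, y)" "(z, x)"] matching_fst_neq_snd[OF D(2), of "(x, z)" "(y, x)"]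
        by auto
      ultimately show ?thesis by blast
    qed
    define f where "f x = (if x \<in> endpts S then (THE y. (x, y) \<in> S \<or> (y, x) \<in> S) else x)" for x
    have f: "(x, f x) \<in> S \<or> (f x, x) \<in> S" if "x \<in> endpts S" for x
      using theI'[OF ex[OF that]] that by (simp add: f_def)
    have f_eq: "f x = y" if "(x, y) \<in> S \<or> (y, x) \<in> S" for x y
    proof -
      have x: "x \<in> endpts S" using that endptsI[of _ S] by fastforce
      show ?thesis using ex[OF x] f[OF x] that by blast
    qed
    have "fpf_inv (card S) f"
      unfolding fpf_inv_def D(3)[symmetric]
    proof (intro conjI ballI allI impI)
      fix x assume x: "x \<in> endpts S"
      show "f x \<in> endpts S" using f[OF x] endptsI[of _ S] by fastforce
      show "f x \<noteq> x" using f[OF x] matching_less[OF D(2)] by fastforce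
      show "f (f x) = x" using f[OF x] f_eq by blast
    qed (simp add: f_def)
    moreover have "chords (card S) f = S"
    proof (rule set_eqI)
      fix c :: "nat \<times> nat" obtain x y where c: "c = (x, y)" by (cases c)
      have "(x, y) \<in> chords (card S) f \<longleftrightarrow> x \<in> endpts S \<and> y = f x \<and> x < f x"
        unfolding D(3) by (auto simp: chords_def)
      also have "\<dots> \<longleftrightarrow> (x, y) \<in> S"
      proof
        assume "x \<in> endpts S \<and> y = f x \<and> x < f x"
        then show "(x, y) \<in> S" using f[of x] matching_less[OF D(2), of "(f x, x)"] by auto
      next
        assume xy: "(x, y) \<in> S"
        then show "x \<in> endpts S \<and> y = f x \<and> x < f x"
          using f_eq[of x y] matching_less[OF D(2) xy] endptsI(1)[OF xy] by auto
      qed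
      finally show "c \<in> chords (card S) f \<longleftrightarrow> c \<in> S" unfolding c .
    qed
    ultimately show ?thesis by blast
  qed
  show ?thesis
  proof (rule bij_betwI')
    fix x y assume "x \<in> {(n, f, d) \<in> Rdec. dnorm n d = N}" "y \<in> {(n, f, d) \<in> Rdec. dnorm n d = N}"
    then obtain n f d n' f' d' where x: "x = (n, f, d)" "1 \<le> n" "fpf_inv n f" "connected_cd (chords n f)"
      and y: "y = (n', f', d')" "1 \<le> n'" "fpf_inv n' f'" "connected_cd (chords n' f')"
      by (auto simp: Rdec_def)
    show "(case x of (n, f, d) \<Rightarrow> (chords n f, d)) = (case y of (n, f, d) \<Rightarrow> (chords n f, d)) \<longleftrightarrow> x = y"
    proof
      assume "(case x of (n, f, d) \<Rightarrow> (chords n f, d)) = (case y of (n, f, d) \<Rightarrow> (chords n f, d))"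
      then have eq: "chords n f = chords n' f'" "d = d'" by (auto simp: x y)
      then have "n = n'" using props[OF x(2-4)] props[OF y(2-4)] by simp
      then show "x = y" using eq inj[of n f f'] x(3) y(3) by (simp add: x(1) y(1))
    qed simp
  next
    fix x assume "x \<in> {(n, f, d) \<in> Rdec. dnorm n d = N}"
    then obtain n f d where x: "x = (n, f, d)" "1 \<le> n" "fpf_inv n f" "connected_cd (chords n f)"
      "d \<in> decs n" "dnorm n d = N" by (auto simp: Rdec_def decs_def)
    then show "(case x of (n, f, d) \<Rightarrow> (chords n f, d)) \<in> ddiag N"
      using props[OF x(2-4)] by (simp add: ddiag_def)
  next
    fix y assume "y \<in> ddiag N"
    then obtain S d where y: "y = (S, d)" "(S, d) \<in> ddiag N" by (cases y) auto
    note D = ddiagD[OF y(2)]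
    obtain f where f: "fpf_inv (card S) f" "chords (card S) f = S" using surj[OF D(1)] by blast
    have "(card S, f, d) \<in> {(n, f, d) \<in> Rdec. dnorm n d = N}"
      using f D(2,3) cdiagD(4,6)[OF D(1)] by (simp add: Rdec_def decs_def)
    moreover have "y = (case (card S, f, d) of (n, f, d) \<Rightarrow> (chords n f, d))" by (simp add: y f)
    ultimately show "\<exists>x\<in>{(n, f, d) \<in> Rdec. dnorm n d = N}. y = (case x of (n, f, d) \<Rightarrow> (chords n f, d))"
      by blast
  qed
qed

lemma sum_Rdec:
  "(\<Sum>(n, f, d) \<in> {(n, f, d) \<in> Rdec. dnorm n d = N \<and> base (chords n f) \<ge> k}.
      cd_weight s (chords n f) d * ahat a (chords n f) d *
      a (d (base (chords n f))) (base (chords n f) - k)) =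
    wsum a s (\<lambda>b e. if k \<le> b then a e (b - k) else 0) N"
proof -
  let ?h = "\<lambda>(n, f, d). (chords n f, d)"
  let ?F = "\<lambda>(S, d). cd_weight s S d * ahat a S d * (if k \<le> base S then a (d (base S)) (base S - k) else 0)"
  let ?A = "{(n, f, d) \<in> Rdec. dnorm n d = N}"
  have fin: "finite ?A" using bij_betw_finite[OF chords_bij] finite_ddiag by blast
  have "wsum a s (\<lambda>b e. if k \<le> b then a e (b - k) else 0) N = (\<Sum>x\<in>?A. ?F (?h x))"
    unfolding wsum_def by (rule sum.reindex_bij_betw[OF chords_bij, symmetric])
  also have "\<dots> = (\<Sum>x\<in>{(n, f, d) \<in> Rdec. dnorm n d = N \<and> base (chords n f) \<ge> k}. ?F (?h x))"
    by (rule sum.mono_neutral_right[OF fin]) (auto split: if_split_asm)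
  also have "\<dots> = (\<Sum>(n, f, d) \<in> {(n, f, d) \<in> Rdec. dnorm n d = N \<and> base (chords n f) \<ge> k}.
      cd_weight s (chords n f) d * ahat a (chords n f) d *
      a (d (base (chords n f))) (base (chords n f) - k))"
    by (rule sum.cong) auto
  finally show ?thesis ..
qed

section \<open>Derivations and the binomial series\<close>

text \<open>\<open>local\<close> allows a series to be replaced by a truncation in each coefficient,
  so that the infinite binomial series never has to be differentiated termwise. The instances are x
  d/dx and d/dL.\<close>

locale fps_derivation =
  fixes \<delta> :: "'b::comm_ring_1 fps \<Rightarrow> 'b fps"
  assumes add: "\<delta> (f + g) = \<delta> f + \<delta> g"
    and mult: "\<delta> (f * g) = f * \<delta> g + \<delta> f * g"
    and local: "(\<And>n. n \<le> N \<Longrightarrow> f $ n = g $ n) \<Longrightarrow> \<delta> f $ N = \<delta> g $ N"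
begin

lemma zero: "\<delta> 0 = 0"
  using add[of 0 0] by simp

lemma one: "\<delta> 1 = 0"
  using mult[of 1 1] by simp

lemma sum: "finite A \<Longrightarrow> \<delta> (sum f A) = (\<Sum>x\<in>A. \<delta> (f x))"
  by (induction A rule: finite_induct) (simp_all add: zero add)

lemma power: "\<delta> (f ^ n) = of_nat n * f ^ (n - 1) * \<delta> f"
proof (induction n)
  case (Suc n)
  then show ?case by (cases n) (simp_all add: mult algebra_simps)
qed (simp add: one)

end

lemma abinom_Suc:
  assumes Qalg: "\<And>n::nat. n > 0 \<Longrightarrow> (of_nat n :: 'a::comm_ring_1) dvd 1"
  shows "of_nat (Suc n) * (abinom \<alpha> (Suc n) :: 'a) = (of_int \<alpha> - of_nat n) * abinom \<alpha> n"
proof -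
  have "of_nat (Suc n) * (abinom \<alpha> (Suc n) :: 'a) =
      (\<Prod>i<n. of_int (\<alpha> - int i)) * of_int (\<alpha> - int n) * (of_nat (Suc n) * qinv (fact (Suc n)))"
    unfolding abinom_def prod.lessThan_Suc by (simp only: mult_ac)
  also have "of_nat (Suc n) * qinv (fact (Suc n)) = (qinv (fact n) :: 'a)"
    by (rule qinv_fact_Suc[OF Qalg])
  finally show ?thesis by (simp add: abinom_def mult_ac)
qed

text \<open>The left side is \<open>1 + U\<close> times the formal derivative of the binomial
  polynomial. Neighbouring terms combine by the recursion \<open>cS\<close>, leaving only a boundary
  term at \<open>U ^ M\<close>.\<close>

lemma binomial_truncation:
  fixes U :: "'b::comm_ring_1 fps" and \<alpha> :: int
  assumes Qalg: "\<And>n::nat. n > 0 \<Longrightarrow> (of_nat n :: 'b) dvd 1"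
  defines "c \<equiv> \<lambda>n. fps_const (abinom \<alpha> n :: 'b)"
  shows "(1 + U) * (\<Sum>n\<le>M. c n * (of_nat n * U ^ (n - 1))) =
    of_int \<alpha> * (\<Sum>n\<le>M. c n * U ^ n) - of_nat (Suc M) * c (Suc M) * U ^ M"
proof -
  have cS: "of_nat (Suc n) * c (Suc n) = (of_int \<alpha> - of_nat n) * c n" for n
  proof -
    have "fps_const (of_nat (Suc n) * abinom \<alpha> (Suc n) :: 'b) = fps_const ((of_int \<alpha> - of_nat n) * abinom \<alpha> n)"
      by (rule arg_cong[OF abinom_Suc[OF Qalg]])
    then show ?thesis
      unfolding c_def by (simp add: fps_of_nat[symmetric] fps_of_int[symmetric] del: of_nat_Suc)
  qed
  show ?thesis
  proof (induction M)
    case 0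
    then show ?case using cS[of 0] by simp
  next
    case (Suc M)
    have "(1 + U) * (\<Sum>n\<le>Suc M. c n * (of_nat n * U ^ (n - 1))) =
       (1 + U) * (\<Sum>n\<le>M. c n * (of_nat n * U ^ (n - 1))) + (1 + U) * (of_nat (Suc M) * c (Suc M)) * U ^ M"
      by (simp add: algebra_simps)
    also have "\<dots> = of_int \<alpha> * (\<Sum>n\<le>M. c n * U ^ n) + of_nat (Suc M) * c (Suc M) * U ^ Suc M"
      unfolding Suc.IH by (simp add: algebra_simps)
    also have "\<dots> = of_int \<alpha> * (\<Sum>n\<le>Suc M. c n * U ^ n) - (of_int \<alpha> - of_nat (Suc M)) * c (Suc M) * U ^ Suc M"
      by (simp add: algebra_simps)
    finally show ?case unfolding cS[of "Suc M", symmetric] .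
  qed
qed

text \<open>The logarithmic derivative of a power, multiplied out so that no inverse of
  \<open>G\<close> is needed.\<close>

lemma (in fps_derivation) fps_ipow_deriv:
  assumes Qalg: "\<And>n::nat. n > 0 \<Longrightarrow> (of_nat n :: 'b) dvd 1"
    and G0: "G $ 0 = 1" and const: "\<And>n. \<delta> (fps_const (abinom \<alpha> n)) = 0"
  shows "G * \<delta> (fps_ipow G \<alpha>) = of_int \<alpha> * \<delta> G * fps_ipow G \<alpha>"
proof (rule fps_ext)
  fix N
  define U where "U = G - 1"
  define c where "c n = fps_const (abinom \<alpha> n :: 'b)" for n
  \<comment> \<open>One more than the order \<open>N\<close> under consideration: \<open>U\<close>
    has no constant term, so the boundary term with \<open>U ^ M\<close> does not reach order
    \<open>N\<close>.\<close>
  define M where "M = Suc N"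
  define F where "F = (\<Sum>n\<le>M. c n * U ^ n)"
  have G: "G = 1 + U" and U0: "U $ 0 = 0" using G0 by (auto simp: U_def)
  have vanish: "(U ^ m) $ n = 0" if "n < m" for m n
    using startsby_zero_power_prefix[OF U0] that by blast
  have agree: "fps_ipow G \<alpha> $ n = F $ n" if "n \<le> N" for n
  proof -
    have "F $ n = (\<Sum>m\<le>M. abinom \<alpha> m * (U ^ m) $ n)" by (simp add: F_def c_def fps_sum_nth)
    also have "\<dots> = (\<Sum>m\<le>n. abinom \<alpha> m * (U ^ m) $ n)"
      by (rule sum.mono_neutral_right) (use that in \<open>auto simp: M_def vanish\<close>)
    finally show ?thesis by (simp add: fps_ipow_def U_def)
  qed
  have \<delta>U: "\<delta> G = \<delta> U" by (simp add: G add one)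
  have "\<delta> F = (\<Sum>n\<le>M. c n * (of_nat n * U ^ (n - 1) * \<delta> U))"
    unfolding F_def by (subst sum) (simp_all add: mult power const c_def)
  also have "\<dots> = (\<Sum>n\<le>M. c n * (of_nat n * U ^ (n - 1))) * \<delta> U"
    by (simp add: sum_distrib_right mult.assoc)
  finally have "G * \<delta> F = ((1 + U) * (\<Sum>n\<le>M. c n * (of_nat n * U ^ (n - 1)))) * \<delta> U"
    by (simp add: G mult.assoc)
  also have "(1 + U) * (\<Sum>n\<le>M. c n * (of_nat n * U ^ (n - 1))) =
      of_int \<alpha> * F - of_nat (Suc M) * c (Suc M) * U ^ M"
    unfolding F_def c_def by (rule binomial_truncation[OF Qalg])
  finally have "G * \<delta> F = of_int \<alpha> * \<delta> G * F - U ^ M * (of_nat (Suc M) * c (Suc M) * \<delta> U)"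
    by (simp add: \<delta>U algebra_simps)
  moreover have "(U ^ M * (of_nat (Suc M) * c (Suc M) * \<delta> U)) $ N = 0"
  proof -
    have "(U ^ M) $ i = 0" if "i \<in> {0..N}" for i by (rule vanish) (use that in \<open>simp add: M_def\<close>)
    then show ?thesis unfolding fps_mult_nth[of "U ^ M"] by (intro sum.neutral) simp
  qed
  ultimately have "(G * \<delta> F) $ N = (of_int \<alpha> * \<delta> G * F) $ N" by simp
  moreover have "(G * \<delta> (fps_ipow G \<alpha>)) $ N = (G * \<delta> F) $ N"
    unfolding fps_mult_nth by (intro sum.cong refl arg_cong2[of _ _ _ _ "(*)"] local agree) auto
  moreover have "(of_int \<alpha> * \<delta> G * fps_ipow G \<alpha>) $ N = (of_int \<alpha> * \<delta> G * F) $ N"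
    unfolding fps_mult_nth[of "of_int \<alpha> * \<delta> G"] by (intro sum.cong refl arg_cong2[of _ _ _ _ "(*)"] agree) auto
  ultimately show "(G * \<delta> (fps_ipow G \<alpha>)) $ N = (of_int \<alpha> * \<delta> G * fps_ipow G \<alpha>) $ N" by simp
qed

text \<open>The factor \<open>fps_X\<close> is essential: coefficient \<open>N\<close> of the plain
  derivative involves coefficient \<open>N + 1\<close> and violates \<open>local\<close>.\<close>

interpretation theta: fps_derivation "\<lambda>f :: 'b::comm_ring_1 fps. fps_X * fps_deriv f"
proof
  fix f g :: "'b fps"
  show "fps_X * fps_deriv (f + g) = fps_X * fps_deriv f + fps_X * fps_deriv g"
    by (simp add: algebra_simps)
  show "fps_X * fps_deriv (f * g) = f * (fps_X * fps_deriv g) + fps_X * fps_deriv f * g"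
    by (simp add: algebra_simps)
  show "(fps_X * fps_deriv f) $ N = (fps_X * fps_deriv g) $ N" if "\<And>n. n \<le> N \<Longrightarrow> f $ n = g $ n" for N
    using that by (simp add: fps_mult_fps_X_deriv_shift)
qed

text \<open>The library's derivative of polynomials is restricted to rings without zero divisors.\<close>
definition poly_deriv :: "'a::comm_ring_1 poly \<Rightarrow> 'a poly" where
  "poly_deriv p = (\<Sum>i\<le>degree p. monom (of_nat i * coeff p i) (i - 1))"

lemma coeff_poly_deriv: "coeff (poly_deriv p) n = of_nat (Suc n) * coeff p (Suc n)"
proof -
  have "coeff (poly_deriv p) n = (\<Sum>i\<le>degree p. if i = Suc n then of_nat i * coeff p i else 0)"
    unfolding poly_deriv_def coeff_sum
  proof (intro sum.cong refl)
    fix i show "coeff (monom (of_nat i * coeff p i) (i - 1)) n = (if i = Suc n then of_nat i * coeff p i else 0)"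
      by (cases i) auto
  qed
  also have "\<dots> = of_nat (Suc n) * coeff p (Suc n)"
    by (cases "Suc n \<le> degree p") (simp_all add: sum.delta coeff_eq_0 del: of_nat_Suc)
  finally show ?thesis .
qed

lemma poly_deriv_add: "poly_deriv (p + q) = poly_deriv p + poly_deriv q"
  by (rule poly_eqI) (simp add: coeff_poly_deriv algebra_simps)

lemma poly_deriv_0 [simp]: "poly_deriv 0 = 0"
  by (simp add: poly_deriv_def)

lemma poly_deriv_const [simp]: "poly_deriv [:c:] = 0"
  by (rule poly_eqI) (simp add: coeff_poly_deriv)

lemma poly_deriv_sum: "finite A \<Longrightarrow> poly_deriv (sum f A) = (\<Sum>x\<in>A. poly_deriv (f x))"
  by (induction A rule: finite_induct) (simp_all add: poly_deriv_add)

text \<open>Inherited from power series, into which polynomials embed with \<open>poly_deriv\<close>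
  becoming \<open>fps_deriv\<close>.\<close>

lemma poly_deriv_mult: "poly_deriv (p * q) = p * poly_deriv q + poly_deriv p * q"
proof -
  have fps: "fps_of_poly (poly_deriv p) = fps_deriv (fps_of_poly p)" for p :: "'a poly"
    by (rule fps_ext) (simp add: coeff_poly_deriv)
  have "fps_of_poly (poly_deriv (p * q)) = fps_of_poly (p * poly_deriv q + poly_deriv p * q)"
    by (simp add: fps fps_of_poly_mult fps_of_poly_add)
  then show ?thesis by simp
qed

definition dL :: "'a::comm_ring_1 poly fps \<Rightarrow> 'a poly fps" where
  "dL Y = Abs_fps (\<lambda>N. poly_deriv (Y $ N))"

interpretation dL: fps_derivation dL
proof
  fix f g :: "'a poly fps"
  show "dL (f + g) = dL f + dL g" by (rule fps_ext) (simp add: dL_def poly_deriv_add)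
  show "dL (f * g) = f * dL g + dL f * g"
    by (rule fps_ext) (simp add: dL_def fps_mult_nth poly_deriv_sum poly_deriv_mult sum.distrib)
  show "dL f $ N = dL g $ N" if "\<And>n. n \<le> N \<Longrightarrow> f $ n = g $ n" for N
    using that by (simp add: dL_def)
qed

text \<open>Sorts an element of A[L][[x]] by powers of L, the form in which the flow equation
  becomes a recursion in \<open>j\<close>.\<close>

definition lcoef :: "nat \<Rightarrow> 'a::comm_ring_1 poly fps \<Rightarrow> 'a fps" where
  "lcoef j Y = Abs_fps (\<lambda>N. coeff (Y $ N) j)"

lemma lcoef_nth [simp]: "lcoef j Y $ N = coeff (Y $ N) j"
  by (simp add: lcoef_def)

lemma lcoef_ext: "(\<And>j. lcoef j Y = lcoef j Z) \<Longrightarrow> Y = Z"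
  by (metis fps_ext lcoef_nth poly_eqI)

lemma lcoef_dL: "lcoef j (dL Y) = of_nat (Suc j) * lcoef (Suc j) Y"
  by (rule fps_ext) (simp add: dL_def coeff_poly_deriv fps_of_nat[symmetric] del: of_nat_Suc)

lemma lcoef_0_mult: "lcoef 0 (Y * Z) = lcoef 0 Y * lcoef 0 Z"
  by (rule fps_ext) (simp add: fps_mult_nth coeff_sum coeff_mult_0)

lemma lcoef_0_power: "lcoef 0 (Y ^ n) = lcoef 0 Y ^ n"
proof (induction n)
  case 0 show ?case by (rule fps_ext) simp
qed (simp add: lcoef_0_mult)

text \<open>A constant term 1 makes \<open>G\<close> a unit, so cancellation is possible although
  the coefficient ring may have zero divisors.\<close>

lemma fps_cancel_left:
  fixes G Y Z :: "'b::comm_ring_1 fps"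
  assumes "G $ 0 = 1" "G * Y = G * Z" shows "Y = Z"
proof -
  have "G * fps_right_inverse G 1 = 1" by (rule fps_right_inverse) (simp add: assms)
  then have "W = fps_right_inverse G 1 * (G * W)" for W by (metis mult.assoc mult.commute mult_1)
  then show ?thesis using assms(2) by metis
qed

section \<open>The Dyson-Schwinger equation\<close>

locale dse =
  fixes a :: "nat \<Rightarrow> nat \<Rightarrow> 'a::comm_ring_1" and s :: int
  assumes Qalg: "\<And>n::nat. n > 0 \<Longrightarrow> (of_nat n :: 'a) dvd 1"
begin

lemma qinvR: "n > 0 \<Longrightarrow> of_nat n * (qinv n :: 'a) = 1"
  by (rule qinv_right[OF Qalg])

lemma qinvL: "n > 0 \<Longrightarrow> (qinv n :: 'a) * of_nat n = 1"
  using qinvR[of n] by (simp add: mult.commute)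

lemma qinvF: "of_nat (Suc n) * qinv (fact (Suc n)) = (qinv (fact n) :: 'a)"
  by (rule qinv_fact_Suc[OF Qalg])

lemma Qalg_poly: "n > 0 \<Longrightarrow> (of_nat n :: 'a poly) dvd 1"
proof -
  assume "n > 0"
  then have "of_nat n * [:qinv n:] = (1 :: 'a poly)" by (simp add: of_nat_poly qinvL)
  then show ?thesis by (metis dvd_triv_left)
qed

text \<open>Binomial coefficients in A[L] are thus free of L, hence killed by
  \<open>dL\<close>.\<close>

lemma abinom_poly: "(abinom \<alpha> n :: 'a poly) = [:abinom \<alpha> n:]"
proof -
  have "qinv (fact n) = [:qinv (fact n) :: 'a:]"
    by (rule qinv_unique[OF Qalg_poly]) (simp_all add: of_nat_poly qinvL del: of_nat_fact)
  moreover have "(\<Prod>i<n. of_int (\<alpha> - int i)) = [:\<Prod>i<n. of_int (\<alpha> - int i) :: 'a:]"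
    using of_int_poly[of "\<Prod>i<n. \<alpha> - int i", where ?'a = 'a] unfolding of_int_prod .
  ultimately show ?thesis unfolding abinom_def by simp
qed

definition W :: "(nat \<Rightarrow> nat \<Rightarrow> 'a) \<Rightarrow> 'a fps" where
  "W \<psi> = Abs_fps (wsum a s \<psi>)"

definition g :: "'a fps" where
  "g = W (\<lambda>b e. a e (b - 1))"

definition D :: "'a fps \<Rightarrow> 'a fps" where
  "D f = g * (f - of_int s * (fps_X * fps_deriv f))"

lemma W_nth [simp]: "W \<psi> $ N = wsum a s \<psi> N"
  by (simp add: W_def)

lemma D_nth: "D f $ N = (\<Sum>i\<le>N. g $ i * ((1 - of_int (s * int (N - i))) * f $ (N - i)))"
proof -
  have "(f - of_int s * (fps_X * fps_deriv f)) $ n = (1 - of_int (s * int n)) * f $ n" for n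
    by (simp add: fps_mult_fps_X_deriv_shift fps_of_int[symmetric] algebra_simps)
  then show ?thesis unfolding D_def fps_mult_nth[of g] by (simp only: atLeast0AtMost)
qed

lemma D_const: "D (fps_const c * f) = fps_const c * D f"
  by (rule fps_ext) (simp add: D_nth sum_distrib_left mult_ac)

text \<open>At order \<open>N - i\<close> the factor \<open>s * (N - i) - 1\<close> of
  \<open>wsum_rec\<close> is the action of s x d/dx - 1, so shifting the base label is
  \<open>- D\<close>; the first term comes from the one-chord diagrams.\<close>

lemma W_rec: "W \<psi> = Abs_fps (\<lambda>N. if 1 \<le> N then \<psi> 1 N else 0) - D (W (\<lambda>b. \<psi> (Suc b)))"
proof (rule fps_ext)
  fix N
  have "W \<psi> $ N = (if 1 \<le> N then \<psi> 1 N else 0) +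
    (\<Sum>i\<le>N. wsum a s (\<lambda>b e. a e (b - 1)) i *
       ((of_int (s * int (N - i)) - 1) * wsum a s (\<lambda>b. \<psi> (Suc b)) (N - i)))"
    unfolding W_nth by (rule wsum_rec[OF Qalg])
  also have "(\<Sum>i\<le>N. wsum a s (\<lambda>b e. a e (b - 1)) i *
       ((of_int (s * int (N - i)) - 1) * wsum a s (\<lambda>b. \<psi> (Suc b)) (N - i))) = - (D (W (\<lambda>b. \<psi> (Suc b))) $ N)"
    unfolding D_nth sum_negf[symmetric] g_def W_nth
    by (intro sum.cong refl) (simp add: algebra_simps)
  finally show "W \<psi> $ N = (Abs_fps (\<lambda>N. if 1 \<le> N then \<psi> 1 N else 0) - D (W (\<lambda>b. \<psi> (Suc b)))) $ N"
    by simp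
qed

lemma wsum_cong:
  assumes "\<And>b e. 1 \<le> b \<Longrightarrow> b \<le> N \<Longrightarrow> 1 \<le> e \<Longrightarrow> e \<le> N \<Longrightarrow> \<psi> b e = \<psi>' b e"
  shows "wsum a s \<psi> N = wsum a s \<psi>' N"
  unfolding wsum_def
proof (rule sum.cong[OF refl])
  fix p assume p: "p \<in> ddiag N"
  obtain S d where pS: "p = (S, d)" by (cases p)
  have "\<psi> (base S) (d (base S)) = \<psi>' (base S) (d (base S))"
    by (rule assms; rule ddiagD[OF p[unfolded pS]])
  then show "(case p of (S, d) \<Rightarrow> cd_weight s S d * ahat a S d * \<psi> (base S) (d (base S))) =
      (case p of (S, d) \<Rightarrow> cd_weight s S d * ahat a S d * \<psi>' (base S) (d (base S)))"
    by (simp add: pS)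
qed

lemma wsum_zero [simp]: "wsum a s (\<lambda>b e. 0) N = 0"
  by (simp add: wsum_def case_prod_beta')

text \<open>\<open>j\<close> is the base label minus one, so that it counts the applications of
  \<open>- D\<close> to x^k.\<close>

definition pt :: "nat \<Rightarrow> nat \<Rightarrow> nat \<Rightarrow> nat \<Rightarrow> 'a" where
  "pt j k b e = (if b = Suc j \<and> e = k then 1 else 0)"

lemma W_pt_0: "1 \<le> k \<Longrightarrow> W (pt 0 k) = fps_X ^ k"
proof -
  assume k: "1 \<le> k"
  have "W (\<lambda>b. pt 0 k (Suc b)) = 0"
  proof (rule fps_ext)
    fix N
    have "wsum a s (\<lambda>b. pt 0 k (Suc b)) N = wsum a s (\<lambda>b e. 0) N"
      by (rule wsum_cong) (simp add: pt_def)
    then show "W (\<lambda>b. pt 0 k (Suc b)) $ N = 0 $ N" by simp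
  qed
  moreover have "D 0 = 0" by (simp add: D_def)
  ultimately have "W (pt 0 k) = Abs_fps (\<lambda>N. if 1 \<le> N then pt 0 k 1 N else 0)"
    using W_rec[of "pt 0 k"] by simp
  also have "\<dots> = fps_X ^ k"
    by (rule fps_ext) (use k in \<open>auto simp: pt_def fps_X_power_nth\<close>)
  finally show ?thesis .
qed

lemma W_pt_Suc: "W (pt (Suc j) k) = - D (W (pt j k))"
proof -
  have "Abs_fps (\<lambda>N. if 1 \<le> N then pt (Suc j) k 1 N else 0) = 0"
    by (rule fps_ext) (simp add: pt_def)
  moreover have "(\<lambda>b. pt (Suc j) k (Suc b)) = pt j k"
    by (auto simp: fun_eq_iff pt_def)
  ultimately show ?thesis using W_rec[of "pt (Suc j) k"] by simp
qed

lemma wsum_pt_eq_0: "N \<le> j \<Longrightarrow> wsum a s (pt j k) N = 0"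
  using wsum_cong[of N "pt j k" "\<lambda>b e. 0"] by (simp add: pt_def)

text \<open>Base label and base decoration lie between 1 and \<open>N\<close>, so finitely many
  indicators \<open>pt j k\<close> exhaust all diagrams of norm \<open>N\<close>.\<close>

lemma wsum_expand:
  "wsum a s \<psi> N = (\<Sum>k\<in>{1..N}. \<Sum>j<N. \<psi> (Suc j) k * wsum a s (pt j k) N)"
proof -
  have \<psi>: "\<psi> b e = (\<Sum>k\<in>{1..N}. \<Sum>j<N. \<psi> (Suc j) k * pt j k b e)" if "1 \<le> b" "b \<le> N" "1 \<le> e" "e \<le> N" for b e
  proof -
    have "(\<Sum>k\<in>{1..N}. \<Sum>j<N. \<psi> (Suc j) k * pt j k b e) =
        (\<Sum>k\<in>{1..N}. \<Sum>j<N. if k = e then if j = b - 1 then \<psi> b e else 0 else 0)"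
      using that by (intro sum.cong refl) (auto simp: pt_def)
    also have "\<dots> = (\<Sum>k\<in>{1..N}. if k = e then \<psi> b e else 0)"
    proof (intro sum.cong refl)
      have "b - 1 < N" using that by simp
      then show "(\<Sum>j<N. if k = e then if j = b - 1 then \<psi> b e else 0 else 0) = (if k = e then \<psi> b e else 0)" for k
        by (simp add: sum.delta)
    qed
    also have "\<dots> = \<psi> b e" using that by (simp add: sum.delta)
    finally show ?thesis by simp
  qed
  have "wsum a s \<psi> N = wsum a s (\<lambda>b e. \<Sum>k\<in>{1..N}. \<Sum>j<N. \<psi> (Suc j) k * pt j k b e) N"
    by (rule wsum_cong) (rule \<psi>)
  also have "\<dots> = (\<Sum>(S, d)\<in>ddiag N. \<Sum>k\<in>{1..N}. \<Sum>j<N.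
      \<psi> (Suc j) k * (cd_weight s S d * ahat a S d * pt j k (base S) (d (base S))))"
    unfolding wsum_def by (intro sum.cong) (auto simp: sum_distrib_left mult_ac)
  also have "\<dots> = (\<Sum>k\<in>{1..N}. \<Sum>j<N. \<Sum>(S, d)\<in>ddiag N.
      \<psi> (Suc j) k * (cd_weight s S d * ahat a S d * pt j k (base S) (d (base S))))"
    unfolding case_prod_beta' by (subst sum.swap) (intro sum.cong refl sum.swap)
  also have "\<dots> = (\<Sum>k\<in>{1..N}. \<Sum>j<N. \<psi> (Suc j) k * wsum a s (pt j k) N)"
    unfolding wsum_def sum_distrib_left by (simp add: case_prod_beta')
  finally show ?thesis .
qed

definition DL :: "'a poly fps \<Rightarrow> 'a poly fps" where
  "DL Y = Abs_fps (\<lambda>N. [:g $ N:]) * (Y - of_int s * (fps_X * fps_deriv Y))"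

lemma lcoef_DL: "lcoef j (DL Y) = D (lcoef j Y)"
proof (rule fps_ext)
  fix N
  have c: "coeff (Y $ (N - i) - of_int s * (of_nat (N - i) * Y $ (N - i))) j =
      (1 - of_int (s * int (N - i))) * lcoef j Y $ (N - i)" for i
    by (simp add: of_int_poly of_nat_poly algebra_simps)
  have "lcoef j (DL Y) $ N = (\<Sum>i\<le>N. g $ i * coeff (Y $ (N - i) - of_int s * (of_nat (N - i) * Y $ (N - i))) j)"
    by (simp add: DL_def fps_mult_nth[of "Abs_fps _"] atLeast0AtMost fps_mult_fps_X_deriv_shift
        fps_of_int[symmetric] coeff_sum)
  then show "lcoef j (DL Y) $ N = D (lcoef j Y) $ N" unfolding c by (simp only: D_nth)
qed

text \<open>Comparing powers of L expresses \<open>j + 1\<close> times the next coefficient as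
  \<open>D\<close> of the current one; dividing by \<open>j + 1\<close> determines all of them. The
  sign turns \<open>D\<close> into the \<open>- D\<close> of \<open>W_pt_Suc\<close>.\<close>

lemma flow_coeffs:
  assumes flow: "dL Y = DL Y" and init: "lcoef 0 Y = fps_X ^ k" and k: "1 \<le> k"
  shows "lcoef j Y = fps_const ((- 1) ^ j * qinv (fact j)) * W (pt j k)"
proof (induction j)
  case 0
  have "qinv (Suc 0) = (1 :: 'a)" by (rule qinv_one[OF Qalg])
  then show ?case by (simp add: init W_pt_0[OF k])
next
  case (Suc j)
  have "fps_const (of_nat (Suc j)) * lcoef (Suc j) Y = lcoef j (dL Y)"
    unfolding lcoef_dL fps_of_nat ..
  also have "\<dots> = D (lcoef j Y)" unfolding flow lcoef_DL ..
  also have "\<dots> = fps_const ((- 1) ^ j * qinv (fact j)) * D (W (pt j k))"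
    unfolding Suc.IH D_const ..
  also have "\<dots> = fps_const ((- 1) ^ Suc j * qinv (fact j)) * W (pt (Suc j) k)"
    unfolding W_pt_Suc by (simp add: fps_const_neg[symmetric] del: fps_const_neg)
  finally have eq: "fps_const (of_nat (Suc j)) * lcoef (Suc j) Y =
      fps_const ((- 1) ^ Suc j * qinv (fact j)) * W (pt (Suc j) k)" .
  have "lcoef (Suc j) Y = fps_const (of_nat (Suc j) * qinv (Suc j)) * lcoef (Suc j) Y"
    by (simp only: qinvR zero_less_Suc fps_const_1_eq_1 mult_1)
  also have "\<dots> = fps_const (qinv (Suc j)) * (fps_const (of_nat (Suc j)) * lcoef (Suc j) Y)"
    by (simp only: fps_const_mult[symmetric] mult_ac)
  also have "\<dots> = fps_const (qinv (Suc j) * ((- 1) ^ Suc j * qinv (fact j))) * W (pt (Suc j) k)"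
    unfolding eq by (simp only: fps_const_mult[symmetric] mult_ac)
  also have "qinv (Suc j) * ((- 1) ^ Suc j * qinv (fact j)) =
      (of_nat (Suc j) * qinv (Suc j)) * ((- 1) ^ Suc j * qinv (fact (Suc j)) :: 'a)"
    unfolding qinvF[of j, symmetric] by (simp only: mult_ac)
  also have "\<dots> = (- 1) ^ Suc j * qinv (fact (Suc j))"
    by (simp only: qinvR zero_less_Suc mult_1)
  finally show ?case .
qed

text \<open>The base factor attached to L^m in G; its cut-off is the condition that the base label
  is at least \<open>m\<close>.\<close>

definition psi :: "nat \<Rightarrow> nat \<Rightarrow> nat \<Rightarrow> 'a" where
  "psi m b e = (if m \<le> b then a e (b - m) else 0)"

lemma coeff_polyL_power: "coeff ((- polyL) ^ k * p) m = (if k \<le> m then (- 1) ^ k * coeff p (m - k) else (0 :: 'a))"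
proof -
  have "- polyL = monom (- 1 :: 'a) 1" by (simp add: monom_altdef)
  then have "(- polyL) ^ k = monom ((- 1 :: 'a) ^ k) k" by (simp only: monom_power mult_1)
  then show ?thesis by (simp add: coeff_monom_mult)
qed

text \<open>The sum in \<open>Gser\<close> stops at \<open>N\<close>; larger \<open>m\<close> may be
  included since no diagram of norm \<open>N\<close> has a base label above
  \<open>N\<close>.\<close>

lemma coeff_Gser:
  "coeff (Gser a s $ N) m = (if N = 0 \<and> m = 0 then 1 else 0) -
     (if 1 \<le> m then (- 1) ^ m * qinv (fact m) * wsum a s (psi m) N else 0)"
proof -
  have "coeff (Gser a s $ N) m = (if N = 0 \<and> m = 0 then 1 else 0) -
     (\<Sum>k\<in>{1..N}. coeff ((- polyL) ^ k * smult (qinv (fact k)) [:wsum a s (psi k) N:]) m)"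
    unfolding Gser_def sum_Rdec psi_def[abs_def] by (auto simp: coeff_sum coeff_1)
  also have "(\<Sum>k\<in>{1..N}. coeff ((- polyL) ^ k * smult (qinv (fact k)) [:wsum a s (psi k) N:]) m) =
      (\<Sum>k\<in>{1..N}. if k = m then (- 1) ^ m * (qinv (fact m) * wsum a s (psi m) N) else 0)"
    unfolding coeff_polyL_power by (intro sum.cong) (auto simp: coeff_pCons split: nat.split)
  also have "\<dots> = (if 1 \<le> m then (- 1) ^ m * qinv (fact m) * wsum a s (psi m) N else 0)"
  proof (cases "m \<le> N")
    case False
    then have "wsum a s (psi m) N = 0"
      using wsum_cong[of N "psi m" "\<lambda>b e. 0"] by (simp add: psi_def)
    then show ?thesis by simp
  qed (simp add: sum.delta mult.assoc)
  finally show ?thesis .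
qed

lemma lcoef_Gser_0: "lcoef 0 (Gser a s) = 1"
  by (rule fps_ext) (simp add: coeff_Gser)

lemma lcoef_Gser: "1 \<le> m \<Longrightarrow> lcoef m (Gser a s) = fps_const (- ((- 1) ^ m * qinv (fact m))) * W (psi m)"
  by (rule fps_ext) (simp add: coeff_Gser)

lemma W_psi_1: "W (psi 1) = g"
  unfolding g_def by (rule fps_ext) (auto simp: psi_def intro!: wsum_cong)

text \<open>One-chord diagrams have base label 1, below the cut-off \<open>Suc m\<close>, so only
  the shift by \<open>- D\<close> remains.\<close>

lemma W_psi_Suc: "1 \<le> m \<Longrightarrow> W (psi (Suc m)) = - D (W (psi m))"
proof -
  assume m: "1 \<le> m"
  have "Abs_fps (\<lambda>N. if 1 \<le> N then psi (Suc m) 1 N else 0) = 0"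
    by (rule fps_ext) (use m in \<open>simp add: psi_def\<close>)
  moreover have "(\<lambda>b. psi (Suc m) (Suc b)) = psi m"
    by (auto simp: fun_eq_iff psi_def)
  ultimately show ?thesis using W_rec[of "psi (Suc m)"] by simp
qed

text \<open>Degree 0 in L is special because of the constant 1 in G: there the equation reads
  \<open>g = D 1\<close>. In higher degree it is \<open>W_psi_Suc\<close> with the factorials
  adjusted.\<close>

lemma Gser_flow: "dL (Gser a s) = DL (Gser a s)"
proof (rule lcoef_ext)
  fix j
  show "lcoef j (dL (Gser a s)) = lcoef j (DL (Gser a s))"
  proof (cases "j = 0")
    case True
    have "qinv (Suc 0) = (1 :: 'a)" by (rule qinv_one[OF Qalg])
    then have "lcoef 1 (Gser a s) = g" using lcoef_Gser[of 1] W_psi_1 by simp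
    moreover have "D 1 = g" by (simp add: D_def)
    ultimately show ?thesis unfolding lcoef_dL lcoef_DL True lcoef_Gser_0 by simp
  next
    case False
    then have j: "1 \<le> j" by simp
    have "of_nat (Suc j) * lcoef (Suc j) (Gser a s) =
        fps_const (- ((- 1) ^ Suc j * (of_nat (Suc j) * qinv (fact (Suc j))))) * W (psi (Suc j))"
      unfolding lcoef_Gser[OF le_add1[of 1 j, unfolded plus_1_eq_Suc]] fps_of_nat[symmetric] mult.assoc[symmetric] fps_const_mult
      by (simp only: mult_minus_right mult_ac)
    also have "\<dots> = fps_const (- ((- 1) ^ j * qinv (fact j))) * D (W (psi j))"
      unfolding qinvF W_psi_Suc[OF j] by (simp add: fps_const_neg[symmetric] del: fps_const_neg)
    also have "\<dots> = D (lcoef j (Gser a s))" unfolding lcoef_Gser[OF j] D_const ..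
    finally show ?thesis unfolding lcoef_dL lcoef_DL .
  qed
qed

lemma Gser_nth_0: "Gser a s $ 0 = 1"
  by (rule poly_eqI) (simp add: coeff_Gser wsum_0 coeff_1)

lemma lcoef_0_ipow: "lcoef 0 (fps_ipow (Gser a s) \<alpha>) = 1"
proof (rule fps_ext)
  fix N
  have "lcoef 0 (Gser a s - 1) = 0"
    by (rule fps_ext) (simp add: coeff_Gser coeff_1)
  then have p: "coeff (((Gser a s - 1) ^ n) $ N) 0 = (if n = 0 \<and> N = 0 then 1 else 0)" for n
    using arg_cong[OF lcoef_0_power[of "Gser a s - 1" n], of "\<lambda>f. f $ N"] by (cases n) auto
  have "lcoef 0 (fps_ipow (Gser a s) \<alpha>) $ N =
      (\<Sum>n\<le>N. coeff (abinom \<alpha> n) 0 * coeff (((Gser a s - 1) ^ n) $ N) 0)"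
    by (simp add: fps_ipow_def coeff_sum coeff_mult_0)
  also have "\<dots> = (\<Sum>n\<le>N. if n = 0 then if N = 0 then 1 else 0 else 0)"
    unfolding p by (intro sum.cong) (simp_all add: abinom_0[OF Qalg_poly])
  also have "\<dots> = 1 $ N" by (simp add: sum.delta)
  finally show "lcoef 0 (fps_ipow (Gser a s) \<alpha>) $ N = 1 $ N" .
qed

lemma lcoef_0_X_power: "lcoef 0 (fps_X ^ k) = fps_X ^ k"
  by (rule fps_ext) (simp add: fps_X_power_nth)

text \<open>\<open>x\<^sup>k G\<^sup>1\<^sup>-\<^sup>s\<^sup>k\<close> satisfies the same flow equation as \<open>G\<close>; the exponent is forced by
  \<open>s x \<partial>\<^sub>x\<close> acting on \<open>x\<^sup>k\<close>.\<close>
lemma ipow_flow: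
  fixes k :: nat
  defines "Y \<equiv> fps_X ^ k * fps_ipow (Gser a s) (1 - s * int k)"
  shows "dL Y = DL Y" "lcoef 0 Y = fps_X ^ k"
proof -
  let ?G = "Gser a s" and ?\<alpha> = "1 - s * int k"
  let ?F = "fps_ipow ?G ?\<alpha>" and ?X = "fps_X ^ k :: 'a poly fps"
  let ?\<theta> = "\<lambda>f :: 'a poly fps. fps_X * fps_deriv f"
  let ?g = "Abs_fps (\<lambda>N. [:g $ N:])"
  have F1: "?G * dL ?F = of_int ?\<alpha> * dL ?G * ?F"
    by (rule dL.fps_ipow_deriv[OF Qalg_poly Gser_nth_0]) (auto intro!: fps_ext simp: dL_def abinom_poly)
  have F2: "?G * ?\<theta> ?F = of_int ?\<alpha> * ?\<theta> ?G * ?F"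
    by (rule theta.fps_ipow_deriv[OF Qalg_poly Gser_nth_0]) simp_all
  have X1: "dL ?X = 0"
    by (rule fps_ext) (simp add: dL_def fps_X_power_nth one_pCons del: pCons_one)
  have X2: "?\<theta> ?X = of_nat k * ?X"
    by (rule fps_ext) (simp add: fps_mult_fps_X_deriv_shift fps_X_power_nth fps_of_nat[symmetric])
  have \<alpha>: "of_int ?\<alpha> = (1 - of_int s * of_nat k :: 'a poly fps)" by simp
  have "?G * dL Y = ?X * (?G * dL ?F)"
    unfolding Y_def dL.mult X1 by (simp add: mult_ac)
  also have "\<dots> = ?X * (of_int ?\<alpha> * (?g * (?G - of_int s * ?\<theta> ?G)) * ?F)"
    unfolding F1 Gser_flow DL_def ..
  \<comment> \<open>As the exponent plus \<open>s * k\<close> is 1, the term without derivative can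
    be completed to a full copy at the cost of \<open>s * k\<close> copies, which are the derivative
    of x^k; with the derivative of the power they form the product rule for
    \<open>Y\<close>.\<close>
  also have "\<dots> = ?g * (?G * ?X * ?F - of_int s * (?X * (of_int ?\<alpha> * ?\<theta> ?G * ?F) + of_nat k * ?X * (?G * ?F)))"
    unfolding \<alpha> by (simp add: algebra_simps)
  also have "\<dots> = ?g * (?G * ?X * ?F - of_int s * (?X * (?G * ?\<theta> ?F) + ?\<theta> ?X * (?G * ?F)))"
    unfolding F2 X2 ..
  also have "\<dots> = ?G * DL Y"
    unfolding DL_def Y_def theta.mult by (simp only: algebra_simps)
  finally show "dL Y = DL Y" by (rule fps_cancel_left[OF Gser_nth_0])
  show "lcoef 0 Y = fps_X ^ k"
    unfolding Y_def lcoef_0_mult lcoef_0_ipow lcoef_0_X_power by simp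
qed

lemma coeff_ipow:
  assumes "1 \<le> k" "k \<le> N"
  shows "coeff (fps_ipow (Gser a s) (1 - s * int k) $ (N - k)) j = (- 1) ^ j * qinv (fact j) * wsum a s (pt j k) N"
proof -
  let ?Y = "fps_X ^ k * fps_ipow (Gser a s) (1 - s * int k)"
  have "?Y $ N = fps_ipow (Gser a s) (1 - s * int k) $ (N - k)"
    using assms by (simp add: fps_X_power_mult_nth)
  then have "coeff (fps_ipow (Gser a s) (1 - s * int k) $ (N - k)) j = lcoef j ?Y $ N" by simp
  also have "\<dots> = (- 1) ^ j * qinv (fact j) * wsum a s (pt j k) N"
    by (simp add: flow_coeffs[OF ipow_flow assms(1)] del: lcoef_nth)
  finally show ?thesis .
qed

text \<open>The simple pole shifts the index from \<open>j\<close> to \<open>Suc j\<close>, and only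
  the term of order \<open>m\<close> of the exponential carries L^m. What remains is
  \<open>psi m\<close> at base label \<open>j + 1\<close> and base decoration \<open>k\<close>, the
  data singled out by \<open>pt j k\<close>.\<close>

lemma coeff_kernel:
  "coeff (fls_nth (fps_to_fls expm1L * Fk a k) (int j)) m =
     (if 1 \<le> m then (- 1) ^ m * qinv (fact m) * psi m (Suc j) k else 0)"
proof -
  let ?A = "Abs_fps (\<lambda>l. [:a k l:])"
  have "fps_to_fls expm1L * Fk a k = fls_shift 1 (fps_to_fls (expm1L * ?A))"
    unfolding Fk_def fls_shifted_times_simps fls_times_fps_to_fls ..
  then have "fls_nth (fps_to_fls expm1L * Fk a k) (int j) = (expm1L * ?A) $ Suc j"
    by (simp add: nat_add_distrib)
  also have "coeff \<dots> m = (\<Sum>i\<le>Suc j. coeff (expm1L $ i * [:a k (Suc j - i):]) m)"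
    by (simp add: fps_mult_nth coeff_sum atLeast0AtMost del: sum.atMost_Suc)
  also have "\<dots> = (\<Sum>i\<le>Suc j. if i = m then if 1 \<le> m then (- 1) ^ m * qinv (fact m) * a k (Suc j - m) else 0 else 0)"
  proof (intro sum.cong refl)
    fix i
    have "expm1L $ i * [:a k (Suc j - i):] =
        (if i = 0 then 0 else (- polyL) ^ i * [:qinv (fact i) * a k (Suc j - i):])"
      by (simp add: expm1L_def mult_ac)
    then have "coeff (expm1L $ i * [:a k (Suc j - i):]) m =
        (if i = 0 then 0 else if i \<le> m then (- 1) ^ i * coeff [:qinv (fact i) * a k (Suc j - i):] (m - i) else 0)"
      by (cases "i = 0") (simp_all only: coeff_polyL_power coeff_0 simp_thms if_True if_False)
    then show "coeff (expm1L $ i * [:a k (Suc j - i):]) m =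
        (if i = m then if 1 \<le> m then (- 1) ^ m * qinv (fact m) * a k (Suc j - m) else 0 else 0)"
      by (auto simp only: coeff_pCons coeff_0 mult_zero_right mult.assoc split: nat.split if_split)
  qed
  also have "\<dots> = (if 1 \<le> m then (- 1) ^ m * qinv (fact m) * psi m (Suc j) k else 0)"
    by (simp add: sum.delta psi_def del: sum.atMost_Suc)
  finally show ?thesis .
qed

text \<open>The sign and factorial from applying the operator cancel those in
  \<open>coeff_ipow\<close>.\<close>

lemma apply_op_ipow:
  assumes "1 \<le> k" "k \<le> N"
  shows "apply_op (fps_ipow (Gser a s) (1 - s * int k)) h $ (N - k) =
    (\<Sum>j<N. smult (wsum a s (pt j k) N) (fls_nth h (int j)))"
proof -
  let ?p = "fps_ipow (Gser a s) (1 - s * int k) $ (N - k)"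
  have c: "coeff ?p j * (- 1) ^ j * of_nat (fact j) = wsum a s (pt j k) N" for j
  proof -
    have "coeff ?p j * (- 1) ^ j * of_nat (fact j) =
        ((- 1) ^ j * (- 1) ^ j) * (of_nat (fact j) * qinv (fact j)) * wsum a s (pt j k) N"
      unfolding coeff_ipow[OF assms] by (simp only: mult_ac)
    also have "of_nat (fact j) * qinv (fact j) = (1 :: 'a)" by (rule qinvR) simp
    finally show ?thesis by (simp add: power_add[symmetric])
  qed
  have "apply_op (fps_ipow (Gser a s) (1 - s * int k)) h $ (N - k) =
      (\<Sum>j\<le>degree ?p. smult (wsum a s (pt j k) N) (fls_nth h (int j)))"
    unfolding apply_op_def fps_nth_Abs_fps c ..
  \<comment> \<open>Either of the degree of \<open>?p\<close> and \<open>N\<close> may be the larger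
    bound, so both sums are extended by zeros to a common range.\<close>
  also have "\<dots> = (\<Sum>j\<le>degree ?p + N. smult (wsum a s (pt j k) N) (fls_nth h (int j)))"
    by (rule sum.mono_neutral_left) (auto simp: c[symmetric] coeff_eq_0)
  also have "\<dots> = (\<Sum>j<N. smult (wsum a s (pt j k) N) (fls_nth h (int j)))"
    by (rule sum.mono_neutral_right) (auto simp: wsum_pt_eq_0)
  finally show ?thesis .
qed

text \<open>In each power of L both sides sum the same diagrams, on the right sorted by base label
  and base decoration as in \<open>wsum_expand\<close>.\<close>

lemma dyson_schwinger:
  "Gser a s $ N = (if N = 0 then 1 else 0) -
     (\<Sum>k\<in>{1..N}. apply_op (fps_ipow (Gser a s) (1 - s * int k)) (fps_to_fls expm1L * Fk a k) $ (N - k))"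
proof (rule poly_eqI)
  fix m
  have "coeff (\<Sum>k\<in>{1..N}. apply_op (fps_ipow (Gser a s) (1 - s * int k)) (fps_to_fls expm1L * Fk a k) $ (N - k)) m =
      (\<Sum>k\<in>{1..N}. \<Sum>j<N. wsum a s (pt j k) N *
        (if 1 \<le> m then (- 1) ^ m * qinv (fact m) * psi m (Suc j) k else 0))"
    unfolding coeff_sum by (intro sum.cong refl) (simp add: apply_op_ipow coeff_sum coeff_kernel)
  also have "\<dots> = (if 1 \<le> m then (- 1) ^ m * qinv (fact m) * wsum a s (psi m) N else 0)"
    unfolding wsum_expand[of "psi m"] by (simp add: sum_distrib_left mult_ac)
  finally show "coeff (Gser a s $ N) m = coeff ((if N = 0 then 1 else 0) -
     (\<Sum>k\<in>{1..N}. apply_op (fps_ipow (Gser a s) (1 - s * int k)) (fps_to_fls expm1L * Fk a k) $ (N - k))) m"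
    unfolding coeff_Gser by (simp add: coeff_1)
qed

end

theorem mainTheorem1:
  fixes a :: "nat \<Rightarrow> nat \<Rightarrow> 'a::comm_ring_1" and s :: int
  assumes Qalg: "\<And>n::nat. n > 0 \<Longrightarrow> (of_nat n :: 'a) dvd 1"
  shows "\<forall>N. Gser a s $ N =
           (if N = 0 then 1 else 0) -
           (\<Sum>k\<in>{1..N}. apply_op (fps_ipow (Gser a s) (1 - s * int k))
                                   (fps_to_fls expm1L * Fk a k) $ (N - k))"
proof -
  interpret dse a s by unfold_locales (rule Qalg)
  show ?thesis using dyson_schwinger by blast
qed

end
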